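(* Let $\lambda_1>\lambda_2>0$. Up to isometries of the ambient space, all constant mean curvature (CMC) surfaces in $(\widetilde{\mathrm E}(2), g(\lambda_1,\lambda_2))$ with vertically harmonic (tangential) Gauss map can be locally parametrized as $$f:U\subseteq\mathbb R^2\to\widetilde{\mathrm E}(2):(u,v)\mapsto\begin{pmatrix}1&0&u\\0&1&v\\0&0&1\end{pmatrix},$$ i.e. $f(u,v)=(u,v,0)$ in the coordinates $(x,y,z)$ of $\widetilde{\mathrm E}(2)$. All these surfaces are minimal and their Gauss map is harmonic.
   Context: **The group $\widetilde{\mathrm E}(2)$ and its metrics.** $\widetilde{\mathrm E}(2)$ is the universal covering of the group $\mathrm E(2)$ of matrices $\begin{pmatrix}\cos\theta&-\sin\theta&x\\ \sin\theta&\cos\theta&y\\0&0&1\end{pmatrix}$, $x,y\in\mathbb R$, $\theta\in\mathbb S^1$. It is $\mathbb R^3$ with coordinates $(x,y,z)$ and group operation $(x,y,z)*(\overline x,\overline y,\overline z)=(x+\overline x\cos z-\overline y\sin z,\ y+\overline x\sin z+\overline y\cos z,\ z+\overline z)$. For $\lambda_1,\lambda_2,\lambda_3>0$ consider the left-invariant frame $e_1=\frac1{\lambda_2}(-\sin z\,\partial_x+\cos z\,\partial_y)$, $e_2=\frac1{\lambda_3}\partial_z$, $e_3=\frac1{\lambda_1}(\cos z\,\partial_x+\sin z\,\partial_y)$, and let $g_{(\lambda_1,\lambda_2,\lambda_3)}$ be the left-invariant metric for which it is orthonormal, i.e. $$g_{(\lambda_1,\lambda_2,\lambda_3)}=\lambda_1^2(\cos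 z\,dx+\sin z\,dy)^2+\lambda_2^2(-\sin z\,dx+\cos z\,dy)^2+\lambda_3^2\,dz^2.$$ Put $g(\lambda_1,\lambda_2)=g_{(\lambda_1,\lambda_2,1/(\lambda_1\lambda_2))}$. **CMC surfaces.** A surface $f:M^2\to Q^3$ in a Riemannian $3$-manifold is an isometric immersion (so $M^2$ carries the induced metric) with unit normal $N$. Its second fundamental form $h$ is defined by $\nabla^Q_{\mathrm df(X)}\mathrm df(Y)=\mathrm df(\nabla^M_XY)+h(X,Y)N$, and the mean curvature is $H=\mathrm{tr}\,h$. The surface is CMC if $H$ is constant and minimal if $H\equiv 0$ (so a minimal surface is CMC). **Gauss map.** For a Riemannian $3$-manifold $(Q^3,g_Q)$, let $\pi:\mathrm{Gr}_2(TQ^3)\to Q^3$ be the Grassmannian bundle whose fibre over $q$ is the Grassmannian of $2$-planes in $T_qQ^3$. It carries the natural invariant metric induced by the canonical $1$-form of the orthonormal frame bundle and the Levi-Civita connection: the horizontal distribution determined by the Levi-Civita connection is orthogonal to the fibres and is mapped isometrically by $\mathrm d\pi$, and each fibre has the standard $\mathrm O(3)$-invariant metric (with a fixed normalization). Then $\pi$ is a Riemannian submersion with totally geodesic fibres. The (tangential) Gauss map of $f$ is $\psi:M^2\to \mathrm{Gr}_2(TQ^3)$, $\psi(p)=\mathrm df_p(T_pM^2)$. **(Vertical) harmonicity.** For a smooth map $\phi:(M,g_M)\to(P,g_P)$, the tension field is $\tau(\phi)=\mathrm{tr}_{g_M}(\nabla\mathrm d\phi)$, where $\nabla\mathrm d\phi(X,Y)=\nabla^P_{\mathrm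 d\phi(X)}\mathrm d\phi(Y)-\mathrm d\phi(\nabla^M_XY)$; $\phi$ is harmonic if and only if $\tau(\phi)=0$. If $\pi:P\to Q$ is a Riemannian submersion, $\phi$ is vertically harmonic if the component of $\tau(\phi)$ in $\ker \mathrm d\pi$ (the vertical component with respect to the orthogonal splitting of $TP$) vanishes. *)

theory Defs
  imports "HOL-Analysis.Analysis"
begin

section \<open>Smooth maps and Riemannian metrics in coordinates\<close>

definition dirderiv :: "('a::euclidean_space \<Rightarrow> 'b::euclidean_space) \<Rightarrow> 'a \<Rightarrow> 'a \<Rightarrow> 'b"
  where "dirderiv f p X = frechet_derivative f (at p) X"

primrec Ck_on :: "nat \<Rightarrow> 'a::euclidean_space set \<Rightarrow> ('a \<Rightarrow> 'b::euclidean_space) \<Rightarrow> bool" where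
  "Ck_on 0 S f \<longleftrightarrow> continuous_on S f"
| "Ck_on (Suc k) S f \<longleftrightarrow>
     (\<forall>p\<in>S. f differentiable (at p)) \<and> (\<forall>X. Ck_on k S (\<lambda>p. dirderiv f p X))"

text \<open>Only used for open \<open>S\<close>.\<close>

definition smooth_on :: "'a::euclidean_space set \<Rightarrow> ('a \<Rightarrow> 'b::euclidean_space) \<Rightarrow> bool"
  where "smooth_on S f \<longleftrightarrow> (\<forall>k. Ck_on k S f)"

text \<open>A metric assigns to every point an inner product; vectors are coordinate vectors.\<close>

type_synonym 'a metric_field = "'a \<Rightarrow> 'a \<Rightarrow> 'a \<Rightarrow> real"

text \<open>The Koszul formula for constant (hence commuting) vector fields determines the
  Levi-Civita connection: \<open>\<nabla>\<close> in direction \<open>X\<close> of a field \<open>Y\<close> is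
  \<open>dirderiv Y p X + christoffel g p X (Y p)\<close>.\<close>

definition christoffel :: "'a::euclidean_space metric_field \<Rightarrow> 'a \<Rightarrow> 'a \<Rightarrow> 'a \<Rightarrow> 'a"
  where "christoffel g p X Y =
    (THE Z. \<forall>W. 2 * g p Z W =
        dirderiv (\<lambda>q. g q Y W) p X + dirderiv (\<lambda>q. g q X W) p Y - dirderiv (\<lambda>q. g q X Y) p W)"

text \<open>\<open>(\<nabla>d\<phi>)(X,Y)\<close> for constant coordinate fields \<open>X\<close>, \<open>Y\<close>.\<close>

definition cov_hessian ::
  "'a::euclidean_space metric_field \<Rightarrow> 'b::euclidean_space metric_field \<Rightarrow> ('a \<Rightarrow> 'b) \<Rightarrow> 'a \<Rightarrow> 'a \<Rightarrow> 'a \<Rightarrow> 'b"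
  where "cov_hessian gM gP \<phi> u X Y =
     dirderiv (\<lambda>v. dirderiv \<phi> v Y) u X
     + christoffel gP (\<phi> u) (dirderiv \<phi> u X) (dirderiv \<phi> u Y)
     - dirderiv \<phi> u (christoffel gM u X Y)"

text \<open>The trace \<open>G\<^sup>i\<^sup>j B\<^sub>i\<^sub>j\<close> of a bilinear form with components \<open>B\<close> in a basis with Gram matrix \<open>G\<close>.\<close>

definition gram_trace :: "real^'n^'n \<Rightarrow> ('n::finite \<Rightarrow> 'n \<Rightarrow> 'b::real_vector) \<Rightarrow> 'b"
  where "gram_trace G B = (\<Sum>i\<in>UNIV. \<Sum>j\<in>UNIV. (matrix_inv G $ i $ j) *\<^sub>R B i j)"

definition gram :: "(real^'n) metric_field \<Rightarrow> real^'n \<Rightarrow> real^'n^'n"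
  where "gram g u = (\<chi> i j. g u (axis i 1) (axis j 1))"

definition tension ::
  "(real^'n) metric_field \<Rightarrow> 'b::euclidean_space metric_field \<Rightarrow> (real^'n \<Rightarrow> 'b) \<Rightarrow> real^'n \<Rightarrow> 'b"
  where "tension gM gP \<phi> u =
    gram_trace (gram gM u) (\<lambda>i j. cov_hessian gM gP \<phi> u (axis i 1) (axis j 1))"

definition orth_proj :: "('a::real_vector \<Rightarrow> 'a \<Rightarrow> real) \<Rightarrow> 'a set \<Rightarrow> 'a \<Rightarrow> 'a"
  where "orth_proj h W x = (THE y. y \<in> W \<and> (\<forall>w\<in>W. h (x - y) w = 0))"

definition vertical_component ::
  "'p::euclidean_space metric_field \<Rightarrow> ('p \<Rightarrow> 'q::euclidean_space) \<Rightarrow> 'p \<Rightarrow> 'p \<Rightarrow> 'p"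
  where "vertical_component G \<pi> p v = orth_proj (G p) {w. dirderiv \<pi> p w = 0} v"

definition riemannian_isometry :: "'a::euclidean_space metric_field \<Rightarrow> ('a \<Rightarrow> 'a) \<Rightarrow> bool"
  where "riemannian_isometry g \<Phi> \<longleftrightarrow>
    bij \<Phi> \<and> smooth_on UNIV \<Phi> \<and> smooth_on UNIV (inv \<Phi>) \<and>
    (\<forall>p X Y. g (\<Phi> p) (dirderiv \<Phi> p X) (dirderiv \<Phi> p Y) = g p X Y)"


section \<open>Smooth surfaces\<close>

type_synonym 'm chart = "'m set \<times> ('m \<Rightarrow> real^2)"

definition is_chart :: "'m topology \<Rightarrow> 'm chart \<Rightarrow> bool"
  where "is_chart M c \<longleftrightarrow> (case c of (D, \<phi>) \<Rightarrow>
    openin M D \<and> open (\<phi> ` D) \<and> homeomorphic_map (subtopology M D) (top_of_set (\<phi> ` D)) \<phi>)"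

definition compatible :: "'m chart \<Rightarrow> 'm chart \<Rightarrow> bool"
  where "compatible c c' \<longleftrightarrow> (case (c, c') of ((D, \<phi>), (D', \<phi>')) \<Rightarrow>
    smooth_on (\<phi> ` (D \<inter> D')) (\<phi>' \<circ> inv_into D \<phi>) \<and>
    smooth_on (\<phi>' ` (D \<inter> D')) (\<phi> \<circ> inv_into D' \<phi>'))"

definition smooth_2manifold :: "'m topology \<Rightarrow> 'm chart set \<Rightarrow> bool"
  where "smooth_2manifold M A \<longleftrightarrow>
    Hausdorff_space M \<and> second_countable M \<and>
    (\<forall>c\<in>A. is_chart M c) \<and> (\<forall>c\<in>A. \<forall>c'\<in>A. compatible c c') \<and>
    (\<Union>c\<in>A. fst c) = topspace M"

definition smooth_chart :: "'m topology \<Rightarrow> 'm chart set \<Rightarrow> 'm chart \<Rightarrow> bool"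
  where "smooth_chart M A c \<longleftrightarrow> is_chart M c \<and> (\<forall>c'\<in>A. compatible c c')"

definition in_chart :: "'m chart \<Rightarrow> ('m \<Rightarrow> 'b) \<Rightarrow> real^2 \<Rightarrow> 'b"
  where "in_chart c f = f \<circ> inv_into (fst c) (snd c)"

definition chart_image :: "'m chart \<Rightarrow> (real^2) set"
  where "chart_image c = snd c ` fst c"


section \<open>Surfaces in a Riemannian manifold with global coordinates\<close>

definition induced_metric :: "'b::euclidean_space metric_field \<Rightarrow> ('a::euclidean_space \<Rightarrow> 'b) \<Rightarrow> 'a metric_field"
  where "induced_metric g F u X Y = g (F u) (dirderiv F u X) (dirderiv F u Y)"

text \<open>\<open>f\<close> is an immersion with smooth unit normal \<open>N\<close> (given by its coordinate vectors);
  it is isometric because \<open>M\<close> always carries the induced metric.\<close>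

definition immersed_surface ::
  "(real^3) metric_field \<Rightarrow> 'm topology \<Rightarrow> 'm chart set \<Rightarrow> ('m \<Rightarrow> real^3) \<Rightarrow> ('m \<Rightarrow> real^3) \<Rightarrow> bool"
  where "immersed_surface g M A f N \<longleftrightarrow>
    smooth_2manifold M A \<and>
    (\<forall>c\<in>A. let F = in_chart c f; n = in_chart c N in
       smooth_on (chart_image c) F \<and> smooth_on (chart_image c) n \<and>
       (\<forall>u\<in>chart_image c.
          inj (dirderiv F u) \<and>
          g (F u) (n u) (n u) = 1 \<and>
          (\<forall>X. g (F u) (dirderiv F u X) (n u) = 0)))"

text \<open>The normal coefficient of \<open>\<nabla>\<^bsub>dF X\<^esub> dF Y - dF (\<nabla>\<^bsub>X\<^esub> Y) = h(X,Y) N\<close>, with \<open>N\<close> a unit vector.\<close>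

definition second_fundamental_form ::
  "(real^3) metric_field \<Rightarrow> (real^2 \<Rightarrow> real^3) \<Rightarrow> (real^2 \<Rightarrow> real^3) \<Rightarrow> real^2 \<Rightarrow> real^2 \<Rightarrow> real^2 \<Rightarrow> real"
  where "second_fundamental_form g F n u X Y =
    g (F u) (cov_hessian (induced_metric g F) g F u X Y) (n u)"

text \<open>The trace of the second fundamental form, without a factor one half.\<close>

definition mean_curvature ::
  "(real^3) metric_field \<Rightarrow> (real^2 \<Rightarrow> real^3) \<Rightarrow> (real^2 \<Rightarrow> real^3) \<Rightarrow> real^2 \<Rightarrow> real"
  where "mean_curvature g F n u =
    gram_trace (gram (induced_metric g F) u)
      (\<lambda>i j. second_fundamental_form g F n u (axis i 1) (axis j 1))"

definition has_mean_curvature ::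
  "(real^3) metric_field \<Rightarrow> 'm chart set \<Rightarrow> ('m \<Rightarrow> real^3) \<Rightarrow> ('m \<Rightarrow> real^3) \<Rightarrow> real \<Rightarrow> bool"
  where "has_mean_curvature g A f N H \<longleftrightarrow>
    (\<forall>c\<in>A. \<forall>u\<in>chart_image c. mean_curvature g (in_chart c f) (in_chart c N) u = H)"

definition cmc ::
  "(real^3) metric_field \<Rightarrow> 'm chart set \<Rightarrow> ('m \<Rightarrow> real^3) \<Rightarrow> ('m \<Rightarrow> real^3) \<Rightarrow> bool"
  where "cmc g A f N \<longleftrightarrow> (\<exists>H. has_mean_curvature g A f N H)"

definition minimal ::
  "(real^3) metric_field \<Rightarrow> 'm chart set \<Rightarrow> ('m \<Rightarrow> real^3) \<Rightarrow> ('m \<Rightarrow> real^3) \<Rightarrow> bool"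
  where "minimal g A f N \<longleftrightarrow> has_mean_curvature g A f N 0"


section \<open>The Grassmannian bundle of tangent planes and the Gauss map\<close>

text \<open>A point of the bundle is a pair of a base point \<open>q\<close> and a two-dimensional subspace of the
  tangent space at \<open>q\<close>. A global frame \<open>E\<close> trivializes the bundle, and the three graph charts of
  the Grassmannian of a three-dimensional space, indexed by \<open>k\<close>, cover it: \<open>(q, w)\<close> stands for the
  graph over the plane of \<open>E\<^bsub>k+1\<^esub>\<close> and \<open>E\<^bsub>k+2\<^esub>\<close> (indices modulo 3) of the linear map sending these
  two vectors to \<open>w\<^sub>1 E\<^sub>k\<close> and \<open>w\<^sub>2 E\<^sub>k\<close>.\<close>

type_synonym frame = "3 \<Rightarrow> real^3 \<Rightarrow> real^3"

definition gr_bundle :: "((real^3) \<times> (real^3) set) set"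
  where "gr_bundle = {(q, V). subspace V \<and> dim V = 2}"

definition gr_basis :: "frame \<Rightarrow> 3 \<Rightarrow> (real^3) \<times> (real^2) \<Rightarrow> 2 \<Rightarrow> real^3"
  where "gr_basis E k P i =
    (if i = 1 then E (k + 1) (fst P) else E (k + 2) (fst P)) + (snd P $ i) *\<^sub>R E k (fst P)"

definition gr_plane :: "frame \<Rightarrow> 3 \<Rightarrow> (real^3) \<times> (real^2) \<Rightarrow> (real^3) set"
  where "gr_plane E k P = span (range (gr_basis E k P))"

definition gr_chart_domain :: "frame \<Rightarrow> 3 \<Rightarrow> ((real^3) \<times> (real^3) set) set"
  where "gr_chart_domain E k = {(q, V) \<in> gr_bundle. E k q \<notin> V}"

definition gr_chart :: "frame \<Rightarrow> 3 \<Rightarrow> (real^3) \<times> (real^3) set \<Rightarrow> (real^3) \<times> (real^2)"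
  where "gr_chart E k Q = (fst Q, THE w. gr_plane E k (fst Q, w) = snd Q)"

text \<open>The vertical part of a tangent vector at \<open>V\<close> is the homomorphism from \<open>V\<close> to its orthogonal
  complement that maps \<open>v\<close> to the normal part of the covariant derivative of any section of
  planes extending \<open>v\<close>. This gives its value on the \<open>i\<close>-th basis vector of \<open>V\<close>.\<close>

definition gr_vertical ::
  "(real^3) metric_field \<Rightarrow> frame \<Rightarrow> 3 \<Rightarrow> (real^3) \<times> (real^2) \<Rightarrow> (real^3) \<times> (real^2) \<Rightarrow> 2 \<Rightarrow> real^3"
  where "gr_vertical g E k P \<xi> i =
    (let Db = dirderiv (\<lambda>P'. gr_basis E k P' i) P \<xi>
              + christoffel g (fst P) (fst \<xi>) (gr_basis E k P i)
     in Db - orth_proj (g (fst P)) (gr_plane E k P) Db)"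

text \<open>The chart expression of the natural metric: horizontally the metric of the base, vertically
  \<open>\<kappa>\<close> times the Hilbert-Schmidt inner product of homomorphisms. Up to the normalization \<open>\<kappa> > 0\<close>
  the latter is the only \<open>O(3)\<close>-invariant metric on the fibres.\<close>

definition gr_metric ::
  "(real^3) metric_field \<Rightarrow> real \<Rightarrow> frame \<Rightarrow> 3 \<Rightarrow> ((real^3) \<times> (real^2)) metric_field"
  where "gr_metric g \<kappa> E k P \<xi> \<eta> =
    g (fst P) (fst \<xi>) (fst \<eta>)
    + \<kappa> * gram_trace (\<chi> i j. g (fst P) (gr_basis E k P i) (gr_basis E k P j))
            (\<lambda>i j. g (fst P) (gr_vertical g E k P \<xi> i) (gr_vertical g E k P \<eta> j))"

definition gauss_map :: "(real^2 \<Rightarrow> real^3) \<Rightarrow> real^2 \<Rightarrow> (real^3) \<times> (real^3) set"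
  where "gauss_map F u = (F u, range (dirderiv F u))"

definition gauss_tension ::
  "(real^3) metric_field \<Rightarrow> real \<Rightarrow> frame \<Rightarrow> 3 \<Rightarrow> (real^2 \<Rightarrow> real^3) \<Rightarrow> real^2 \<Rightarrow> (real^3) \<times> (real^2)"
  where "gauss_tension g \<kappa> E k F u =
    tension (induced_metric g F) (gr_metric g \<kappa> E k) (gr_chart E k \<circ> gauss_map F) u"

definition harmonic_gauss_map ::
  "(real^3) metric_field \<Rightarrow> real \<Rightarrow> frame \<Rightarrow> 'm chart set \<Rightarrow> ('m \<Rightarrow> real^3) \<Rightarrow> bool"
  where "harmonic_gauss_map g \<kappa> E A f \<longleftrightarrow>
    (\<forall>c\<in>A. let F = in_chart c f in
      \<forall>u\<in>chart_image c. \<forall>k. gauss_map F u \<in> gr_chart_domain E k \<longrightarrow>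
        gauss_tension g \<kappa> E k F u = 0)"

text \<open>In every chart of the bundle the projection to the base is \<open>fst\<close>.\<close>

definition vertically_harmonic_gauss_map ::
  "(real^3) metric_field \<Rightarrow> real \<Rightarrow> frame \<Rightarrow> 'm chart set \<Rightarrow> ('m \<Rightarrow> real^3) \<Rightarrow> bool"
  where "vertically_harmonic_gauss_map g \<kappa> E A f \<longleftrightarrow>
    (\<forall>c\<in>A. let F = in_chart c f in
      \<forall>u\<in>chart_image c. \<forall>k. gauss_map F u \<in> gr_chart_domain E k \<longrightarrow>
        vertical_component (gr_metric g \<kappa> E k) fst (gr_chart E k (gauss_map F u))
          (gauss_tension g \<kappa> E k F u) = 0)"


section \<open>The universal cover of the group of rigid motions of the plane\<close>

definition E2_frame :: "real \<Rightarrow> real \<Rightarrow> real \<Rightarrow> frame"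
  where "E2_frame l1 l2 l3 i p =
    (if i = 1 then (1 / l2) *\<^sub>R vector [- sin (p$3), cos (p$3), 0]
     else if i = 2 then (1 / l3) *\<^sub>R vector [0, 0, 1]
     else (1 / l1) *\<^sub>R vector [cos (p$3), sin (p$3), 0])"

definition E2_metric3 :: "real \<Rightarrow> real \<Rightarrow> real \<Rightarrow> (real^3) metric_field"
  where "E2_metric3 l1 l2 l3 p X Y =
    l1\<^sup>2 * (cos (p$3) * X$1 + sin (p$3) * X$2) * (cos (p$3) * Y$1 + sin (p$3) * Y$2)
    + l2\<^sup>2 * (- sin (p$3) * X$1 + cos (p$3) * X$2) * (- sin (p$3) * Y$1 + cos (p$3) * Y$2)
    + l3\<^sup>2 * X$3 * Y$3"

definition E2_metric :: "real \<Rightarrow> real \<Rightarrow> (real^3) metric_field"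
  where "E2_metric l1 l2 = E2_metric3 l1 l2 (1 / (l1 * l2))"

lemma E2_frame_orthonormal:
  assumes "l1 > 0" "l2 > 0" "l3 > 0"
  shows "E2_metric3 l1 l2 l3 p (E2_frame l1 l2 l3 i p) (E2_frame l1 l2 l3 j p) = (if i = j then 1 else 0)"
proof -
  have sc: "cos (p$3) * cos (p$3) + sin (p$3) * sin (p$3) = 1"
    using sin_cos_squared_add2[of "p$3"] by (simp add: power2_eq_square)
  have A: "cos (p$3) * E2_frame l1 l2 l3 i p $ 1 + sin (p$3) * E2_frame l1 l2 l3 i p $ 2
      = (if i = 3 then 1 / l1 else 0)" for i
    using exhaust_3[of i] sc by (auto simp: E2_frame_def vector_3 simp flip: add_divide_distrib)
  have B: "- sin (p$3) * E2_frame l1 l2 l3 i p $ 1 + cos (p$3) * E2_frame l1 l2 l3 i p $ 2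
      = (if i = 1 then 1 / l2 else 0)" for i
    using exhaust_3[of i] sc by (auto simp: E2_frame_def vector_3 add.commute simp flip: add_divide_distrib)
  have C: "E2_frame l1 l2 l3 i p $ 3 = (if i = 2 then 1 / l3 else 0)" for i
    using exhaust_3[of i] by (auto simp: E2_frame_def vector_3)
  show ?thesis
    unfolding E2_metric3_def A B C
    using assms exhaust_3[of i] exhaust_3[of j] by (auto simp: power2_eq_square)
qed

definition horizontal_plane :: "real^2 \<Rightarrow> real^3"
  where "horizontal_plane u = vector [u$1, u$2, 0]"

end

theory Submission
  imports Defs
begin

text \<open>
  In a left-invariant orthonormal frame the connection is \<open>\<nabla>\<^sub>a b = conn a \<times> b\<close>. The Grassmannian
  bundle is locally the unit tangent bundle with its Sasaki metric, the plane corresponding to its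
  unit normal \<open>n\<close>, so the vertical tension of the Gauss map is the tangential part of the rough
  Laplacian of \<open>n\<close> along the surface. By the Codazzi equation it is, up to signs, the gradient of the mean
  curvature plus the tangential part of \<open>Ric(n)\<close>. For a CMC surface it vanishes exactly if \<open>n\<close> is an
  eigenvector of the Ricci tensor, whose eigenvalues are distinct with eigenvectors
  \<open>E\<^sub>1, E\<^sub>2, E\<^sub>3\<close>. The distributions orthogonal to \<open>E\<^sub>1\<close> and \<open>E\<^sub>3\<close> are not integrable, which leaves
  the planes \<open>z = const\<close>; these are left translates of \<open>z = 0\<close>.
\<close>

section \<open>Calculus of smooth maps\<close>

text \<open>Computing the Christoffel symbols of the five-dimensional bundle metric would mean
  inverting a matrix of functions. Tension vectors are therefore only paired with constant vectors,
  which turns these symbols into Koszul terms. Vertical vectors suffice for vertical harmonicity;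
  for full harmonicity of the planes all vectors are used. A bundle chart sees the unit normal with
  positive \<open>k\<close>-th component, so the normal of the surface enters up to a sign \<sigma>.
  In dimension three R(a,b)v = curv(a x b) x v, where \<open>curv\<close> is diagonal in the frame
  and differs from the Ricci tensor by a multiple of the identity. Being a Ricci eigenvector thus
  reads curv(n) x n = 0. The eigenvalue differences have the factors \<open>m\<close>,
  \<open>s\<close>, \<open>s - m\<close>, \<open>s + m\<close>, nonzero because
  \<open>l1 > l2 > 0\<close>. Integrability is read off the brackets [E1,E2] = l1^2 E3, [E2,E3] =
  l2^2 E1, [E3,E1] = 0: only the planes of E1 and E3 are tangent to surfaces. A surface is an
  abstract manifold with an atlas, so the pointwise knowledge of the normal is finally turned into
  charts by a smooth inverse function theorem.\<close>

lemma dirderiv_eq: "(f has_derivative f') (at p) \<Longrightarrow> dirderiv f p = f'"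
  unfolding dirderiv_def using frechet_derivative_at by metis

lemma has_derivative_dirderiv: "f differentiable (at p) \<Longrightarrow> (f has_derivative dirderiv f p) (at p)"
  by (simp add: dirderiv_def[abs_def] frechet_derivative_works[symmetric])

lemma linear_dirderiv: "f differentiable (at p) \<Longrightarrow> linear (dirderiv f p)"
  using has_derivative_dirderiv has_derivative_linear by blast

lemma has_derivative_cong_open:
  assumes "open S" "p \<in> S" "\<And>q. q \<in> S \<Longrightarrow> f q = g q"
  shows "(f has_derivative f') (at p) \<longleftrightarrow> (g has_derivative f') (at p)"
  using has_derivative_transform_within_open[OF _ assms(1,2)] assms(3) by metis

lemma dirderiv_cong_open:
  assumes "open S" "p \<in> S" "\<And>q. q \<in> S \<Longrightarrow> f q = g q"
  shows "dirderiv f p = dirderiv g p"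
  unfolding dirderiv_def[abs_def] frechet_derivative_def
  using has_derivative_cong_open[OF assms] by simp

lemma differentiable_cong_open:
  assumes "open S" "p \<in> S" "\<And>q. q \<in> S \<Longrightarrow> f q = g q"
  shows "f differentiable (at p) \<longleftrightarrow> g differentiable (at p)"
  unfolding differentiable_def using has_derivative_cong_open[OF assms] by simp

lemma dirderiv_linear_compose:
  assumes "linear L" "f differentiable (at p)"
  shows "dirderiv (\<lambda>q. L (f q)) p X = L (dirderiv f p X)"
  using dirderiv_eq[OF bounded_linear.has_derivative[OF linear_conv_bounded_linear[THEN iffD1, OF assms(1)]
        has_derivative_dirderiv[OF assms(2)]]] by simp

lemma dirderiv_bilinear:
  assumes "bounded_bilinear h" "f differentiable (at p)" "g differentiable (at p)"
  shows "dirderiv (\<lambda>q. h (f q) (g q)) p X = h (f p) (dirderiv g p X) + h (dirderiv f p X) (g p)"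
  using dirderiv_eq[OF bounded_bilinear.FDERIV[OF assms(1) has_derivative_dirderiv[OF assms(2)]
        has_derivative_dirderiv[OF assms(3)]]] by simp

lemmas dirderiv_inner = dirderiv_bilinear[OF bounded_bilinear_inner]

lemma dirderiv_add:
  assumes "f differentiable (at p)" "g differentiable (at p)"
  shows "dirderiv (\<lambda>q. f q + g q) p X = dirderiv f p X + dirderiv g p X"
  using dirderiv_eq[OF has_derivative_add[OF assms[THEN has_derivative_dirderiv]]] by simp

lemma dirderiv_const [simp]: "dirderiv (\<lambda>q. c) p X = 0"
  by (simp add: dirderiv_def)

lemma dirderiv_chain:
  assumes "g differentiable (at p)" "f differentiable (at (g p))"
  shows "dirderiv (\<lambda>q. f (g q)) p X = dirderiv f (g p) (dirderiv g p X)"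
  using dirderiv_eq[OF has_derivative_compose[OF assms[THEN has_derivative_dirderiv]]] by simp

lemma dirderiv_basis_expand:
  assumes "f differentiable (at p)"
  shows "dirderiv f p X = (\<Sum>b\<in>Basis. (X \<bullet> b) *\<^sub>R dirderiv f p b)"
proof -
  have "dirderiv f p X = dirderiv f p (\<Sum>b\<in>Basis. (X \<bullet> b) *\<^sub>R b)"
    by (simp add: euclidean_representation)
  also have "\<dots> = (\<Sum>b\<in>Basis. (X \<bullet> b) *\<^sub>R dirderiv f p b)"
    using linear_dirderiv[OF assms] by (simp add: linear_sum linear_scale)
  finally show ?thesis .
qed

section \<open>Closure properties of C^k and smooth maps\<close>

lemma Ck_on_cong:
  assumes "open S" "\<And>q. q \<in> S \<Longrightarrow> f q = g q" "Ck_on k S f"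
  shows "Ck_on k S g"
  using assms(2,3)
proof (induction k arbitrary: f g)
  case 0
  then show ?case by (simp cong: continuous_on_cong)
next
  case (Suc k)
  have "dirderiv f q = dirderiv g q" if "q \<in> S" for q
    using dirderiv_cong_open[OF assms(1) that] Suc.prems(1) by blast
  moreover have "f differentiable (at q) \<longleftrightarrow> g differentiable (at q)" if "q \<in> S" for q
    using differentiable_cong_open[OF assms(1) that] Suc.prems(1) by blast
  moreover have "Ck_on k S (\<lambda>q. dirderiv g q X)" for X
    by (rule Suc.IH[of "\<lambda>q. dirderiv f q X"]) (use Suc.prems(2) calculation(1) in simp_all)
  ultimately show ?case
    using Suc.prems(2) by auto
qed

lemma Ck_on_subset: "Ck_on k T f \<Longrightarrow> S \<subseteq> T \<Longrightarrow> Ck_on k S f"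
  by (induction k arbitrary: f) (auto intro: continuous_on_subset)

lemma Ck_on_SucD: "Ck_on (Suc k) S f \<Longrightarrow> Ck_on k S f"
proof (induction k arbitrary: f)
  case 0
  then show ?case
    by (auto intro!: continuous_at_imp_continuous_on differentiable_imp_continuous_within)
qed auto

lemma Ck_on_const [simp]: "Ck_on k S (\<lambda>_. c)"
  by (induction k arbitrary: c) auto

lemma Ck_on_linear:
  assumes "open S" "linear L" "Ck_on k S f"
  shows "Ck_on k S (\<lambda>q. L (f q))"
  using assms(3)
proof (induction k arbitrary: f)
  case 0
  then show ?case
    using linear_continuous_on_compose[OF _ assms(2)] by simp
next
  case (Suc k)
  have d: "f differentiable (at q)" if "q \<in> S" for q using Suc.prems that by simp
  have "(\<lambda>q. L (f q)) differentiable (at q)" if "q \<in> S" for q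
    using bounded_linear.has_derivative[OF linear_conv_bounded_linear[THEN iffD1, OF assms(2)]
        has_derivative_dirderiv[OF d[OF that]]] by (auto simp: differentiable_def)
  moreover have "Ck_on k S (\<lambda>q. dirderiv (\<lambda>q. L (f q)) q X)" for X
    by (rule Ck_on_cong[OF assms(1) _ Suc.IH[of "\<lambda>q. dirderiv f q X"]])
      (use Suc.prems in \<open>simp_all add: dirderiv_linear_compose[OF assms(2) d]\<close>)
  ultimately show ?case by simp
qed

lemma Ck_on_add:
  assumes "open S" "Ck_on k S f" "Ck_on k S g"
  shows "Ck_on k S (\<lambda>q. f q + g q)"
  using assms(2,3)
proof (induction k arbitrary: f g)
  case 0
  then show ?case by (auto intro: continuous_intros)
next
  case (Suc k)
  have "Ck_on k S (\<lambda>q. dirderiv (\<lambda>q. f q + g q) q X)" for X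
    by (rule Ck_on_cong[OF assms(1) _ Suc.IH[of "\<lambda>q. dirderiv f q X" "\<lambda>q. dirderiv g q X"]])
      (use Suc.prems in \<open>simp_all add: dirderiv_add\<close>)
  then show ?case using Suc.prems by (auto intro: differentiable_add)
qed

lemma Ck_on_sum:
  assumes "open S" "\<And>i. i \<in> I \<Longrightarrow> Ck_on k S (f i)"
  shows "Ck_on k S (\<lambda>q. \<Sum>i\<in>I. f i q)"
  using assms(2) by (induction I rule: infinite_finite_induct) (auto intro: Ck_on_add[OF assms(1)])

lemma Ck_on_bilinear:
  assumes "open S" "bounded_bilinear h" "Ck_on k S f" "Ck_on k S g"
  shows "Ck_on k S (\<lambda>q. h (f q) (g q))"
  using assms(3,4)
proof (induction k arbitrary: f g)
  case 0
  then show ?case by (simp add: bounded_bilinear.continuous_on[OF assms(2)])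
next
  case (Suc k)
  have "Ck_on k S (\<lambda>q. h (f q) (dirderiv g q X) + h (dirderiv f q X) (g q))" for X
    using Suc.prems Suc.prems[THEN Ck_on_SucD] by (intro Ck_on_add assms(1) Suc.IH) simp_all
  then have "Ck_on k S (\<lambda>q. dirderiv (\<lambda>q. h (f q) (g q)) q X)" for X
    by (rule Ck_on_cong[OF assms(1), rotated]) (use Suc.prems in \<open>simp add: dirderiv_bilinear[OF assms(2)]\<close>)
  moreover have "(\<lambda>q. h (f q) (g q)) differentiable (at q)" if "q \<in> S" for q
    using bounded_bilinear.FDERIV[OF assms(2)] Suc.prems that unfolding Ck_on.simps differentiable_def by metis
  ultimately show ?case by simp
qed

text \<open>The chain rule differentiates \<open>f\<close> in the direction
  \<open>dirderiv g q X\<close>, which moves with \<open>q\<close>, while \<open>Ck_on\<close>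
  speaks of fixed directions. Expanding that direction in the basis leaves sums of products to which
  the induction hypothesis applies.\<close>

lemma Ck_on_compose:
  assumes "open S" "open T" "g ` S \<subseteq> T" "Ck_on k T f" "Ck_on k S g"
  shows "Ck_on k S (\<lambda>q. f (g q))"
  using assms(4,5)
proof (induction k arbitrary: f)
  case 0
  then show ?case using assms(3) continuous_on_compose2[of T f S g] by auto
next
  case (Suc k)
  have dg: "g differentiable (at q)" and df: "f differentiable (at (g q))" if "q \<in> S" for q
    using Suc.prems that assms(3) by auto
  have "Ck_on k S (\<lambda>q. \<Sum>b\<in>Basis. (dirderiv g q X \<bullet> b) *\<^sub>R dirderiv f (g q) b)" for X
  proof (intro Ck_on_sum[OF assms(1)] Ck_on_bilinear[OF assms(1) bounded_bilinear_scaleR])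
    show "Ck_on k S (\<lambda>q. dirderiv g q X \<bullet> b)" for b
      using Suc.prems by (intro Ck_on_bilinear[OF assms(1) bounded_bilinear_inner]) auto
    show "Ck_on k S (\<lambda>q. dirderiv f (g q) b)" for b
      using Suc.prems Ck_on_SucD by (intro Suc.IH[of "\<lambda>p. dirderiv f p b"]) auto
  qed
  then have "Ck_on k S (\<lambda>q. dirderiv (\<lambda>q. f (g q)) q X)" for X
    by (rule Ck_on_cong[OF assms(1), rotated])
      (simp add: dirderiv_chain dg df dirderiv_basis_expand[of f _ "dirderiv g _ _"])
  moreover have "(\<lambda>q. f (g q)) differentiable (at q)" if "q \<in> S" for q
    using has_derivative_compose[OF dg[OF that, THEN has_derivative_dirderiv] df[OF that, THEN has_derivative_dirderiv]]
    by (auto simp: differentiable_def)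
  ultimately show ?case by simp
qed

lemma Ck_on_id: "Ck_on k S (\<lambda>q. q)"
proof (cases k)
  case (Suc n)
  have "dirderiv (\<lambda>q. q) = (\<lambda>(p::'a) X. X)" by (simp add: dirderiv_def[abs_def])
  then show ?thesis by (simp add: Suc)
qed simp

lemma Ck_on_inverse: "Ck_on k (- {0}) (inverse :: real \<Rightarrow> real)"
proof (induction k)
  case 0
  then show ?case by (auto intro!: continuous_intros)
next
  case (Suc k)
  have d: "(inverse has_derivative (\<lambda>h. - (inverse p * h * inverse p))) (at p)" if "p \<noteq> 0" for p :: real
    using that by (auto intro!: derivative_eq_intros)
  have o: "open (- {0::real})" by auto
  have "Ck_on k (- {0::real}) (\<lambda>p. (- X) *\<^sub>R (inverse p * inverse p))" for X
    by (intro Ck_on_bilinear[OF o bounded_bilinear_scaleR] Ck_on_bilinear[OF o bounded_bilinear_mult] Suc) auto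
  then have "Ck_on k (- {0}) (\<lambda>p::real. dirderiv inverse p X)" for X
    by (rule Ck_on_cong[OF o, rotated]) (simp add: dirderiv_eq[OF d])
  then show ?case using d by (auto simp: differentiable_def)
qed

text \<open>Both claims share one induction because each derivative is a multiple of the other
  function.\<close>

lemma Ck_on_sin_cos: "Ck_on k UNIV (sin :: real \<Rightarrow> real) \<and> Ck_on k UNIV (cos :: real \<Rightarrow> real)"
proof (induction k)
  case 0
  then show ?case by (auto intro!: continuous_intros)
next
  case (Suc k)
  have s: "(sin has_derivative (\<lambda>h. h * cos p)) (at p)"
    and c: "(cos has_derivative (\<lambda>h. (- h) * sin p)) (at p)" for p :: real
    by (auto intro!: derivative_eq_intros)
  have "Ck_on k UNIV (\<lambda>p::real. dirderiv sin p X)" "Ck_on k UNIV (\<lambda>p::real. dirderiv cos p X)" for X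
    unfolding dirderiv_eq[OF s] dirderiv_eq[OF c]
    by (intro Ck_on_bilinear[OF open_UNIV bounded_bilinear_mult] Suc[THEN conjunct1] Suc[THEN conjunct2]; simp)+
  moreover have "sin differentiable (at p)" "cos differentiable (at p)" for p :: real
    using s c unfolding differentiable_def by blast+
  ultimately show ?case by simp
qed

lemma smooth_on_cong: "open S \<Longrightarrow> (\<And>q. q \<in> S \<Longrightarrow> f q = g q) \<Longrightarrow> smooth_on S f \<Longrightarrow> smooth_on S g"
  unfolding smooth_on_def using Ck_on_cong by blast

lemma smooth_on_subset: "smooth_on T f \<Longrightarrow> S \<subseteq> T \<Longrightarrow> smooth_on S f"
  unfolding smooth_on_def using Ck_on_subset by blast

lemma smooth_on_differentiable: "smooth_on S f \<Longrightarrow> p \<in> S \<Longrightarrow> f differentiable (at p)"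
  unfolding smooth_on_def using Ck_on.simps(2) by blast

lemma smooth_on_continuous: "smooth_on S f \<Longrightarrow> continuous_on S f"
  unfolding smooth_on_def using Ck_on.simps(1) by blast

lemma smooth_on_dirderiv: "smooth_on S f \<Longrightarrow> smooth_on S (\<lambda>p. dirderiv f p X)"
  unfolding smooth_on_def using Ck_on.simps(2) by blast

lemma smooth_on_const: "smooth_on S (\<lambda>_. c)"
  and smooth_on_id: "smooth_on S (\<lambda>q. q)"
  by (simp_all add: smooth_on_def Ck_on_id)

lemma smooth_on_linear: "open S \<Longrightarrow> linear L \<Longrightarrow> smooth_on S f \<Longrightarrow> smooth_on S (\<lambda>q. L (f q))"
  unfolding smooth_on_def using Ck_on_linear by blast

lemma smooth_on_add: "open S \<Longrightarrow> smooth_on S f \<Longrightarrow> smooth_on S g \<Longrightarrow> smooth_on S (\<lambda>q. f q + g q)"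
  unfolding smooth_on_def using Ck_on_add by blast

lemma smooth_on_uminus: "open S \<Longrightarrow> smooth_on S f \<Longrightarrow> smooth_on S (\<lambda>q. - f q)"
  by (rule smooth_on_linear) (simp_all add: linear_uminus)

lemma smooth_on_diff: "open S \<Longrightarrow> smooth_on S f \<Longrightarrow> smooth_on S g \<Longrightarrow> smooth_on S (\<lambda>q. f q - g q)"
  using smooth_on_add[of S f "\<lambda>q. - g q"] smooth_on_uminus by fastforce

lemma smooth_on_bilinear:
  "open S \<Longrightarrow> bounded_bilinear h \<Longrightarrow> smooth_on S f \<Longrightarrow> smooth_on S g \<Longrightarrow> smooth_on S (\<lambda>q. h (f q) (g q))"
  unfolding smooth_on_def using Ck_on_bilinear by blast

lemma smooth_on_scaleR:
  "open S \<Longrightarrow> smooth_on S f \<Longrightarrow> smooth_on S g \<Longrightarrow> smooth_on S (\<lambda>q. f q *\<^sub>R g q)"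
  and smooth_on_mult: "open S \<Longrightarrow> smooth_on S r \<Longrightarrow> smooth_on S s \<Longrightarrow> smooth_on S (\<lambda>q. r q * s q :: real)"
  by (auto intro: smooth_on_bilinear bounded_bilinear_scaleR bounded_bilinear_mult)

lemma smooth_on_compose:
  "open S \<Longrightarrow> open T \<Longrightarrow> smooth_on T f \<Longrightarrow> smooth_on S g \<Longrightarrow> g ` S \<subseteq> T \<Longrightarrow> smooth_on S (\<lambda>q. f (g q))"
  unfolding smooth_on_def using Ck_on_compose by blast

lemma smooth_on_divide:
  fixes f g :: "'a::euclidean_space \<Rightarrow> real"
  assumes "open S" "smooth_on S f" "smooth_on S g" "\<And>q. q \<in> S \<Longrightarrow> g q \<noteq> 0"
  shows "smooth_on S (\<lambda>q. f q / g q)"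
proof -
  have "smooth_on S (\<lambda>q. inverse (g q))"
    by (rule smooth_on_compose[of S "- {0}" inverse g])
      (use assms in \<open>auto simp: smooth_on_def Ck_on_inverse open_delete\<close>)
  then show ?thesis
    unfolding divide_inverse using assms by (intro smooth_on_mult)
qed

lemma smooth_on_sin: "open S \<Longrightarrow> smooth_on S f \<Longrightarrow> smooth_on S (\<lambda>q. sin (f q :: real))"
  and smooth_on_cos: "open S \<Longrightarrow> smooth_on S f \<Longrightarrow> smooth_on S (\<lambda>q. cos (f q :: real))"
  using smooth_on_compose[of S UNIV _ f] Ck_on_sin_cos by (auto simp: smooth_on_def)

lemma linear_vec_nth: "linear (\<lambda>x::real^'n. x $ i)"
  by (simp add: bounded_linear.linear bounded_linear_vec_nth)

lemma smooth_on_nth: "open S \<Longrightarrow> smooth_on S f \<Longrightarrow> smooth_on S (\<lambda>q. f q $ i :: real)"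
  by (rule smooth_on_linear[OF _ linear_vec_nth])

lemma smooth_on_vec_lambda:
  fixes f :: "'n::finite \<Rightarrow> 'a::euclidean_space \<Rightarrow> real"
  assumes "open S" "\<And>i. smooth_on S (f i)"
  shows "smooth_on S (\<lambda>q. \<chi> i. f i q)"
proof -
  have eq: "(\<chi> i. f i q) = (\<Sum>i\<in>UNIV. f i q *\<^sub>R axis i 1)" for q
    by (simp add: vec_eq_iff axis_def if_distrib cong: if_cong)
  show ?thesis
    unfolding eq using assms unfolding smooth_on_def
    by (auto intro!: Ck_on_sum Ck_on_bilinear[OF _ bounded_bilinear_scaleR])
qed

lemma smooth_on_Pair:
  assumes "open S" "smooth_on S f" "smooth_on S g"
  shows "smooth_on S (\<lambda>q. (f q, g q))"
proof -
  have eq: "(\<lambda>q. (f q, g q)) = (\<lambda>q. (f q, 0) + (0, g q))" by auto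
  have "linear (\<lambda>x. (x, 0))" "linear (\<lambda>x. (0, x))"
    by (auto intro!: linearI)
  then show ?thesis
    unfolding eq by (intro smooth_on_add smooth_on_linear[where L="\<lambda>x. (x, 0)"]
        smooth_on_linear[where L="\<lambda>x. (0, x)"] assms)
qed

section \<open>Symmetry of second derivatives\<close>

lemma second_difference_mvt:
  fixes f :: "'a::euclidean_space \<Rightarrow> real"
  assumes t: "t > 0" and B: "\<And>a b. 0 \<le> a \<Longrightarrow> a \<le> t \<Longrightarrow> 0 \<le> b \<Longrightarrow> b \<le> t \<Longrightarrow> p + a *\<^sub>R X + b *\<^sub>R Y \<in> S"
    and f: "Ck_on 2 S f"
  shows "\<exists>a b. 0 < a \<and> a < t \<and> 0 < b \<and> b < t \<and>
    f (p + t *\<^sub>R X + t *\<^sub>R Y) - f (p + t *\<^sub>R X) - f (p + t *\<^sub>R Y) + f p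
      = t * t * dirderiv (\<lambda>q. dirderiv f q X) (p + a *\<^sub>R X + b *\<^sub>R Y) Y"
proof -
  have f1: "f differentiable (at q)" and f2: "(\<lambda>q. dirderiv f q X) differentiable (at q)" if "q \<in> S" for q
    using f that by (auto simp: numeral_2_eq_2)
  have line: "((\<lambda>s. h (c + s *\<^sub>R Z)) has_real_derivative dirderiv h (c + s *\<^sub>R Z) Z) (at s)"
    if "h differentiable (at (c + s *\<^sub>R Z))" for h :: "'a \<Rightarrow> real" and c Z s
  proof -
    have "((\<lambda>s. c + s *\<^sub>R Z) has_derivative (\<lambda>k. k *\<^sub>R Z)) (at s)"
      by (auto intro!: derivative_eq_intros)
    from has_derivative_compose[OF this has_derivative_dirderiv[OF that]]
    show ?thesis
      using linear_dirderiv[OF that]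
      by (simp add: has_field_derivative_def linear_scale mult.commute[of _ "dirderiv h _ _"])
  qed
  \<comment> \<open>The second difference is an increment of \<open>?g\<close>. The mean value
    theorem is applied to \<open>?g\<close> in direction \<open>X\<close>, then to the derivative so
    obtained in direction \<open>Y\<close>.\<close>
  let ?g = "\<lambda>s. f (p + t *\<^sub>R Y + s *\<^sub>R X) - f (p + s *\<^sub>R X)"
  have "\<exists>a>0. a < t \<and> ?g t - ?g 0 = (t - 0) *
      (dirderiv f (p + t *\<^sub>R Y + a *\<^sub>R X) X - dirderiv f (p + a *\<^sub>R X) X)"
  proof (intro MVT2 t DERIV_diff line f1)
    fix s assume "0 \<le> s" "s \<le> t"
    then show "p + t *\<^sub>R Y + s *\<^sub>R X \<in> S" "p + s *\<^sub>R X \<in> S"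
      using B[of s t] B[of s 0] t by (auto simp: algebra_simps)
  qed
  then obtain a where a: "0 < a" "a < t" and
    ea: "?g t - ?g 0 = t * (dirderiv f (p + t *\<^sub>R Y + a *\<^sub>R X) X - dirderiv f (p + a *\<^sub>R X) X)" by auto
  have "\<exists>b>0. b < t \<and> dirderiv f (p + a *\<^sub>R X + t *\<^sub>R Y) X - dirderiv f (p + a *\<^sub>R X + 0 *\<^sub>R Y) X
      = (t - 0) * dirderiv (\<lambda>q. dirderiv f q X) (p + a *\<^sub>R X + b *\<^sub>R Y) Y"
    by (intro MVT2[where f="\<lambda>s. dirderiv f (p + a *\<^sub>R X + s *\<^sub>R Y) X"] t line f2 B) (use a in auto)
  then obtain b where b: "0 < b" "b < t" and
    eb: "dirderiv f (p + a *\<^sub>R X + t *\<^sub>R Y) X - dirderiv f (p + a *\<^sub>R X) X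
      = t * dirderiv (\<lambda>q. dirderiv f q X) (p + a *\<^sub>R X + b *\<^sub>R Y) Y" by auto
  have "?g t - ?g 0 = t * (t * dirderiv (\<lambda>q. dirderiv f q X) (p + a *\<^sub>R X + b *\<^sub>R Y) Y)"
    unfolding ea eb[symmetric] by (simp add: algebra_simps)
  then show ?thesis using a b by (intro exI[of _ a] exI[of _ b]) (simp add: algebra_simps)
qed

text \<open>The second difference over a parallelogram is symmetric in its two sides. Hence the two
  mixed derivatives agree at suitable, possibly different, points arbitrarily close to
  \<open>p\<close>, and continuity carries this to \<open>p\<close>.\<close>

lemma dirderiv_commute_real:
  fixes f :: "'a::euclidean_space \<Rightarrow> real"
  assumes S: "open S" "p \<in> S" and f: "Ck_on 2 S f"
  shows "dirderiv (\<lambda>q. dirderiv f q X) p Y = dirderiv (\<lambda>q. dirderiv f q Y) p X"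
proof -
  define u where "u = (\<lambda>q. dirderiv (\<lambda>q. dirderiv f q X) q Y)"
  define v where "v = (\<lambda>q. dirderiv (\<lambda>q. dirderiv f q Y) q X)"
  have "continuous_on S u" "continuous_on S v"
    using f by (auto simp: u_def v_def numeral_2_eq_2)
  then have cu: "isCont u p" and cv: "isCont v p"
    using S by (simp_all add: continuous_on_eq_continuous_at)
  have "u p = v p"
  proof (rule ccontr)
    assume ne: "u p \<noteq> v p"
    define e where "e = \<bar>u p - v p\<bar> / 2"
    have e: "e > 0" using ne by (simp add: e_def)
    obtain d1 where d1: "d1 > 0" "\<And>q. dist q p < d1 \<Longrightarrow> \<bar>u q - u p\<bar> < e"
      using cu e unfolding continuous_at_eps_delta dist_real_def by metis
    obtain d2 where d2: "d2 > 0" "\<And>q. dist q p < d2 \<Longrightarrow> \<bar>v q - v p\<bar> < e"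
      using cv e unfolding continuous_at_eps_delta dist_real_def by metis
    obtain d3 where d3: "d3 > 0" "ball p d3 \<subseteq> S"
      using S open_contains_ball by metis
    define d where "d = min d1 (min d2 d3)"
    define n where "n = norm X + norm Y + 1"
    have n: "n > 0" by (simp add: n_def add_nonneg_pos)
    \<comment> \<open>With this side length the whole parallelogram stays within distance
      \<open>d\<close> of \<open>p\<close>; the 1 in \<open>n\<close> prevents a division by
      zero.\<close>
    define t where "t = d / (2 * n)"
    have d: "d > 0" using d1 d2 d3 by (simp add: d_def)
    have t: "t > 0" using d n by (simp add: t_def)
    have near: "dist (p + a *\<^sub>R X + b *\<^sub>R Y) p < d" if "0 \<le> a" "a \<le> t" "0 \<le> b" "b \<le> t" for a b
    proof -
      have "dist (p + a *\<^sub>R X + b *\<^sub>R Y) p = norm (a *\<^sub>R X + b *\<^sub>R Y)"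
        by (simp add: dist_norm algebra_simps)
      also have "\<dots> \<le> a * norm X + b * norm Y"
        using that norm_triangle_ineq[of "a *\<^sub>R X" "b *\<^sub>R Y"] by simp
      also have "\<dots> \<le> t * norm X + t * norm Y"
        using that by (intro add_mono mult_right_mono) auto
      also have "\<dots> \<le> t * n" using t by (simp add: n_def algebra_simps)
      also have "\<dots> < d" using d n by (simp add: t_def)
      finally show ?thesis .
    qed
    have nS: "p + a *\<^sub>R X + b *\<^sub>R Y \<in> S" "p + b *\<^sub>R Y + a *\<^sub>R X \<in> S"
      if "0 \<le> a" "a \<le> t" "0 \<le> b" "b \<le> t" for a b
      using near[OF that] d3 by (auto simp: d_def dist_commute subset_iff add_ac)
    obtain a b where ab: "0 < a" "a < t" "0 < b" "b < t" and
      eu: "f (p + t *\<^sub>R X + t *\<^sub>R Y) - f (p + t *\<^sub>R X) - f (p + t *\<^sub>R Y) + f p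
        = t * t * u (p + a *\<^sub>R X + b *\<^sub>R Y)"
      using second_difference_mvt[OF t nS(1) f] unfolding u_def by blast
    obtain a' b' where ab': "0 < a'" "a' < t" "0 < b'" "b' < t" and
      ev: "f (p + t *\<^sub>R Y + t *\<^sub>R X) - f (p + t *\<^sub>R Y) - f (p + t *\<^sub>R X) + f p
        = t * t * v (p + a' *\<^sub>R Y + b' *\<^sub>R X)"
      using second_difference_mvt[OF t nS(2) f] unfolding v_def by blast
    have "t * t * u (p + a *\<^sub>R X + b *\<^sub>R Y) = t * t * v (p + a' *\<^sub>R Y + b' *\<^sub>R X)"
      unfolding eu[symmetric] ev[symmetric] by (simp add: algebra_simps)
    then have "u (p + a *\<^sub>R X + b *\<^sub>R Y) = v (p + b' *\<^sub>R X + a' *\<^sub>R Y)"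
      using t by (simp add: add_ac)
    moreover have "\<bar>u (p + a *\<^sub>R X + b *\<^sub>R Y) - u p\<bar> < e" "\<bar>v (p + b' *\<^sub>R X + a' *\<^sub>R Y) - v p\<bar> < e"
      using near[of a b] near[of b' a'] ab ab' d1 d2 by (auto simp: d_def)
    ultimately show False by (simp add: e_def abs_if field_simps split: if_splits)
  qed
  then show ?thesis by (simp add: u_def v_def)
qed

lemma dirderiv_commute:
  fixes f :: "'a::euclidean_space \<Rightarrow> 'b::euclidean_space"
  assumes S: "open S" "p \<in> S" and f: "smooth_on S f"
  shows "dirderiv (\<lambda>q. dirderiv f q X) p Y = dirderiv (\<lambda>q. dirderiv f q Y) p X"
proof (rule euclidean_eqI)
  fix b :: 'b assume "b \<in> Basis"
  have lin: "linear (\<lambda>x::'b. x \<bullet> b)" by (simp add: linear_iff inner_add_left)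
  have *: "dirderiv (\<lambda>q. dirderiv (\<lambda>q. f q \<bullet> b) q X) p Y = dirderiv (\<lambda>q. dirderiv f q X) p Y \<bullet> b" for X Y
  proof -
    have "dirderiv (\<lambda>q. f q \<bullet> b) q X = dirderiv f q X \<bullet> b" if "q \<in> S" for q
      using dirderiv_linear_compose[OF lin smooth_on_differentiable[OF f that]] .
    then have "dirderiv (\<lambda>q. dirderiv (\<lambda>q. f q \<bullet> b) q X) p Y = dirderiv (\<lambda>q. dirderiv f q X \<bullet> b) p Y"
      by (rule dirderiv_cong_open[OF S, THEN fun_cong])
    also have "\<dots> = dirderiv (\<lambda>q. dirderiv f q X) p Y \<bullet> b"
      using dirderiv_linear_compose[OF lin smooth_on_differentiable[OF smooth_on_dirderiv[OF f] S(2)]] .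
    finally show ?thesis .
  qed
  have "Ck_on 2 S (\<lambda>q. f q \<bullet> b)"
    using smooth_on_linear[OF S(1) lin f] by (simp add: smooth_on_def)
  from dirderiv_commute_real[OF S this]
  show "dirderiv (\<lambda>q. dirderiv f q X) p Y \<bullet> b = dirderiv (\<lambda>q. dirderiv f q Y) p X \<bullet> b"
    by (simp add: *)
qed

section \<open>Inner products and the Koszul formula\<close>

definition pos_inner :: "('a::real_vector \<Rightarrow> 'a \<Rightarrow> real) \<Rightarrow> bool"
  where "pos_inner h \<longleftrightarrow> bilinear h \<and> (\<forall>x y. h x y = h y x) \<and> (\<forall>x. x \<noteq> 0 \<longrightarrow> h x x > 0)"

lemma pos_inner_sym: "pos_inner h \<Longrightarrow> h x y = h y x"
  by (simp add: pos_inner_def)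

lemma pos_inner_zero: "pos_inner h \<Longrightarrow> h x x = 0 \<Longrightarrow> x = 0"
  unfolding pos_inner_def by fastforce

lemma pos_inner_eq:
  assumes "pos_inner h" "\<And>w. h x w = h y w"
  shows "x = y"
proof -
  have "h (x - y) (x - y) = h x (x - y) - h y (x - y)"
    using assms(1) by (simp add: pos_inner_def bilinear_lsub)
  then show ?thesis using pos_inner_zero[OF assms(1), of "x - y"] assms(2) by simp
qed

text \<open>The map \<open>L\<close> records the products of \<open>Z\<close> with the standard
  basis. It is an injective endomorphism of a finite-dimensional space, hence onto.\<close>

lemma riesz:
  fixes h :: "'a::euclidean_space \<Rightarrow> 'a \<Rightarrow> real"
  assumes h: "pos_inner h" and l: "linear l"
  obtains Z where "\<And>W. h Z W = l W"
proof -
  have bil: "bilinear h" using h by (simp add: pos_inner_def)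
  have hr: "linear (h Z)" for Z using bil by (simp add: bilinear_def)
  define L where "L Z = (\<Sum>b\<in>Basis. h Z b *\<^sub>R b)" for Z
  have "linear L"
    unfolding L_def by (auto intro!: linearI simp: bilinear_ladd[OF bil] bilinear_lmul[OF bil]
        scaleR_add_left sum.distrib scaleR_sum_right)
  moreover have "inj L"
    unfolding linear_injective_0[OF \<open>linear L\<close>]
  proof (intro allI impI)
    fix Z assume "L Z = 0"
    then have "h Z b = 0" if "b \<in> Basis" for b
      using that inner_sum_left_Basis[OF that, of "h Z"] by (simp add: L_def)
    then have "h Z Z = 0"
      using linear_eq_stdbasis[OF hr, of "\<lambda>_. 0" Z] linear_zero by (metis (no_types))
    then show "Z = 0" using pos_inner_zero[OF h] by blast
  qed
  ultimately have "surj L" by (rule linear_inj_imp_surj)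
  then obtain Z where Z: "L Z = (\<Sum>b\<in>Basis. l b *\<^sub>R b)" by (metis surjD)
  have "h Z b = l b" if "b \<in> Basis" for b
  proof -
    have "h Z b = L Z \<bullet> b" using that by (simp add: L_def inner_sum_left_Basis)
    then show ?thesis using that unfolding Z by (simp add: inner_sum_left_Basis)
  qed
  then have "h Z = l"
    using linear_eq_stdbasis[OF hr l] by blast
  then show ?thesis using that by blast
qed

lemma christoffel_eqI:
  assumes "pos_inner (g p)"
    and "\<And>W. 2 * g p Z W = dirderiv (\<lambda>q. g q Y W) p X + dirderiv (\<lambda>q. g q X W) p Y - dirderiv (\<lambda>q. g q X Y) p W"
  shows "christoffel g p X Y = Z"
  unfolding christoffel_def
proof (rule the_equality)
  fix Z' assume "\<forall>W. 2 * g p Z' W = dirderiv (\<lambda>q. g q Y W) p X + dirderiv (\<lambda>q. g q X W) p Y - dirderiv (\<lambda>q. g q X Y) p W"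
  then have "2 * g p Z' W = 2 * g p Z W" for W using assms(2) by metis
  then show "Z' = Z" by (intro pos_inner_eq[OF assms(1)]) simp
qed (use assms(2) in blast)

text \<open>As \<open>christoffel\<close> is a definite description, its equation is available only
  after existence is shown. The right-hand side is linear in \<open>W\<close>, both where
  \<open>W\<close> stands inside the metric and where it is the direction, so \<open>riesz\<close>
  supplies the vector.\<close>

lemma koszul:
  fixes g :: "'a::euclidean_space metric_field"
  assumes S: "open S" "p \<in> S" and g: "\<And>q. q \<in> S \<Longrightarrow> pos_inner (g q)"
    and d: "\<And>Y W. (\<lambda>q. g q Y W) differentiable (at p)"
  shows "2 * g p (christoffel g p X Y) W =
    dirderiv (\<lambda>q. g q Y W) p X + dirderiv (\<lambda>q. g q X W) p Y - dirderiv (\<lambda>q. g q X Y) p W"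
proof -
  have bil: "bilinear (g q)" if "q \<in> S" for q using g[OF that] by (simp add: pos_inner_def)
  have "linear (\<lambda>W. dirderiv (\<lambda>q. g q Y W) p X)" for X Y
  proof (rule linearI)
    show "dirderiv (\<lambda>q. g q Y (a + b)) p X = dirderiv (\<lambda>q. g q Y a) p X + dirderiv (\<lambda>q. g q Y b) p X" for a b
      by (subst dirderiv_add[OF d d, symmetric], rule dirderiv_cong_open[OF S, THEN fun_cong])
        (simp add: bilinear_radd[OF bil])
    have "dirderiv (\<lambda>q. g q Y (c *\<^sub>R a)) p X = dirderiv (\<lambda>q. c *\<^sub>R g q Y a) p X" for c a
      by (rule dirderiv_cong_open[OF S, THEN fun_cong]) (simp add: bilinear_rmul[OF bil])
    then show "dirderiv (\<lambda>q. g q Y (c *\<^sub>R a)) p X = c *\<^sub>R dirderiv (\<lambda>q. g q Y a) p X" for c a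
      using dirderiv_linear_compose[OF linear_scaleR d] by metis
  qed
  note lin = this linear_dirderiv[OF d]
  have "linear (\<lambda>W. (dirderiv (\<lambda>q. g q Y W) p X + dirderiv (\<lambda>q. g q X W) p Y - dirderiv (\<lambda>q. g q X Y) p W) / 2)"
    unfolding divide_inverse mult.commute[of _ "inverse (2::real)"]
    using linear_compose_scale_right[OF linear_compose_sub[OF linear_compose_add[OF lin(1)[of Y X] lin(1)[of X Y]] lin(2)[of X Y]],
      of "inverse 2"] by simp
  from riesz[OF g[OF S(2)] this] obtain Z where
    Z: "g p Z W = (dirderiv (\<lambda>q. g q Y W) p X + dirderiv (\<lambda>q. g q X W) p Y - dirderiv (\<lambda>q. g q X Y) p W) / 2" for W
    by metis
  then have "christoffel g p X Y = Z"
    by (intro christoffel_eqI g S) (simp add: Z)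
  then show ?thesis by (simp add: Z)
qed

lemma orth_proj_eqI:
  assumes "pos_inner h" "subspace W" "y \<in> W" "\<And>w. w \<in> W \<Longrightarrow> h (x - y) w = 0"
  shows "orth_proj h W x = y"
  unfolding orth_proj_def
proof (rule the_equality)
  fix y' assume y': "y' \<in> W \<and> (\<forall>w\<in>W. h (x - y') w = 0)"
  have bil: "bilinear h" using assms(1) by (simp add: pos_inner_def)
  have in_W: "y' - y \<in> W" using y' assms by (simp add: subspace_diff)
  have "h (y' - y) (y' - y) = h (x - y) (y' - y) - h (x - y') (y' - y)"
    by (simp add: bilinear_lsub[OF bil])
  also have "\<dots> = 0" using in_W y' assms(4) by simp
  finally show "y' = y" using pos_inner_zero[OF assms(1), of "y' - y"] by simp
qed (use assms in auto)

lemma dirderiv_fst [simp]: "dirderiv fst p w = fst w"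
  by (simp add: dirderiv_eq[OF bounded_linear_imp_has_derivative[OF bounded_linear_fst]])

text \<open>Lets vertical harmonicity be tested by pairing with vertical vectors. The restriction of
  \<open>G p\<close> to the fibre directions is again an inner product; its Riesz vector for the
  functional \<open>G p v\<close> is the projection of \<open>v\<close>.\<close>

lemma vertical_component_eq_0_iff:
  fixes G :: "('a::euclidean_space \<times> 'b::euclidean_space) metric_field"
  assumes G: "pos_inner (G p)"
  shows "vertical_component G fst p v = 0 \<longleftrightarrow> (\<forall>\<eta>. G p v (0, \<eta>) = 0)"
proof
  let ?V = "{w. dirderiv fst p w = 0} :: ('a \<times> 'b) set"
  have bil: "bilinear (G p)" using G by (simp add: pos_inner_def)
  have sub: "subspace ?V" by (auto simp: subspace_def)
  {
    assume "\<forall>\<eta>. G p v (0, \<eta>) = 0"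
    then have "G p (v - 0) w = 0" if "w \<in> ?V" for w
      using that by (metis (mono_tags) diff_zero dirderiv_fst mem_Collect_eq prod.collapse)
    then show "vertical_component G fst p v = 0"
      unfolding vertical_component_def by (intro orth_proj_eqI G sub) auto
  }
  assume 0: "vertical_component G fst p v = 0"
  have "bilinear (\<lambda>a b. G p (0, a) (0, b))"
    unfolding bilinear_def
    by (auto intro!: linearI simp: bilinear_lmul[OF bil, of _ "(0, _)", simplified]
        bilinear_rmul[OF bil, of _ _ "(0, _)", simplified] simp flip: bilinear_ladd[OF bil] bilinear_radd[OF bil])
  then have pi: "pos_inner (\<lambda>a b. G p (0, a) (0, b))"
    using G by (simp add: pos_inner_def zero_prod_def)
  have lin: "linear (\<lambda>b. G p v (0, b))"
    by (auto intro!: linearI simp: bilinear_rmul[OF bil, of _ _ "(0, _)", simplified] simp flip: bilinear_radd[OF bil])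
  obtain y where y: "G p (0, y) (0, b) = G p v (0, b)" for b
    by (rule riesz[OF pi lin]) blast
  have "G p (v - (0, y)) w = 0" if "w \<in> ?V" for w
  proof -
    have "w = (0, snd w)" using that by (simp add: prod_eq_iff)
    then show ?thesis using y[of "snd w"] by (metis bilinear_lsub[OF bil] right_minus_eq)
  qed
  then have "orth_proj (G p) ?V v = (0, y)"
    by (intro orth_proj_eqI G sub) auto
  then have "y = 0" using 0 by (simp add: vertical_component_def zero_prod_def)
  then show "\<forall>\<eta>. G p v (0, \<eta>) = 0"
    using y bilinear_lzero[OF bil] by (simp flip: zero_prod_def)
qed

section \<open>Traces with respect to a 2 x 2 Gram matrix\<close>

lemma matrix_inv_2:
  fixes G :: "real^2^2"
  assumes "G$1$1 * G$2$2 - G$1$2 * G$2$1 \<noteq> 0"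
  shows "matrix_inv G = (1 / (G$1$1 * G$2$2 - G$1$2 * G$2$1)) *\<^sub>R
    vector [vector [G$2$2, - G$1$2], vector [- G$2$1, G$1$1]]" (is "_ = ?I")
proof -
  define d where "d = 1 / (G$1$1 * G$2$2 - G$1$2 * G$2$1)"
  have d: "d * (G$1$1 * G$2$2 - G$1$2 * G$2$1) = 1"
    using assms by (simp add: d_def)
  let ?J = "d *\<^sub>R vector [vector [G$2$2, - G$1$2], vector [- G$2$1, G$1$1]] :: real^2^2"
  have "G$1$1 * (d * G$2$2) + G$1$2 * (d * - G$2$1) = 1" "G$2$1 * (d * - G$1$2) + G$2$2 * (d * G$1$1) = 1"
    "G$1$1 * (d * - G$1$2) + G$1$2 * (d * G$1$1) = 0" "G$2$1 * (d * G$2$2) + G$2$2 * (d * - G$2$1) = 0"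
    "d * G$2$2 * G$1$1 + d * - G$1$2 * G$2$1 = 1" "d * - G$2$1 * G$1$2 + d * G$1$1 * G$2$2 = 1"
    "d * G$2$2 * G$1$2 + d * - G$1$2 * G$2$2 = 0" "d * - G$2$1 * G$1$1 + d * G$1$1 * G$2$1 = 0"
    using d by algebra+
  then have l: "G ** ?J = mat 1" and r: "?J ** G = mat 1"
    by (simp_all add: vec_eq_iff matrix_matrix_mult_def sum_2 forall_2 vector_2 mat_def)
  \<comment> \<open>\<open>matrix_inv\<close> is a choice among two-sided inverses, so its defining
    property comes from exhibiting one.\<close>
  have inv: "G ** matrix_inv G = mat 1 \<and> matrix_inv G ** G = mat 1"
    unfolding matrix_inv_def by (rule someI[of _ ?J]) (simp only: l r)
  have "matrix_inv G = matrix_inv G ** (G ** ?J)" by (simp only: l matrix_mul_rid)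
  also have "\<dots> = ?J" by (simp only: matrix_mul_assoc inv matrix_mul_lid)
  finally show ?thesis by (simp only: d_def)
qed

lemma gram_trace_2:
  fixes G :: "real^2^2"
  assumes "G$1$1 * G$2$2 - G$1$2 * G$2$1 \<noteq> 0"
  shows "gram_trace G B = (1 / (G$1$1 * G$2$2 - G$1$2 * G$2$1)) *\<^sub>R
    (G$2$2 *\<^sub>R B 1 1 - G$1$2 *\<^sub>R B 1 2 - G$2$1 *\<^sub>R B 2 1 + G$1$1 *\<^sub>R B 2 2)"
  by (simp add: gram_trace_def matrix_inv_2[OF assms] sum_2 vector_2 algebra_simps)

lemma gram_trace_linear:
  assumes "linear L"
  shows "L (gram_trace G B) = gram_trace G (\<lambda>i j. L (B i j))"
  by (simp add: gram_trace_def linear_sum[OF assms] linear_scale[OF assms])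

lemma gram_det_pos:
  assumes "pos_inner h" "\<And>a b. a *\<^sub>R x + b *\<^sub>R y = 0 \<Longrightarrow> a = 0 \<and> b = 0"
  shows "h x x * h y y - h x y * h y x > 0"
proof -
  have bil: "bilinear h" using assms(1) by (simp add: pos_inner_def)
  have "x \<noteq> 0" using assms(2)[of 1 0] by auto
  then have p: "h x x > 0" using assms(1) by (simp add: pos_inner_def)
  \<comment> \<open>This is \<open>h x x\<close> times the part of \<open>y\<close> orthogonal to
    \<open>x\<close>; its square is \<open>h x x\<close> times the Gram determinant.\<close>
  let ?z = "(- h x y) *\<^sub>R x + h x x *\<^sub>R y"
  have "?z \<noteq> 0" using assms(2) p by fastforce
  then have "h ?z ?z > 0" using assms(1) by (simp add: pos_inner_def)
  also have "h ?z ?z = h x x * (h x x * h y y - h x y * h y x)"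
    by (simp only: bilinear_ladd[OF bil] bilinear_radd[OF bil] bilinear_lmul[OF bil] bilinear_rmul[OF bil]
        pos_inner_sym[OF assms(1), of y x]) (simp add: algebra_simps)
  finally show ?thesis using p by (simp add: zero_less_mult_iff)
qed

section \<open>The group and its Levi-Civita connection\<close>

lemma bounded_bilinear_cross3: "bounded_bilinear cross3"
  by (simp add: bilinear_cross flip: bilinear_conv_bounded_bilinear)

lemma vec3_eqI: "(x::real^3)$1 = y$1 \<Longrightarrow> x$2 = y$2 \<Longrightarrow> x$3 = y$3 \<Longrightarrow> x = y"
  by (simp add: vec_eq_iff forall_3)

lemma inner_3: "(x::real^3) \<bullet> y = x$1 * y$1 + x$2 * y$2 + x$3 * y$3"
  by (simp add: inner_vec_def sum_3)

lemma axis_3 [simp]: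
  "(axis 1 a :: real^3)$1 = a" "(axis 1 a :: real^3)$2 = 0" "(axis 1 a :: real^3)$3 = 0"
  "(axis 2 a :: real^3)$1 = 0" "(axis 2 a :: real^3)$2 = a" "(axis 2 a :: real^3)$3 = 0"
  "(axis 3 a :: real^3)$1 = 0" "(axis 3 a :: real^3)$2 = 0" "(axis 3 a :: real^3)$3 = a"
  by (simp_all add: axis_def)

lemma vector_3_axis: "(vector [a, b, c] :: real^3) = a *\<^sub>R axis 1 1 + b *\<^sub>R axis 2 1 + c *\<^sub>R axis 3 1"
  by (rule vec3_eqI) (simp_all add: vector_3)

locale e2 =
  fixes l1 l2 :: real
  assumes l12: "l1 > l2" and l2_pos: "l2 > 0"
begin

abbreviation g :: "(real^3) metric_field" where "g \<equiv> E2_metric l1 l2"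
abbreviation E :: frame where "E \<equiv> E2_frame l1 l2 (1 / (l1 * l2))"

lemma l1_pos: "l1 > 0" using l12 l2_pos by simp

lemma l_nonzero [simp]: "l1 \<noteq> 0" "l2 \<noteq> 0" using l1_pos l2_pos by auto

text \<open>The components of a tangent vector with respect to the orthonormal frame \<open>E\<close>.\<close>

definition coframe :: "real^3 \<Rightarrow> real^3 \<Rightarrow> real^3" where
  "coframe p X = vector [l2 * (- sin (p$3) * X$1 + cos (p$3) * X$2), X$3 / (l1 * l2),
     l1 * (cos (p$3) * X$1 + sin (p$3) * X$2)]"

text \<open>The frame has structure constants \<open>l2\<^sup>2\<close>, 0,
  \<open>l1\<^sup>2\<close>. Milnor's numbers, half their sum minus each of them, are
  \<open>m\<close>, \<open>s\<close>, \<open>- m\<close>.\<close>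

definition m :: real where "m = (l1\<^sup>2 - l2\<^sup>2) / 2"
definition s :: real where "s = (l1\<^sup>2 + l2\<^sup>2) / 2"

text \<open>Milnor's description of the Levi-Civita connection of a unimodular group:
  \<open>\<nabla>\<close> of the left-invariant field \<open>b\<close> in direction \<open>a\<close> is \<open>cross3 (conn a) b\<close>.\<close>

definition conn :: "real^3 \<Rightarrow> real^3" where "conn a = vector [m * a$1, s * a$2, - m * a$3]"

text \<open>The derivative of \<open>p \<mapsto> coframe p X\<close>, in frame components.\<close>

definition twist :: "real^3 \<Rightarrow> real^3 \<Rightarrow> real^3" where
  "twist a b = vector [- l2\<^sup>2 * a$2 * b$3, 0, l1\<^sup>2 * a$2 * b$1]"

lemma coframe_nth:
  "coframe p X $ 1 = l2 * (- sin (p$3) * X$1 + cos (p$3) * X$2)"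
  "coframe p X $ 2 = X$3 / (l1 * l2)"
  "coframe p X $ 3 = l1 * (cos (p$3) * X$1 + sin (p$3) * X$2)"
  by (simp_all add: coframe_def vector_3)

lemma conn_nth: "conn a $ 1 = m * a$1" "conn a $ 2 = s * a$2" "conn a $ 3 = - m * a$3"
  by (simp_all add: conn_def vector_3)

lemma twist_nth: "twist a b $ 1 = - l2\<^sup>2 * a$2 * b$3" "twist a b $ 2 = 0" "twist a b $ 3 = l1\<^sup>2 * a$2 * b$1"
  by (simp_all add: twist_def vector_3)

lemma linear_coframe: "linear (coframe p)"
  by (intro linearI vec3_eqI) (simp_all add: coframe_nth algebra_simps add_divide_distrib)

lemma linear_conn: "linear conn"
  by (intro linearI vec3_eqI) (simp_all add: conn_nth algebra_simps)

lemma bilinear_twist: "bilinear twist"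
  unfolding bilinear_def by (intro conjI allI linearI vec3_eqI) (simp_all add: twist_nth algebra_simps)

lemmas coframe_linear_simps = linear_add[OF linear_coframe] linear_diff[OF linear_coframe]
  linear_scale[OF linear_coframe] linear_0[OF linear_coframe]

lemmas conn_linear_simps = linear_add[OF linear_conn] linear_diff[OF linear_conn]
  linear_scale[OF linear_conn] linear_0[OF linear_conn]

lemma m_pos: "m > 0"
  using l12 l2_pos by (simp add: m_def power_strict_mono)

lemma m_less_s: "m < s"
  using l2_pos by (simp add: m_def s_def field_simps)

lemma g_eq: "g p X Y = coframe p X \<bullet> coframe p Y"
  by (simp add: E2_metric_def E2_metric3_def inner_3 coframe_nth power2_eq_square field_simps)

lemma coframe_E [simp]: "coframe p (E i p) = axis i 1"
proof -
  have "cos (p$3) * cos (p$3) + sin (p$3) * sin (p$3) = 1"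
    using sin_cos_squared_add2[of "p$3"] by (simp add: power2_eq_square)
  then show ?thesis
    using exhaust_3[of i]
    by (auto intro!: vec3_eqI simp: coframe_nth E2_frame_def vector_3 add.commute simp flip: add_divide_distrib)
qed

definition lift :: "real^3 \<Rightarrow> real^3 \<Rightarrow> real^3" where
  "lift p a = a$1 *\<^sub>R E 1 p + a$2 *\<^sub>R E 2 p + a$3 *\<^sub>R E 3 p"

lemma coframe_lift [simp]: "coframe p (lift p a) = a"
  unfolding lift_def coframe_linear_simps coframe_E by (rule vec3_eqI) simp_all

lemma coframe_eq_0: "coframe p X = 0 \<Longrightarrow> X = 0"
proof -
  have "surj (coframe p)" using coframe_lift by (metis surjI)
  then have "inj (coframe p)" using linear_coframe linear_surjective_imp_injective by blast
  then show "coframe p X = 0 \<Longrightarrow> X = 0"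
    using linear_injective_0[OF linear_coframe] by blast
qed

lemma coframe_inject: "coframe p X = coframe p Y \<longleftrightarrow> X = Y"
  using coframe_eq_0[of p "X - Y"] by (auto simp: coframe_linear_simps)

lemma pos_inner_g: "pos_inner (g p)"
proof -
  have "coframe p X \<bullet> coframe p X > 0" if "X \<noteq> 0" for X
    using coframe_eq_0 that by auto
  then show ?thesis
    by (auto simp: pos_inner_def g_eq[abs_def] bilinear_def inner_commute
        linear_iff coframe_linear_simps inner_add_left inner_add_right)
qed

text \<open>The base point enters \<open>coframe\<close> only through the angle z. Its variation
  rotates the first and third components into each other with speed l1 l2 times the second frame
  component of the velocity; together with the scale factors \<open>l2\<close> and \<open>l1\<close>
  this gives the squares in \<open>twist\<close>.\<close>

lemma has_derivative_coframe:
  assumes F: "(F has_derivative F') (at u)" and X: "(X has_derivative X') (at u)"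
  shows "((\<lambda>v. coframe (F v) (X v)) has_derivative
    (\<lambda>H. twist (coframe (F u) (F' H)) (coframe (F u) (X u)) + coframe (F u) (X' H))) (at u)"
proof -
  note Fn = bounded_linear.has_derivative[OF bounded_linear_vec_nth F]
    and Xn = bounded_linear.has_derivative[OF bounded_linear_vec_nth X]
  have "((\<lambda>v. l2 * (- sin (F v $ 3) * X v $ 1 + cos (F v $ 3) * X v $ 2)) has_derivative
      (\<lambda>H. l2 * (- cos (F u $ 3) * F' H $ 3 * X u $ 1 - sin (F u $ 3) * F' H $ 3 * X u $ 2)
        + l2 * (- sin (F u $ 3) * X' H $ 1 + cos (F u $ 3) * X' H $ 2))) (at u)" (is "(?a has_derivative ?a') _")
    and "((\<lambda>v. X v $ 3 / (l1 * l2)) has_derivative (\<lambda>H. X' H $ 3 / (l1 * l2))) (at u)" (is "(?b has_derivative ?b') _")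
    and "((\<lambda>v. l1 * (cos (F v $ 3) * X v $ 1 + sin (F v $ 3) * X v $ 2)) has_derivative
      (\<lambda>H. l1 * (- sin (F u $ 3) * F' H $ 3 * X u $ 1 + cos (F u $ 3) * F' H $ 3 * X u $ 2)
        + l1 * (cos (F u $ 3) * X' H $ 1 + sin (F u $ 3) * X' H $ 2))) (at u)" (is "(?c has_derivative ?c') _")
    by (rule derivative_eq_intros Fn Xn refl ext | simp add: algebra_simps)+
  then have "((\<lambda>v. ?a v *\<^sub>R axis 1 1 + ?b v *\<^sub>R axis 2 1 + ?c v *\<^sub>R axis 3 1 :: real^3) has_derivative
      (\<lambda>H. ?a' H *\<^sub>R axis 1 1 + ?b' H *\<^sub>R axis 2 1 + ?c' H *\<^sub>R axis 3 1)) (at u)"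
    by (intro has_derivative_add has_derivative_scaleR_left)
  moreover have "(\<lambda>H. ?a' H *\<^sub>R axis 1 1 + ?b' H *\<^sub>R axis 2 1 + ?c' H *\<^sub>R axis 3 1) =
      (\<lambda>H. twist (coframe (F u) (F' H)) (coframe (F u) (X u)) + coframe (F u) (X' H))"
    by (intro ext vec3_eqI) (simp_all add: coframe_nth twist_nth power2_eq_square field_simps)
  ultimately show ?thesis
    unfolding coframe_def[of "F _" "X _"] vector_3_axis by simp
qed

lemma dirderiv_coframe:
  assumes "F differentiable (at u)" "X differentiable (at u)"
  shows "dirderiv (\<lambda>v. coframe (F v) (X v)) u H =
    twist (coframe (F u) (dirderiv F u H)) (coframe (F u) (X u)) + coframe (F u) (dirderiv X u H)"
  using dirderiv_eq[OF has_derivative_coframe[OF assms[THEN has_derivative_dirderiv]]] by simp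

lemma smooth_on_coframe:
  assumes "open S" "smooth_on S F" "smooth_on S X"
  shows "smooth_on S (\<lambda>v. coframe (F v) (X v))"
  unfolding coframe_def vector_3_axis divide_inverse
  by (intro smooth_on_add smooth_on_diff smooth_on_uminus smooth_on_scaleR smooth_on_mult smooth_on_const
      smooth_on_sin smooth_on_cos smooth_on_nth assms)

lemma dirderiv_g:
  shows "dirderiv (\<lambda>q. g q Y W) p X =
    twist (coframe p X) (coframe p Y) \<bullet> coframe p W + coframe p Y \<bullet> twist (coframe p X) (coframe p W)"
    and differentiable_g: "(\<lambda>q. g q Y W) differentiable (at p)"
proof -
  have c: "((\<lambda>q. coframe q Z) has_derivative (\<lambda>H. twist (coframe p H) (coframe p Z))) (at p)" for Z
    using has_derivative_coframe[OF has_derivative_ident has_derivative_const[of Z], of p]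
    by (simp add: coframe_linear_simps)
  note d = has_derivative_inner[OF c[of Y] c[of W]]
  show "dirderiv (\<lambda>q. g q Y W) p X =
    twist (coframe p X) (coframe p Y) \<bullet> coframe p W + coframe p Y \<bullet> twist (coframe p X) (coframe p W)"
    unfolding g_eq dirderiv_eq[OF d] by simp
  show "(\<lambda>q. g q Y W) differentiable (at p)"
    unfolding g_eq differentiable_def using d by blast
qed

text \<open>A field with constant coordinates does not have constant frame components. The cross
  product is the connection in the frame, and \<open>twist\<close> is the derivative of the
  components.\<close>

lemma coframe_christoffel:
  "coframe p (christoffel g p X Y) = cross3 (conn (coframe p X)) (coframe p Y) + twist (coframe p X) (coframe p Y)"
proof -
  have "christoffel g p X Y =
    lift p (cross3 (conn (coframe p X)) (coframe p Y) + twist (coframe p X) (coframe p Y))"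
    by (rule christoffel_eqI[OF pos_inner_g])
      (unfold dirderiv_g, simp add: g_eq inner_3 cross_components conn_nth twist_nth m_def s_def field_simps)
  then show ?thesis by simp
qed

lemma E_differentiable: "E j differentiable (at p)"
proof -
  have "E 1 = (\<lambda>p. (1 / l2) *\<^sub>R ((- sin (p$3)) *\<^sub>R axis 1 1 + cos (p$3) *\<^sub>R axis 2 1))"
    "E 2 = (\<lambda>p. (l1 * l2) *\<^sub>R axis 3 1)"
    "E 3 = (\<lambda>p. (1 / l1) *\<^sub>R (cos (p$3) *\<^sub>R axis 1 1 + sin (p$3) *\<^sub>R axis 2 1))"
    by (simp_all add: fun_eq_iff E2_frame_def vector_3_axis)
  then have "smooth_on UNIV (E 1)" "smooth_on UNIV (E 2)" "smooth_on UNIV (E 3)"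
    by (simp_all only:, (intro smooth_on_add smooth_on_uminus smooth_on_scaleR smooth_on_const
      smooth_on_sin smooth_on_cos smooth_on_nth smooth_on_id open_UNIV)+)
  then have "smooth_on UNIV (E j)" using exhaust_3[of j] by auto
  then show ?thesis by (intro smooth_on_differentiable[of UNIV]) auto
qed

text \<open>The frame fields have constant components, so the \<open>twist\<close> terms
  cancel.\<close>

lemma coframe_cov_E:
  "coframe p (dirderiv (E j) p X + christoffel g p X (E j p)) = cross3 (conn (coframe p X)) (axis j 1)"
proof -
  have "dirderiv (\<lambda>q. coframe q (E j q)) p X = twist (coframe p X) (axis j 1) + coframe p (dirderiv (E j) p X)"
    by (subst dirderiv_coframe) (simp_all add: E_differentiable dirderiv_def)
  then have "coframe p (dirderiv (E j) p X) = - twist (coframe p X) (axis j 1)"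
    by (simp add: eq_neg_iff_add_eq_0 add.commute)
  then show ?thesis by (simp add: coframe_linear_simps coframe_christoffel)
qed

end

section \<open>The metric of the Grassmannian bundle\<close>

lemma numeral_mod_3: "(4::3) = 1" "(5::3) = 2"
  by simp_all

lemma index_distinct: "k + 1 \<noteq> k" "k + 2 \<noteq> k" "k + 1 \<noteq> k + 2" for k :: 3
  using exhaust_3[of k] by auto

lemma inner_index: "x \<bullet> y = x$k * y$k + x$(k+1) * y$(k+1) + x$(k+2) * y$(k+2)" for x y :: "real^3" and k :: 3
  using exhaust_3[of k] by (elim disjE) (simp_all add: inner_3 numeral_mod_3)

lemma vec_index_eqI: "x$k = y$k \<Longrightarrow> x$(k+1) = y$(k+1) \<Longrightarrow> x$(k+2) = y$(k+2) \<Longrightarrow> x = y" for x y :: "real^3" and k :: 3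
  using exhaust_3[of k] by (elim disjE) (auto intro: vec3_eqI simp: numeral_mod_3)

lemma axis_index [simp]:
  fixes k :: 3
  shows "(axis k a :: real^3) $ k = a" "(axis k a :: real^3) $ (k+1) = 0" "(axis k a :: real^3) $ (k+2) = 0"
    "(axis (k+1) a :: real^3) $ k = 0" "(axis (k+1) a :: real^3) $ (k+1) = a" "(axis (k+1) a :: real^3) $ (k+2) = 0"
    "(axis (k+2) a :: real^3) $ k = 0" "(axis (k+2) a :: real^3) $ (k+1) = 0" "(axis (k+2) a :: real^3) $ (k+2) = a"
  using index_distinct[of k] by (auto simp: axis_def)

text \<open>The plane with graph coordinates \<open>w\<close> is the orthogonal complement of \<open>nu k w\<close>.\<close>

definition lnu :: "3 \<Rightarrow> real^2 \<Rightarrow> real^3" where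
  "lnu k w = - (w$1 *\<^sub>R axis (k + 1) 1 + w$2 *\<^sub>R axis (k + 2) 1)"

definition nu :: "3 \<Rightarrow> real^2 \<Rightarrow> real^3" where "nu k w = axis k 1 + lnu k w"

definition gbas :: "3 \<Rightarrow> real^2 \<Rightarrow> 2 \<Rightarrow> real^3" where
  "gbas k w i = (if i = 1 then axis (k + 1) 1 else axis (k + 2) 1) + (w $ i) *\<^sub>R axis k 1"

definition rad :: "3 \<Rightarrow> real^2 \<Rightarrow> real" where "rad k w = inverse (norm (nu k w))"

definition unu :: "3 \<Rightarrow> real^2 \<Rightarrow> real^3" where "unu k w = rad k w *\<^sub>R nu k w"

definition dunu :: "3 \<Rightarrow> real^2 \<Rightarrow> real^2 \<Rightarrow> real^3" where
  "dunu k w \<eta> = rad k w *\<^sub>R lnu k \<eta> - (rad k w ^ 3 * (nu k w \<bullet> lnu k \<eta>)) *\<^sub>R nu k w"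

definition d2unu :: "3 \<Rightarrow> real^2 \<Rightarrow> real^2 \<Rightarrow> real^2 \<Rightarrow> real^3" where
  "d2unu k w \<xi> \<eta> = (3 * rad k w ^ 5 * (nu k w \<bullet> lnu k \<xi>) * (nu k w \<bullet> lnu k \<eta>)) *\<^sub>R nu k w
     - rad k w ^ 3 *\<^sub>R ((nu k w \<bullet> lnu k \<xi>) *\<^sub>R lnu k \<eta> + (nu k w \<bullet> lnu k \<eta>) *\<^sub>R lnu k \<xi>
        + (lnu k \<xi> \<bullet> lnu k \<eta>) *\<^sub>R nu k w)"

lemma lnu_nth [simp]: "lnu k w $ k = 0" "lnu k w $ (k+1) = - w$1" "lnu k w $ (k+2) = - w$2"
  by (simp_all add: lnu_def)

lemma nu_nth [simp]: "nu k w $ k = 1" "nu k w $ (k+1) = - w$1" "nu k w $ (k+2) = - w$2"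
  by (simp_all add: nu_def)

lemma gbas_nth [simp]:
  "gbas k w i $ k = w $ i" "gbas k w 1 $ (k+1) = 1" "gbas k w 1 $ (k+2) = 0"
  "gbas k w 2 $ (k+1) = 0" "gbas k w 2 $ (k+2) = 1"
  by (simp_all add: gbas_def)

lemma nu_nonzero: "nu k w \<noteq> 0"
  using nu_nth(1)[of k w] by (metis zero_index zero_neq_one)

lemma rad_pos: "rad k w > 0"
  by (simp add: rad_def nu_nonzero)

lemma rad_nu: "rad k w ^ 2 * (nu k w \<bullet> nu k w) = 1"
  using nu_nonzero by (simp add: rad_def power_inverse power2_norm_eq_inner)

lemma linear_lnu: "linear (lnu k)"
  by (rule linearI) (rule vec_index_eqI[of _ k]; simp)+

lemma linear_dunu: "linear (dunu k w)"
  unfolding dunu_def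
  by (rule linearI) (simp_all add: linear_add[OF linear_lnu] linear_scale[OF linear_lnu] inner_add_right algebra_simps)

lemma d2unu_commute: "d2unu k w \<xi> \<eta> = d2unu k w \<eta> \<xi>"
  by (simp add: d2unu_def algebra_simps inner_commute[of "lnu k \<xi>"])

lemma has_derivative_lnu: "(lnu k has_derivative lnu k) (at w)"
  using linear_lnu linear_conv_bounded_linear bounded_linear_imp_has_derivative by blast

lemma has_derivative_nu: "(nu k has_derivative lnu k) (at w)"
  unfolding nu_def by (rule has_derivative_eq_rhs[OF has_derivative_add[OF has_derivative_const has_derivative_lnu]]) simp

lemma has_derivative_rad: "(rad k has_derivative (\<lambda>\<eta>. - (rad k w ^ 3 * (nu k w \<bullet> lnu k \<eta>)))) (at w)"
proof -
  have "(norm has_derivative (\<lambda>h. nu k w \<bullet> h / norm (nu k w))) (at (nu k w))"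
    using has_derivative_norm[OF nu_nonzero[of k w]] by (simp add: sgn_div_norm divide_inverse mult.commute inner_commute)
  from has_derivative_compose[OF has_derivative_nu this]
  have n: "((\<lambda>w. norm (nu k w)) has_derivative (\<lambda>\<eta>. nu k w \<bullet> lnu k \<eta> / norm (nu k w))) (at w)" .
  show ?thesis
    unfolding rad_def
    by (rule has_derivative_eq_rhs[OF Deriv.has_derivative_inverse[OF _ n]])
      (simp_all add: nu_nonzero fun_eq_iff field_simps power3_eq_cube)
qed

lemma has_derivative_unu: "(unu k has_derivative dunu k w) (at w)"
  unfolding unu_def
  by (rule has_derivative_eq_rhs[OF has_derivative_scaleR[OF has_derivative_rad has_derivative_nu]])
    (simp add: dunu_def fun_eq_iff)

lemma has_derivative_dunu: "((\<lambda>w. dunu k w \<eta>) has_derivative (\<lambda>\<xi>. d2unu k w \<xi> \<eta>)) (at w)"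
proof -
  have i: "((\<lambda>w. nu k w \<bullet> lnu k \<eta>) has_derivative (\<lambda>\<xi>. lnu k \<xi> \<bullet> lnu k \<eta>)) (at w)"
    by (rule has_derivative_inner_left[OF has_derivative_nu])
  have r3: "((\<lambda>w. rad k w ^ 3) has_derivative (\<lambda>\<xi>. - 3 * rad k w ^ 5 * (nu k w \<bullet> lnu k \<xi>))) (at w)"
    by (rule has_derivative_eq_rhs[OF has_derivative_power[OF has_derivative_rad]])
      (simp add: fun_eq_iff numeral_eq_Suc)
  show ?thesis
    unfolding dunu_def
    by (rule has_derivative_eq_rhs[OF has_derivative_diff[OF
          has_derivative_scaleR_left[OF has_derivative_rad]
          has_derivative_scaleR[OF has_derivative_mult[OF r3 i] has_derivative_nu]]])
      (simp add: d2unu_def fun_eq_iff algebra_simps)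
qed

lemma unu_unit: "unu k w \<bullet> unu k w = 1"
  using rad_nu[of k w] by (simp add: unu_def power2_eq_square mult.assoc)

lemma unu_dunu: "unu k w \<bullet> dunu k w \<eta> = 0"
proof -
  have "unu k w \<bullet> dunu k w \<eta> = (nu k w \<bullet> lnu k \<eta>) * (rad k w ^ 2 - rad k w ^ 2 * (rad k w ^ 2 * (nu k w \<bullet> nu k w)))"
    by (simp add: unu_def dunu_def inner_diff_right power2_eq_square power3_eq_cube algebra_simps)
  then show ?thesis by (simp add: rad_nu)
qed

lemma gbas_nu: "gbas k w i \<bullet> nu k w = 0"
  using exhaust_2[of i] by (auto simp: inner_index[of _ _ k])

text \<open>This is the derivative in direction \<open>\<eta>\<close> of the orthogonality of
  \<open>gbas k w i\<close> and \<open>unu k w\<close>.\<close>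

lemma gbas_dunu: "gbas k w i \<bullet> dunu k w \<eta> = - (\<eta> $ i * (axis k 1 \<bullet> unu k w))"
  using exhaust_2[of i] by (auto simp: dunu_def inner_diff_right gbas_nu unu_def inner_index[of _ _ k])

lemma gbas_expand:
  assumes "x \<bullet> nu k w = 0"
  shows "x = x$(k+1) *\<^sub>R gbas k w 1 + x$(k+2) *\<^sub>R gbas k w 2"
  using assms by (intro vec_index_eqI[of _ k]) (simp_all add: inner_index[of _ _ k])

lemma dunu_surj:
  assumes "x \<bullet> nu k w = 0"
  obtains \<eta> where "dunu k w \<eta> = rad k w *\<^sub>R x"
proof
  \<comment> \<open>Subtracting \<open>x$k\<close> times \<open>nu k w\<close> makes the
    \<open>k\<close>-th entry zero, so the difference lies in the range of \<open>lnu k\<close>; the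
    subtracted normal part is restored by the projection term of \<open>dunu\<close>.\<close>
  define \<eta> :: "real^2" where "\<eta> = vector [- (x - x$k *\<^sub>R nu k w)$(k+1), - (x - x$k *\<^sub>R nu k w)$(k+2)]"
  have l: "lnu k \<eta> = x - x$k *\<^sub>R nu k w"
    by (intro vec_index_eqI[of _ k]) (simp_all add: \<eta>_def vector_2)
  have "nu k w \<bullet> lnu k \<eta> = - x$k * (nu k w \<bullet> nu k w)"
    using assms by (simp add: l inner_diff_right inner_commute)
  then have "rad k w ^ 3 * (nu k w \<bullet> lnu k \<eta>) = - x$k * rad k w * (rad k w ^ 2 * (nu k w \<bullet> nu k w))"
    by (simp add: power2_eq_square power3_eq_cube)
  then have r: "rad k w ^ 3 * (nu k w \<bullet> lnu k \<eta>) = - (x$k * rad k w)"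
    by (simp only: rad_nu)
  show "dunu k w \<eta> = rad k w *\<^sub>R x"
    unfolding dunu_def r unfolding l by (simp add: algebra_simps)
qed

lemma dunu_inj: "dunu k w \<eta> = 0 \<Longrightarrow> \<eta> = 0"
proof -
  assume "dunu k w \<eta> = 0"
  then have "\<eta> $ i * (axis k 1 \<bullet> unu k w) = 0" for i
    using gbas_dunu[of k w i \<eta>] by simp
  moreover have "axis k 1 \<bullet> unu k w = rad k w"
    by (simp add: unu_def inner_index[of _ _ k])
  ultimately have "\<eta> $ i = 0" for i using rad_pos[of k w] by (metis less_irrefl mult_eq_0_iff)
  then show "\<eta> = 0" by (simp add: vec_eq_iff)
qed

text \<open>Parseval's identity for a basis that need not be orthonormal: the inverse Gram matrix
  corrects the products. Only \<open>x\<close> has to lie in the span.\<close>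

lemma gram_trace_inner:
  fixes b :: "2 \<Rightarrow> 'a::real_inner"
  assumes ind: "(b 1 \<bullet> b 1) * (b 2 \<bullet> b 2) - (b 1 \<bullet> b 2) * (b 1 \<bullet> b 2) \<noteq> 0"
    and x: "x = x1 *\<^sub>R b 1 + x2 *\<^sub>R b 2"
  shows "gram_trace (\<chi> i j. b i \<bullet> b j) (\<lambda>i j. (b i \<bullet> x) * (b j \<bullet> y)) = x \<bullet> y"
proof -
  have xb: "b 1 \<bullet> x = x1 * (b 1 \<bullet> b 1) + x2 * (b 1 \<bullet> b 2)" "b 2 \<bullet> x = x1 * (b 1 \<bullet> b 2) + x2 * (b 2 \<bullet> b 2)"
    "x \<bullet> y = x1 * (b 1 \<bullet> y) + x2 * (b 2 \<bullet> y)"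
    by (simp_all add: x inner_add_left inner_add_right inner_commute)
  define d where "d = (b 1 \<bullet> b 1) * (b 2 \<bullet> b 2) - (b 1 \<bullet> b 2) * (b 1 \<bullet> b 2)"
  have "(b 2 \<bullet> b 2) * ((b 1 \<bullet> x) * (b 1 \<bullet> y)) - (b 1 \<bullet> b 2) * ((b 1 \<bullet> x) * (b 2 \<bullet> y))
      - (b 1 \<bullet> b 2) * ((b 2 \<bullet> x) * (b 1 \<bullet> y)) + (b 1 \<bullet> b 1) * ((b 2 \<bullet> x) * (b 2 \<bullet> y)) = d * (x \<bullet> y)"
    unfolding xb d_def by algebra
  moreover have "d \<noteq> 0" using ind by (simp add: d_def)
  moreover have "gram_trace (\<chi> i j. b i \<bullet> b j) (\<lambda>i j. (b i \<bullet> x) * (b j \<bullet> y)) = (1 / d) *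
      ((b 2 \<bullet> b 2) * ((b 1 \<bullet> x) * (b 1 \<bullet> y)) - (b 1 \<bullet> b 2) * ((b 1 \<bullet> x) * (b 2 \<bullet> y))
      - (b 1 \<bullet> b 2) * ((b 2 \<bullet> x) * (b 1 \<bullet> y)) + (b 1 \<bullet> b 1) * ((b 2 \<bullet> x) * (b 2 \<bullet> y)))"
    unfolding d_def
    using gram_trace_2[of "\<chi> i j. b i \<bullet> b j" "\<lambda>i j. (b i \<bullet> x) * (b j \<bullet> y)"] ind
    by (simp only: vec_lambda_beta inner_commute[of "b 2" "b 1"] real_scaleR_def not_False_eq_True)
  ultimately show ?thesis by simp
qed

lemma gbas_independent:
  assumes "a *\<^sub>R gbas k w 1 + b *\<^sub>R gbas k w 2 = 0"
  shows "a = 0 \<and> b = 0"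
  using arg_cong[OF assms, of "\<lambda>v. v $ (k+1)"] arg_cong[OF assms, of "\<lambda>v. v $ (k+2)"] by simp

lemma pos_inner_inner: "pos_inner ((\<bullet>) :: 'a::euclidean_space \<Rightarrow> 'a \<Rightarrow> real)"
  by (auto simp: pos_inner_def bilinear_def linear_iff inner_add_left inner_add_right inner_commute)

lemma gbas_gram: "(gbas k w 1 \<bullet> gbas k w 1) * (gbas k w 2 \<bullet> gbas k w 2) - (gbas k w 1 \<bullet> gbas k w 2) * (gbas k w 1 \<bullet> gbas k w 2) \<noteq> 0"
  using gram_det_pos[OF pos_inner_inner, of "gbas k w 1" "gbas k w 2"] gbas_independent[of _ k w]
  by (simp add: inner_commute)

lemma cross3_inner_swap: "cross3 c b \<bullet> u = - (b \<bullet> cross3 c u)"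
  by (simp add: cross3_simps)

section \<open>The bundle metric in terms of the unit normal of the plane\<close>

context e2
begin

lemma coframe_gr_basis: "coframe (fst P) (gr_basis E k P i) = gbas k (snd P) i"
  by (simp add: gr_basis_def gbas_def coframe_linear_simps)

lemma gr_plane_eq: "gr_plane E k P = {X. coframe (fst P) X \<bullet> nu k (snd P) = 0}"
proof (intro equalityI subsetI)
  have "subspace {X. coframe (fst P) X \<bullet> nu k (snd P) = 0}"
    by (auto simp: subspace_def coframe_linear_simps inner_add_left)
  then have "span (range (gr_basis E k P)) \<subseteq> {X. coframe (fst P) X \<bullet> nu k (snd P) = 0}"
    by (intro span_minimal) (auto simp: coframe_gr_basis gbas_nu)
  then show "X \<in> {X. coframe (fst P) X \<bullet> nu k (snd P) = 0}" if "X \<in> gr_plane E k P" for X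
    using that by (auto simp: gr_plane_def)
next
  fix X assume "X \<in> {X. coframe (fst P) X \<bullet> nu k (snd P) = 0}"
  then have "coframe (fst P) X = coframe (fst P)
      (coframe (fst P) X $ (k+1) *\<^sub>R gr_basis E k P 1 + coframe (fst P) X $ (k+2) *\<^sub>R gr_basis E k P 2)"
    using gbas_expand[of "coframe (fst P) X" k "snd P"] by (simp add: coframe_linear_simps coframe_gr_basis)
  then have "X = coframe (fst P) X $ (k+1) *\<^sub>R gr_basis E k P 1 + coframe (fst P) X $ (k+2) *\<^sub>R gr_basis E k P 2"
    by (simp only: coframe_inject)
  also have "\<dots> \<in> gr_plane E k P"
    unfolding gr_plane_def by (intro span_add span_scale span_base) auto
  finally show "X \<in> gr_plane E k P" .
qed

lemma subspace_gr_plane: "subspace (gr_plane E k P)"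
  by (simp add: gr_plane_def)

text \<open>The covariant derivative of the unit normal field of the plane in direction \<open>\<xi>\<close>. The natural
  metric is the base metric plus \<open>\<kappa>\<close> times the inner product of these derivatives.\<close>

definition vert :: "3 \<Rightarrow> (real^3) \<times> (real^2) \<Rightarrow> (real^3) \<times> (real^2) \<Rightarrow> real^3" where
  "vert k P \<xi> = dunu k (snd P) (snd \<xi>) + cross3 (conn (coframe (fst P) (fst \<xi>))) (unu k (snd P))"

lemma unu_vert: "vert k P \<xi> \<bullet> unu k (snd P) = 0"
  by (subst inner_commute) (simp add: vert_def inner_add_right unu_dunu dot_cross_self)

lemma linear_vert: "linear (vert k P)"
  unfolding vert_def
  by (rule linearI) (simp_all add: linear_add[OF linear_dunu] linear_scale[OF linear_dunu]
      coframe_linear_simps conn_linear_simps cross_add_left cross_mult_left scaleR_add_right)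

text \<open>Differentiating the orthogonality of a basis section and the unit normal moves the
  derivative to the normal: the normal part of the derivative of b is minus the product of b with
  the derivative of the normal.\<close>

lemma coframe_gr_vertical: "coframe (fst P) (gr_vertical g E k P \<xi> i) = - (gbas k (snd P) i \<bullet> vert k P \<xi>) *\<^sub>R unu k (snd P)"
proof -
  let ?p = "fst P" and ?w = "snd P" and ?b = "gbas k (snd P) i"
  define j where "j = (if i = 1 then k + 1 else k + 2)"
  have gb: "gr_basis E k Q i = E j (fst Q) + (snd Q $ i) *\<^sub>R E k (fst Q)" for Q
    by (simp add: gr_basis_def j_def)
  have dE: "((\<lambda>Q. E a (fst Q)) has_derivative (\<lambda>\<xi>. dirderiv (E a) ?p (fst \<xi>))) (at P)" for a
    using has_derivative_compose[OF has_derivative_fst[OF has_derivative_ident] has_derivative_dirderiv[OF E_differentiable]] .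
  have dw: "((\<lambda>Q. snd Q $ i) has_derivative (\<lambda>\<xi>. snd \<xi> $ i)) (at P)"
    using bounded_linear.has_derivative[OF bounded_linear_vec_nth has_derivative_snd[OF has_derivative_ident]] .
  have d: "dirderiv (\<lambda>Q. gr_basis E k Q i) P \<xi> = dirderiv (E j) ?p (fst \<xi>) + (?w $ i *\<^sub>R dirderiv (E k) ?p (fst \<xi>) + snd \<xi> $ i *\<^sub>R E k ?p)"
    unfolding gb using dirderiv_eq[OF has_derivative_add[OF dE has_derivative_scaleR[OF dw dE]]] by simp
  define Db where "Db = dirderiv (\<lambda>Q. gr_basis E k Q i) P \<xi> + christoffel g ?p (fst \<xi>) (gr_basis E k P i)"
  have "coframe ?p Db = snd \<xi> $ i *\<^sub>R axis k 1
      + cross3 (conn (coframe ?p (fst \<xi>))) ?b"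
  proof -
    have "coframe ?p Db = coframe ?p (dirderiv (E j) ?p (fst \<xi>) + christoffel g ?p (fst \<xi>) (E j ?p))
      + ?w $ i *\<^sub>R coframe ?p (dirderiv (E k) ?p (fst \<xi>) + christoffel g ?p (fst \<xi>) (E k ?p)) + snd \<xi> $ i *\<^sub>R axis k 1"
      unfolding Db_def d coframe_linear_simps coframe_christoffel coframe_gr_basis
      by (simp add: gbas_def j_def cross_add_right cross_mult_right bilinear_radd[OF bilinear_twist]
          bilinear_rmul[OF bilinear_twist] algebra_simps)
    then show ?thesis
      unfolding coframe_cov_E by (simp add: gbas_def j_def cross_add_right cross_mult_right)
  qed
  then have n: "coframe ?p Db \<bullet> unu k ?w = - (?b \<bullet> vert k P \<xi>)"
    by (simp add: vert_def inner_add_left inner_add_right gbas_dunu cross3_inner_swap)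
  \<comment> \<open>The candidate for the projection: the covariant derivative with its unit normal
    part removed.\<close>
  let ?y = "lift ?p (coframe ?p Db - (coframe ?p Db \<bullet> unu k ?w) *\<^sub>R unu k ?w)"
  have "orth_proj (g ?p) (gr_plane E k P) Db = ?y"
  proof (rule orth_proj_eqI[OF pos_inner_g subspace_gr_plane])
    have "nu k ?w = inverse (rad k ?w) *\<^sub>R unu k ?w"
      using rad_pos[of k ?w] by (simp add: unu_def)
    then show "?y \<in> gr_plane E k P"
      by (simp add: gr_plane_eq inner_diff_left unu_unit)
    fix X assume "X \<in> gr_plane E k P"
    then have "coframe ?p X \<bullet> nu k ?w = 0" by (simp add: gr_plane_eq)
    then show "g ?p (Db - ?y) X = 0"
      by (simp add: g_eq coframe_linear_simps unu_def inner_commute)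
  qed
  then show ?thesis
    unfolding gr_vertical_def Let_def Db_def[symmetric] by (simp add: coframe_linear_simps n)
qed

text \<open>By \<open>coframe_gr_vertical\<close> the homomorphisms take values on the normal line
  and are represented by \<open>vert\<close>, so their Hilbert-Schmidt product is the dot product of
  these vectors.\<close>

lemma gr_metric_eq:
  "gr_metric g \<kappa> E k P \<xi> \<eta> = coframe (fst P) (fst \<xi>) \<bullet> coframe (fst P) (fst \<eta>) + \<kappa> * (vert k P \<xi> \<bullet> vert k P \<eta>)"
proof -
  have "vert k P \<xi> \<bullet> nu k (snd P) = 0"
    using unu_vert[of k P \<xi>] rad_pos[of k "snd P"] by (simp add: unu_def)
  from gbas_expand[OF this] have "gram_trace (\<chi> i j. gbas k (snd P) i \<bullet> gbas k (snd P) j)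
      (\<lambda>i j. (gbas k (snd P) i \<bullet> vert k P \<xi>) * (gbas k (snd P) j \<bullet> vert k P \<eta>)) = vert k P \<xi> \<bullet> vert k P \<eta>"
    by (rule gram_trace_inner[OF gbas_gram])
  then show ?thesis
    by (simp add: gr_metric_def g_eq coframe_gr_basis coframe_gr_vertical unu_unit mult.commute)
qed

lemma pos_inner_gr_metric:
  assumes "\<kappa> > 0"
  shows "pos_inner (gr_metric g \<kappa> E k P)"
proof -
  have "gr_metric g \<kappa> E k P \<xi> \<xi> > 0" if "\<xi> \<noteq> 0" for \<xi>
  proof (cases "fst \<xi> = 0")
    case False
    then have "coframe (fst P) (fst \<xi>) \<bullet> coframe (fst P) (fst \<xi>) > 0"
      using coframe_eq_0 by auto
    then show ?thesis using assms by (simp add: gr_metric_eq add_pos_nonneg)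
  next
    case True
    then have "snd \<xi> \<noteq> 0" using that by (simp add: prod_eq_iff)
    then have "vert k P \<xi> \<noteq> 0"
      using dunu_inj True by (auto simp: vert_def coframe_linear_simps conn_linear_simps)
    then show ?thesis using assms by (simp add: gr_metric_eq True coframe_linear_simps)
  qed
  then show ?thesis
    by (simp add: pos_inner_def gr_metric_eq[abs_def] bilinear_def linear_iff coframe_linear_simps
        linear_add[OF linear_vert] linear_scale[OF linear_vert] inner_add_left inner_add_right inner_commute algebra_simps)
qed

definition dvert :: "3 \<Rightarrow> (real^3) \<times> (real^2) \<Rightarrow> (real^3) \<times> (real^2) \<Rightarrow> (real^3) \<times> (real^2) \<Rightarrow> real^3" where
  "dvert k P \<zeta> \<xi> = d2unu k (snd P) (snd \<zeta>) (snd \<xi>)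
     + cross3 (conn (twist (coframe (fst P) (fst \<zeta>)) (coframe (fst P) (fst \<xi>)))) (unu k (snd P))
     + cross3 (conn (coframe (fst P) (fst \<xi>))) (dunu k (snd P) (snd \<zeta>))"

lemma has_derivative_coframe_fst:
  "((\<lambda>Q. coframe (fst Q) X) has_derivative (\<lambda>\<zeta>. twist (coframe (fst P) (fst \<zeta>)) (coframe (fst P) X))) (at P)"
  using has_derivative_coframe[OF has_derivative_fst[OF has_derivative_ident] has_derivative_const[of X], of P]
  by (simp add: coframe_linear_simps)

lemma has_derivative_vert: "((\<lambda>Q. vert k Q \<xi>) has_derivative (\<lambda>\<zeta>. dvert k P \<zeta> \<xi>)) (at P)"
proof -
  have sn: "(snd has_derivative snd) (at P)"
    by (rule bounded_linear_imp_has_derivative[OF bounded_linear_snd])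
  note c = bounded_linear.has_derivative[OF linear_conn[unfolded linear_conv_bounded_linear] has_derivative_coframe_fst]
  note dd = has_derivative_compose[OF sn has_derivative_dunu] and du = has_derivative_compose[OF sn has_derivative_unu]
  show ?thesis
    unfolding vert_def
    by (rule has_derivative_eq_rhs[OF has_derivative_add[OF dd bounded_bilinear.FDERIV[OF bounded_bilinear_cross3 c du]]])
      (simp add: dvert_def fun_eq_iff)
qed

lemma
  shows dirderiv_gr_metric: "dirderiv (\<lambda>Q. gr_metric g \<kappa> E k Q \<xi> \<eta>) P \<zeta> =
      twist (coframe (fst P) (fst \<zeta>)) (coframe (fst P) (fst \<xi>)) \<bullet> coframe (fst P) (fst \<eta>)
      + coframe (fst P) (fst \<xi>) \<bullet> twist (coframe (fst P) (fst \<zeta>)) (coframe (fst P) (fst \<eta>))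
      + \<kappa> * (dvert k P \<zeta> \<xi> \<bullet> vert k P \<eta> + vert k P \<xi> \<bullet> dvert k P \<zeta> \<eta>)"
    and differentiable_gr_metric: "(\<lambda>Q. gr_metric g \<kappa> E k Q \<xi> \<eta>) differentiable (at P)"
proof -
  have d: "((\<lambda>Q. coframe (fst Q) (fst \<xi>) \<bullet> coframe (fst Q) (fst \<eta>) + \<kappa> * (vert k Q \<xi> \<bullet> vert k Q \<eta>)) has_derivative
      (\<lambda>\<zeta>. twist (coframe (fst P) (fst \<zeta>)) (coframe (fst P) (fst \<xi>)) \<bullet> coframe (fst P) (fst \<eta>)
      + coframe (fst P) (fst \<xi>) \<bullet> twist (coframe (fst P) (fst \<zeta>)) (coframe (fst P) (fst \<eta>))
      + \<kappa> * (dvert k P \<zeta> \<xi> \<bullet> vert k P \<eta> + vert k P \<xi> \<bullet> dvert k P \<zeta> \<eta>))) (at P)"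
    by (rule has_derivative_eq_rhs[OF has_derivative_add[OF has_derivative_inner[OF has_derivative_coframe_fst has_derivative_coframe_fst]
      has_derivative_mult_right[OF has_derivative_inner[OF has_derivative_vert has_derivative_vert]]]])
      (simp add: fun_eq_iff add.commute)
  show "dirderiv (\<lambda>Q. gr_metric g \<kappa> E k Q \<xi> \<eta>) P \<zeta> =
      twist (coframe (fst P) (fst \<zeta>)) (coframe (fst P) (fst \<xi>)) \<bullet> coframe (fst P) (fst \<eta>)
      + coframe (fst P) (fst \<xi>) \<bullet> twist (coframe (fst P) (fst \<zeta>)) (coframe (fst P) (fst \<eta>))
      + \<kappa> * (dvert k P \<zeta> \<xi> \<bullet> vert k P \<eta> + vert k P \<xi> \<bullet> dvert k P \<zeta> \<eta>)"
    unfolding gr_metric_eq by (simp add: dirderiv_eq[OF d])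
  show "(\<lambda>Q. gr_metric g \<kappa> E k Q \<xi> \<eta>) differentiable (at P)"
    unfolding gr_metric_eq differentiable_def using d by blast
qed

lemma koszul_gr_metric:
  assumes "\<kappa> > 0"
  shows "2 * gr_metric g \<kappa> E k P (christoffel (gr_metric g \<kappa> E k) P X Y) W =
    dirderiv (\<lambda>Q. gr_metric g \<kappa> E k Q Y W) P X + dirderiv (\<lambda>Q. gr_metric g \<kappa> E k Q X W) P Y
    - dirderiv (\<lambda>Q. gr_metric g \<kappa> E k Q X Y) P W"
  by (rule koszul[OF open_UNIV UNIV_I]) (simp_all add: pos_inner_gr_metric[OF assms] differentiable_gr_metric)

end

section \<open>Surfaces and the Codazzi equation\<close>

text \<open>The algebra behind differentiating a trace in a moving basis \<open>a1\<close>,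
  \<open>a2\<close>. \<open>Y1\<close>, \<open>Y2\<close> are the images of the basis under the
  operator, \<open>d1\<close>, \<open>d2\<close>, \<open>y1\<close>, \<open>y2\<close> stand for
  derivatives, and \<open>dH\<close> is the product rule applied to \<open>H\<close> with
  \<open>c\<close> constant. Once \<open>c\<close> is recognised as the trace
  \<open>p1 + q2\<close>, the derivatives of the Gram matrix cancel.\<close>

lemma shape_trace_derivative:
  fixes Y1 Y2 a1 a2 d1 d2 y1 y2 :: "'a::real_inner"
  defines "g11 \<equiv> a1 \<bullet> a1" and "g12 \<equiv> a1 \<bullet> a2" and "g22 \<equiv> a2 \<bullet> a2"
  assumes Y1: "Y1 = p1 *\<^sub>R a1 + q1 *\<^sub>R a2" and Y2: "Y2 = p2 *\<^sub>R a1 + q2 *\<^sub>R a2"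
    and sym: "Y1 \<bullet> a2 = Y2 \<bullet> a1"
    and det: "g11 * g22 - g12 * g12 \<noteq> 0"
    and H: "c * (g11 * g22 - g12 * g12) = g22 * (Y1 \<bullet> a1) - g12 * (Y1 \<bullet> a2) - g12 * (Y2 \<bullet> a1) + g11 * (Y2 \<bullet> a2)"
    and dH: "c * (2 * (d1 \<bullet> a1) * g22 + g11 * (2 * (d2 \<bullet> a2)) - 2 * g12 * (d1 \<bullet> a2 + a1 \<bullet> d2))
      = 2 * (d2 \<bullet> a2) * (Y1 \<bullet> a1) + g22 * (y1 \<bullet> a1 + Y1 \<bullet> d1)
        - (d1 \<bullet> a2 + a1 \<bullet> d2) * (Y1 \<bullet> a2) - g12 * (y1 \<bullet> a2 + Y1 \<bullet> d2)
        - (d1 \<bullet> a2 + a1 \<bullet> d2) * (Y2 \<bullet> a1) - g12 * (y2 \<bullet> a1 + Y2 \<bullet> d1)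
        + 2 * (d1 \<bullet> a1) * (Y2 \<bullet> a2) + g11 * (y2 \<bullet> a2 + Y2 \<bullet> d2)"
  shows "g22 * (y1 \<bullet> a1 - Y1 \<bullet> d1) - g12 * (y1 \<bullet> a2 - Y2 \<bullet> d1) - g12 * (y2 \<bullet> a1 - Y1 \<bullet> d2) + g11 * (y2 \<bullet> a2 - Y2 \<bullet> d2) = 0"
proof -
  define d11 d12 d21 d22 where "d11 = d1 \<bullet> a1" "d12 = d1 \<bullet> a2" "d21 = a1 \<bullet> d2" "d22 = d2 \<bullet> a2"
  have Yd: "Y1 \<bullet> d1 = p1 * d11 + q1 * d12" "Y1 \<bullet> d2 = p1 * d21 + q1 * d22"
    "Y2 \<bullet> d1 = p2 * d11 + q2 * d12" "Y2 \<bullet> d2 = p2 * d21 + q2 * d22"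
    by (simp_all add: Y1 Y2 inner_add_left inner_add_right inner_commute d11_d12_d21_d22_def)
  have Ya: "Y1 \<bullet> a1 = p1 * g11 + q1 * g12" "Y1 \<bullet> a2 = p1 * g12 + q1 * g22"
    "Y2 \<bullet> a1 = p2 * g11 + q2 * g12" "Y2 \<bullet> a2 = p2 * g12 + q2 * g22"
    by (simp_all add: Y1 Y2 inner_add_left inner_add_right g11_def g12_def g22_def inner_commute)
  have "(c - p1 - q2) * (g11 * g22 - g12 * g12) = 0"
    using H unfolding Ya by (simp add: algebra_simps)
  then have c: "c = p1 + q2" using det by simp
  \<comment> \<open>All that separates \<open>dH\<close> from the goal: the asymmetry of the
    operator times \<open>d21 - d12\<close>.\<close>
  have "((p1 * g12 + q1 * g22) - (p2 * g11 + q2 * g12)) * (d21 - d12) = 0"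
    using sym unfolding Ya by simp
  then show ?thesis
    using dH unfolding Yd Ya c d11_d12_d21_d22_def[symmetric] by (simp add: algebra_simps)
qed

section \<open>Vector fields along a surface in frame components\<close>

locale surface = e2 +
  fixes S :: "(real^2) set" and F n :: "real^2 \<Rightarrow> real^3"
  assumes open_S: "open S" and smooth_F: "smooth_on S F" and smooth_n: "smooth_on S n"
    and immersion: "\<And>u. u \<in> S \<Longrightarrow> inj (dirderiv F u)"
    and unit_normal: "\<And>u. u \<in> S \<Longrightarrow> g (F u) (n u) (n u) = 1"
    and orth_normal: "\<And>u X. u \<in> S \<Longrightarrow> g (F u) (dirderiv F u X) (n u) = 0"
begin

definition al :: "real^2 \<Rightarrow> real^2 \<Rightarrow> real^3" where "al X u = coframe (F u) (dirderiv F u X)"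
definition nn :: "real^2 \<Rightarrow> real^3" where "nn u = coframe (F u) (n u)"
text \<open>The pullback to the surface of the ambient Levi-Civita connection, for fields given by
  their frame components.\<close>

definition cov :: "real^2 \<Rightarrow> (real^2 \<Rightarrow> real^3) \<Rightarrow> real^2 \<Rightarrow> real^3" where
  "cov X V u = dirderiv V u X + cross3 (conn (al X u)) (V u)"
text \<open>The curvature operator under the identification of bivectors with vectors by the cross
  product. Its eigenvalues are minus the sectional curvatures of the planes orthogonal to the frame
  vectors; subtracting its trace \<open>m\<^sup>2\<close> times the identity gives the Ricci
  tensor.\<close>

definition curv :: "real^3 \<Rightarrow> real^3" where
  "curv x = vector [(m\<^sup>2 - 2 * m * s) * x$1, - m\<^sup>2 * x$2, (m\<^sup>2 + 2 * m * s) * x$3]"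

abbreviation gM :: "(real^2) metric_field" where "gM \<equiv> induced_metric g F"

lemma smooth_al: "smooth_on S (al X)"
  unfolding al_def[abs_def] by (intro smooth_on_coframe open_S smooth_F smooth_on_dirderiv)

lemma smooth_nn: "smooth_on S nn"
  unfolding nn_def[abs_def] by (intro smooth_on_coframe open_S smooth_F smooth_n)

lemma smooth_cov:
  assumes "smooth_on S V"
  shows "smooth_on S (cov X V)"
  unfolding cov_def[abs_def]
  by (intro smooth_on_add smooth_on_dirderiv smooth_on_bilinear[OF _ bounded_bilinear_cross3]
      smooth_on_linear[OF _ linear_conn] open_S assms smooth_al)

lemmas differentiable_al = smooth_on_differentiable[OF smooth_al]
lemmas differentiable_nn = smooth_on_differentiable[OF smooth_nn]
lemmas differentiable_F = smooth_on_differentiable[OF smooth_F]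

lemma linear_al: "u \<in> S \<Longrightarrow> linear (\<lambda>X. al X u)"
  unfolding al_def using linear_compose[OF linear_dirderiv[OF differentiable_F] linear_coframe] by (simp add: o_def)

lemma inj_al: "u \<in> S \<Longrightarrow> inj (\<lambda>X. al X u)"
  using immersion by (auto simp: inj_def al_def coframe_inject)

lemma al_eq_0: "u \<in> S \<Longrightarrow> al X u = 0 \<Longrightarrow> X = 0"
  using linear_injective_0[OF linear_al] inj_al by blast

lemma nn_unit: "u \<in> S \<Longrightarrow> nn u \<bullet> nn u = 1"
  using unit_normal by (simp add: nn_def g_eq)

lemma al_nn: "u \<in> S \<Longrightarrow> al X u \<bullet> nn u = 0"
  using orth_normal by (simp add: nn_def al_def g_eq)

lemma range_al:
  assumes u: "u \<in> S"
  shows "range (\<lambda>X. al X u) = {x. nn u \<bullet> x = 0}"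
proof (rule subspace_dim_equal)
  show "subspace (range (\<lambda>X. al X u))"
    using linear_subspace_image[OF linear_al[OF u]] by simp
  show "subspace {x. nn u \<bullet> x = 0}" by (rule subspace_hyperplane)
  show "range (\<lambda>X. al X u) \<subseteq> {x. nn u \<bullet> x = 0}"
    using al_nn[OF u] by (auto simp: inner_commute)
  have "nn u \<noteq> 0" using nn_unit[OF u] by auto
  then have "dim {x. nn u \<bullet> x = 0} = 2" by (simp add: dim_hyperplane)
  moreover have "dim (range (\<lambda>X. al X u)) = dim (UNIV :: (real^2) set)"
    using inj_al[OF u] by (intro dim_image_eq linear_al u) (simp add: inj_on_subset)
  ultimately show "dim {x. nn u \<bullet> x = 0} \<le> dim (range (\<lambda>X. al X u))" by simp
qed

lemma tangent_eq_0:
  assumes u: "u \<in> S" and "\<And>X. x \<bullet> al X u = 0" "x \<bullet> nn u = 0"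
  shows "x = 0"
proof -
  have "x \<in> range (\<lambda>X. al X u)"
    using assms(3) by (simp add: range_al[OF u] inner_commute)
  then obtain X where X: "x = al X u" by auto
  have "x \<bullet> x = 0" using assms(2)[of X] by (simp flip: X)
  then show ?thesis by simp
qed

lemma vec2_expand: "(X :: real^2) = X$1 *\<^sub>R axis 1 1 + X$2 *\<^sub>R axis 2 1"
  by (simp add: vec_eq_iff forall_2 axis_def)

lemma al_expand: "u \<in> S \<Longrightarrow> al X u = X$1 *\<^sub>R al (axis 1 1) u + X$2 *\<^sub>R al (axis 2 1) u"
  by (subst vec2_expand) (simp only: linear_add[OF linear_al] linear_scale[OF linear_al])

text \<open>The connection is metric: cross multiplication by a fixed vector is skew, so the
  connection terms cancel.\<close>

lemma dirderiv_inner_cov: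
  assumes "V differentiable (at u)" "W differentiable (at u)"
  shows "dirderiv (\<lambda>v. V v \<bullet> W v) u X = cov X V u \<bullet> W u + V u \<bullet> cov X W u"
  by (simp add: dirderiv_inner[OF assms] cov_def inner_add_left inner_add_right cross3_inner_swap)

lemma coframe_hessian_F:
  assumes u: "u \<in> S"
  shows "coframe (F u) (dirderiv (\<lambda>v. dirderiv F v Y) u X
      + christoffel g (F u) (dirderiv F u X) (dirderiv F u Y)) = cov X (al Y) u"
proof -
  have d: "dirderiv (al Y) u X = twist (al X u) (al Y u) + coframe (F u) (dirderiv (\<lambda>v. dirderiv F v Y) u X)"
    unfolding al_def[abs_def] using smooth_on_dirderiv[OF smooth_F]
    by (intro dirderiv_coframe smooth_on_differentiable[OF _ u] smooth_F)
  show ?thesis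
    unfolding cov_def d by (simp add: coframe_linear_simps coframe_christoffel al_def)
qed

text \<open>Torsion-freeness. Second derivatives of \<open>F\<close> commute, and the ambient
  Christoffel expression is symmetric for the given values of \<open>m\<close> and
  \<open>s\<close>.\<close>

lemma cov_al_commute:
  assumes u: "u \<in> S"
  shows "cov X (al Y) u = cov Y (al X) u"
proof -
  have "cross3 (conn a) b + twist a b = cross3 (conn b) a + twist b a" for a b
    by (rule vec3_eqI) (simp_all add: cross_components conn_nth twist_nth m_def s_def field_simps)
  then show ?thesis
    using dirderiv_commute[OF open_S u smooth_F, of X Y]
    by (simp add: coframe_hessian_F[OF u, symmetric] coframe_linear_simps coframe_christoffel)
qed

text \<open>The curvature of the frame connection. The second summand is the commutator of the two
  infinitesimal rotations; the first is what differentiating \<open>conn\<close> contributes once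
  torsion-freeness has expressed the difference of the derivatives of \<open>al\<close>.\<close>

lemma curv_identity:
  "cross3 (conn (cross3 (conn b) a - cross3 (conn a) b)) v
    + (cross3 (conn a) (cross3 (conn b) v) - cross3 (conn b) (cross3 (conn a) v)) = cross3 (curv (cross3 a b)) v"
  by (rule vec3_eqI) (simp_all add: cross_components conn_nth curv_def vector_3 power2_eq_square algebra_simps)

lemma cov_cov:
  assumes u: "u \<in> S" and V: "smooth_on S V"
  shows "cov X (cov Y V) u = dirderiv (\<lambda>v. dirderiv V v Y) u X + cross3 (conn (dirderiv (al Y) u X)) (V u)
    + cross3 (conn (al Y u)) (dirderiv V u X) + cross3 (conn (al X u)) (dirderiv V u Y)
    + cross3 (conn (al X u)) (cross3 (conn (al Y u)) (V u))"
proof -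
  have dV: "(\<lambda>v. dirderiv V v Y) differentiable (at u)" "V differentiable (at u)"
    "(\<lambda>v. conn (al Y v)) differentiable (at u)"
    "(\<lambda>v. cross3 (conn (al Y v)) (V v)) differentiable (at u)"
    by (intro smooth_on_differentiable[OF _ u] smooth_on_dirderiv V smooth_on_bilinear[OF _ bounded_bilinear_cross3]
      smooth_on_linear[OF _ linear_conn] open_S smooth_al)+
  have "dirderiv (cov Y V) u X = dirderiv (\<lambda>v. dirderiv V v Y) u X + (cross3 (conn (al Y u)) (dirderiv V u X)
      + cross3 (conn (dirderiv (al Y) u X)) (V u))"
    unfolding cov_def[abs_def]
    by (simp add: dirderiv_add[OF dV(1,4)] dirderiv_bilinear[OF bounded_bilinear_cross3 dV(3,2)]
        dirderiv_linear_compose[OF linear_conn differentiable_al[OF u]])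
  then show ?thesis
    by (simp add: cov_def[of X "cov Y V"] cov_def[of Y V] cross_add_right algebra_simps)
qed

lemma cov_commutator:
  assumes u: "u \<in> S" and V: "smooth_on S V"
  shows "cov X (cov Y V) u = cov Y (cov X V) u + cross3 (curv (cross3 (al X u) (al Y u))) (V u)"
proof -
  have t: "dirderiv (al Y) u X = dirderiv (al X) u Y + (cross3 (conn (al Y u)) (al X u) - cross3 (conn (al X u)) (al Y u))"
    using cov_al_commute[OF u, of X Y] by (simp add: cov_def algebra_simps)
  show ?thesis
    unfolding cov_cov[OF assms] curv_identity[symmetric] t dirderiv_commute[OF open_S u V, of Y X]
    by (simp add: conn_linear_simps cross_add_left Cross3.left_diff_distrib algebra_simps)
qed

section \<open>First and second fundamental forms\<close>

lemma gM_eq: "gM u X Y = al X u \<bullet> al Y u"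
  by (simp add: induced_metric_def g_eq al_def)

lemma pos_inner_gM:
  assumes u: "u \<in> S"
  shows "pos_inner (gM u)"
proof -
  have "al X u \<bullet> al X u > 0" if "X \<noteq> 0" for X
    using al_eq_0[OF u, of X] that by auto
  then show ?thesis
    by (auto simp: pos_inner_def gM_eq[abs_def] bilinear_def inner_commute linear_iff
        linear_add[OF linear_al[OF u]] linear_scale[OF linear_al[OF u]] inner_add_left inner_add_right)
qed

text \<open>The induced connection is the tangential part of the ambient one: \<open>cov\<close> is
  metric and torsion-free, so the six terms of the Koszul formula collapse to one product, taken
  twice.\<close>

lemma al_christoffel:
  assumes u: "u \<in> S"
  shows "al (christoffel gM u X Y) u \<bullet> al W u = cov X (al Y) u \<bullet> al W u"
proof -
  have d: "dirderiv (\<lambda>v. gM v Y W) u X = cov X (al Y) u \<bullet> al W u + al Y u \<bullet> cov X (al W) u" for X Y W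
    unfolding gM_eq by (rule dirderiv_inner_cov[OF differentiable_al[OF u] differentiable_al[OF u]])
  have "(\<lambda>v. gM v Y W) differentiable (at u)" for Y W
    unfolding gM_eq by (intro smooth_on_differentiable[OF _ u] smooth_on_bilinear[OF _ bounded_bilinear_inner] open_S smooth_al)
  from koszul[of S u gM, OF open_S u pos_inner_gM this, of X Y W]
  have "2 * (al (christoffel gM u X Y) u \<bullet> al W u) = 2 * (cov X (al Y) u \<bullet> al W u)"
    unfolding gM_eq[symmetric] d
    using cov_al_commute[OF u, of X W] cov_al_commute[OF u, of Y W] cov_al_commute[OF u, of Y X]
    by (simp add: inner_commute gM_eq)
  then show ?thesis by simp
qed

lemma gram_gM: "gram gM u $ i $ j = al (axis i 1) u \<bullet> al (axis j 1) u"
  by (simp add: gram_def gM_eq)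

definition det_gM :: "real^2 \<Rightarrow> real" where
  "det_gM u = (al (axis 1 1) u \<bullet> al (axis 1 1) u) * (al (axis 2 1) u \<bullet> al (axis 2 1) u)
    - (al (axis 1 1) u \<bullet> al (axis 2 1) u) * (al (axis 1 1) u \<bullet> al (axis 2 1) u)"

lemma det_gM_pos: "u \<in> S \<Longrightarrow> det_gM u > 0"
proof -
  assume u: "u \<in> S"
  have "a = 0 \<and> b = 0" if "a *\<^sub>R al (axis 1 1) u + b *\<^sub>R al (axis 2 1) u = 0" for a b
  proof -
    have "al (vector [a, b]) u = 0" using that by (simp add: al_expand[OF u, of "vector [a, b]"] vector_2)
    then have "vector [a, b] = (0 :: real^2)" by (rule al_eq_0[OF u])
    then show ?thesis by (metis vector_2 zero_index)
  qed
  from gram_det_pos[OF pos_inner_inner this] show ?thesis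
    by (simp add: det_gM_def inner_commute)
qed

abbreviation trM :: "real^2 \<Rightarrow> (real^2 \<Rightarrow> real^2 \<Rightarrow> 'b::real_vector) \<Rightarrow> 'b" where
  "trM u B \<equiv> gram_trace (gram gM u) (\<lambda>i j. B (axis i 1) (axis j 1))"

lemma trM_eq:
  assumes u: "u \<in> S"
  shows "trM u B = (1 / det_gM u) *\<^sub>R
    ((al (axis 2 1) u \<bullet> al (axis 2 1) u) *\<^sub>R B (axis 1 1) (axis 1 1)
     - (al (axis 1 1) u \<bullet> al (axis 2 1) u) *\<^sub>R B (axis 1 1) (axis 2 1)
     - (al (axis 1 1) u \<bullet> al (axis 2 1) u) *\<^sub>R B (axis 2 1) (axis 1 1)
     + (al (axis 1 1) u \<bullet> al (axis 1 1) u) *\<^sub>R B (axis 2 1) (axis 2 1))"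
  using det_gM_pos[OF u] by (subst gram_trace_2) (simp_all add: gram_gM det_gM_def inner_commute)

lemma cov_nn_nn: "u \<in> S \<Longrightarrow> cov X nn u \<bullet> nn u = 0"
proof -
  assume u: "u \<in> S"
  have "dirderiv (\<lambda>v. nn v \<bullet> nn v) u X = dirderiv (\<lambda>v. 1) u X"
    by (rule dirderiv_cong_open[OF open_S u, THEN fun_cong]) (rule nn_unit)
  then show "cov X nn u \<bullet> nn u = 0"
    by (simp add: dirderiv_inner_cov[OF differentiable_nn[OF u] differentiable_nn[OF u]] inner_commute)
qed

lemma cov_nn_al: "u \<in> S \<Longrightarrow> cov X nn u \<bullet> al Y u = - (cov X (al Y) u \<bullet> nn u)"
proof -
  assume u: "u \<in> S"
  have "dirderiv (\<lambda>v. al Y v \<bullet> nn v) u X = dirderiv (\<lambda>v. 0) u X"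
    by (rule dirderiv_cong_open[OF open_S u, THEN fun_cong]) (rule al_nn)
  then show ?thesis
    by (simp add: dirderiv_inner_cov[OF differentiable_al[OF u] differentiable_nn[OF u]] inner_commute)
qed

lemma shape_sym: "u \<in> S \<Longrightarrow> cov X nn u \<bullet> al Y u = cov Y nn u \<bullet> al X u"
  by (simp add: cov_nn_al cov_al_commute)

text \<open>Weingarten's equation; the Christoffel term of the induced metric is tangential and
  disappears against the normal.\<close>

lemma second_fundamental_form_eq:
  assumes u: "u \<in> S"
  shows "second_fundamental_form g F n u X Y = - (cov X nn u \<bullet> al Y u)"
  unfolding second_fundamental_form_def cov_hessian_def g_eq[of _ _ "n u"]
  using coframe_hessian_F[OF u, of Y X] al_nn[OF u]
  by (simp add: linear_diff[OF linear_coframe] inner_diff_left cov_nn_al[OF u] flip: nn_def al_def)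

lemma mean_curvature_eq: "u \<in> S \<Longrightarrow> mean_curvature g F n u = - trM u (\<lambda>X Y. cov X nn u \<bullet> al Y u)"
  unfolding mean_curvature_def by (simp add: second_fundamental_form_eq gram_trace_def sum_negf)

lemma cov_nn_expand:
  assumes u: "u \<in> S"
  obtains Z where "cov X nn u = al Z u"
proof -
  have "cov X nn u \<in> range (\<lambda>Z. al Z u)"
    using cov_nn_nn[OF u, of X] by (simp add: range_al[OF u] inner_commute)
  then show ?thesis using that by auto
qed

text \<open>The derivative of the constant mean curvature in direction \<open>X\<close>, that is,
  the trace of the covariant derivative of the shape operator. Curvature enters only in
  \<open>ricci_of_laplacian\<close>, where covariant derivatives are interchanged.\<close>

lemma codazzi_cmc:
  assumes H: "\<And>v. v \<in> S \<Longrightarrow> mean_curvature g F n v = H" and u: "u \<in> S"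
  shows "trM u (\<lambda>A B. cov X (cov A nn) u \<bullet> al B u - cov B nn u \<bullet> cov X (al A) u) = 0"
proof -
  let ?e1 = "axis 1 1 :: real^2" and ?e2 = "axis 2 1 :: real^2"
  define a1 a2 where "a1 = al ?e1" and "a2 = al ?e2"
  define Y1 Y2 where "Y1 = cov ?e1 nn" and "Y2 = cov ?e2 nn"
  note defs = a1_def a2_def Y1_def Y2_def
  have sm: "smooth_on S a1" "smooth_on S a2" "smooth_on S Y1" "smooth_on S Y2"
    unfolding defs by (intro smooth_al smooth_cov smooth_nn)+
  \<comment> \<open>Multiplying by the Gram determinant avoids differentiating a quotient:
    \<open>P\<close> is minus \<open>H\<close> times the determinant, \<open>Q\<close> the numerator
    of the trace.\<close>
  define P where "P v = - H * ((a1 v \<bullet> a1 v) * (a2 v \<bullet> a2 v) - (a1 v \<bullet> a2 v) * (a1 v \<bullet> a2 v))" for v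
  define Q where "Q v = (a2 v \<bullet> a2 v) * (Y1 v \<bullet> a1 v) - (a1 v \<bullet> a2 v) * (Y1 v \<bullet> a2 v)
      - (a1 v \<bullet> a2 v) * (Y2 v \<bullet> a1 v) + (a1 v \<bullet> a1 v) * (Y2 v \<bullet> a2 v)" for v
  have PQ: "P v = Q v" if v: "v \<in> S" for v
    using H[OF v] det_gM_pos[OF v] unfolding mean_curvature_eq[OF v] trM_eq[OF v, of "\<lambda>X Y. cov X nn v \<bullet> al Y v"] P_def Q_def defs
    by (simp add: det_gM_def[symmetric] field_simps)
  have dPQ: "dirderiv P u X = dirderiv Q u X"
    by (rule dirderiv_cong_open[OF open_S u, THEN fun_cong]) (rule PQ)
  note df = sm[THEN smooth_on_differentiable, OF u]
  have hd: "((\<lambda>v. V v \<bullet> W v) has_derivative (\<lambda>X. cov X V u \<bullet> W u + V u \<bullet> cov X W u)) (at u)"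
    if "V differentiable (at u)" "W differentiable (at u)" for V W
  proof -
    have "(\<lambda>v. V v \<bullet> W v) differentiable (at u)"
      using has_derivative_inner[OF that[THEN has_derivative_dirderiv]] unfolding differentiable_def by blast
    from has_derivative_dirderiv[OF this] show ?thesis
      unfolding dirderiv_inner_cov[OF that, abs_def] .
  qed
  have dP: "dirderiv P u X = - H * (2 * (cov X a1 u \<bullet> a1 u) * (a2 u \<bullet> a2 u) + (a1 u \<bullet> a1 u) * (2 * (cov X a2 u \<bullet> a2 u))
      - 2 * (a1 u \<bullet> a2 u) * (cov X a1 u \<bullet> a2 u + a1 u \<bullet> cov X a2 u))"
    unfolding P_def[abs_def]
    by (subst dirderiv_eq, (rule has_derivative_diff has_derivative_mult hd df has_derivative_const)+)
      (simp add: inner_commute algebra_simps)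
  have dQ: "dirderiv Q u X = 2 * (cov X a2 u \<bullet> a2 u) * (Y1 u \<bullet> a1 u) + (a2 u \<bullet> a2 u) * (cov X Y1 u \<bullet> a1 u + Y1 u \<bullet> cov X a1 u)
        - (cov X a1 u \<bullet> a2 u + a1 u \<bullet> cov X a2 u) * (Y1 u \<bullet> a2 u) - (a1 u \<bullet> a2 u) * (cov X Y1 u \<bullet> a2 u + Y1 u \<bullet> cov X a2 u)
        - (cov X a1 u \<bullet> a2 u + a1 u \<bullet> cov X a2 u) * (Y2 u \<bullet> a1 u) - (a1 u \<bullet> a2 u) * (cov X Y2 u \<bullet> a1 u + Y2 u \<bullet> cov X a1 u)
        + 2 * (cov X a1 u \<bullet> a1 u) * (Y2 u \<bullet> a2 u) + (a1 u \<bullet> a1 u) * (cov X Y2 u \<bullet> a2 u + Y2 u \<bullet> cov X a2 u)"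
    unfolding Q_def[abs_def]
    by (subst dirderiv_eq, (rule has_derivative_add has_derivative_diff has_derivative_mult hd df)+)
      (simp add: inner_commute algebra_simps)
  obtain Z1 Z2 where Z: "Y1 u = al Z1 u" "Y2 u = al Z2 u"
    unfolding defs using cov_nn_expand[OF u] by metis
  have e1: "Y1 u = Z1$1 *\<^sub>R a1 u + Z1$2 *\<^sub>R a2 u" and e2: "Y2 u = Z2$1 *\<^sub>R a1 u + Z2$2 *\<^sub>R a2 u"
    unfolding Z a1_def a2_def by (rule al_expand[OF u])+
  have "(a2 u \<bullet> a2 u) * (cov X Y1 u \<bullet> a1 u - Y1 u \<bullet> cov X a1 u) - (a1 u \<bullet> a2 u) * (cov X Y1 u \<bullet> a2 u - Y2 u \<bullet> cov X a1 u)
      - (a1 u \<bullet> a2 u) * (cov X Y2 u \<bullet> a1 u - Y1 u \<bullet> cov X a2 u) + (a1 u \<bullet> a1 u) * (cov X Y2 u \<bullet> a2 u - Y2 u \<bullet> cov X a2 u) = 0"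
  proof (rule shape_trace_derivative[OF e1 e2, of "- H"])
    show "Y1 u \<bullet> a2 u = Y2 u \<bullet> a1 u" unfolding defs by (rule shape_sym[OF u])
    show "(a1 u \<bullet> a1 u) * (a2 u \<bullet> a2 u) - (a1 u \<bullet> a2 u) * (a1 u \<bullet> a2 u) \<noteq> 0"
      using det_gM_pos[OF u] unfolding defs det_gM_def by simp
    show "- H * ((a1 u \<bullet> a1 u) * (a2 u \<bullet> a2 u) - (a1 u \<bullet> a2 u) * (a1 u \<bullet> a2 u)) =
      (a2 u \<bullet> a2 u) * (Y1 u \<bullet> a1 u) - (a1 u \<bullet> a2 u) * (Y1 u \<bullet> a2 u) - (a1 u \<bullet> a2 u) * (Y2 u \<bullet> a1 u) + (a1 u \<bullet> a1 u) * (Y2 u \<bullet> a2 u)"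
      using PQ[OF u] by (simp only: P_def Q_def)
  qed (rule dPQ[unfolded dP dQ])
  then show ?thesis
    unfolding trM_eq[OF u, of "\<lambda>A B. cov X (cov A nn) u \<bullet> al B u - cov B nn u \<bullet> cov X (al A) u"] defs by simp
qed

text \<open>The tangential part of the rough Laplacian of the unit normal is the Ricci curvature in
  normal direction minus the gradient of the mean curvature.\<close>

lemma ricci_of_laplacian:
  assumes H: "\<And>v. v \<in> S \<Longrightarrow> mean_curvature g F n v = H" and u: "u \<in> S"
    and lap: "\<And>X. trM u (\<lambda>A B. cov A (cov B nn) u \<bullet> al X u - cov X nn u \<bullet> cov A (al B) u) = 0"
  shows "cross3 (curv (cross3 (al (axis 1 1) u) (al (axis 2 1) u))) (nn u) = 0"
proof -
  let ?e1 = "axis 1 1 :: real^2" and ?e2 = "axis 2 1 :: real^2"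
  \<comment> \<open>Codazzi: differentiate the symmetry of the shape operator, then interchange the
    derivatives along \<open>A\<close> and \<open>X\<close>, which costs a curvature term.\<close>
  have 1: "cov A (cov B nn) u \<bullet> al X u - cov X nn u \<bullet> cov A (al B) u
      = (cov X (cov A nn) u \<bullet> al B u - cov B nn u \<bullet> cov X (al A) u)
        + cross3 (curv (cross3 (al A u) (al X u))) (nn u) \<bullet> al B u" for A B X
  proof -
    have "dirderiv (\<lambda>v. cov B nn v \<bullet> al X v) u A = dirderiv (\<lambda>v. cov X nn v \<bullet> al B v) u A"
      by (rule dirderiv_cong_open[OF open_S u, THEN fun_cong]) (rule shape_sym)
    then have "cov A (cov B nn) u \<bullet> al X u + cov B nn u \<bullet> cov A (al X) u
        = cov A (cov X nn) u \<bullet> al B u + cov X nn u \<bullet> cov A (al B) u"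
      using smooth_on_differentiable[OF smooth_cov[OF smooth_nn] u] differentiable_al[OF u]
      by (simp add: dirderiv_inner_cov)
    then show ?thesis
      by (simp add: cov_commutator[OF u smooth_nn, of A X] cov_al_commute[OF u, of A X] inner_add_left)
  qed
  \<comment> \<open>The trace of the left side of \<open>1\<close> vanishes by \<open>lap\<close>
    and that of its first summand by constancy of \<open>H\<close>, so the curvature term is
    traceless.\<close>
  have 2: "trM u (\<lambda>A B. cross3 (curv (cross3 (al A u) (al X u))) (nn u) \<bullet> al B u) = 0" for X
  proof -
    have "trM u (\<lambda>A B. cov A (cov B nn) u \<bullet> al X u - cov X nn u \<bullet> cov A (al B) u)
        = trM u (\<lambda>A B. (cov X (cov A nn) u \<bullet> al B u - cov B nn u \<bullet> cov X (al A) u)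
          + cross3 (curv (cross3 (al A u) (al X u))) (nn u) \<bullet> al B u)"
      by (rule arg_cong[where f="gram_trace _"]) (intro ext 1)
    also have "\<dots> = trM u (\<lambda>A B. cov X (cov A nn) u \<bullet> al B u - cov B nn u \<bullet> cov X (al A) u)
        + trM u (\<lambda>A B. cross3 (curv (cross3 (al A u) (al X u))) (nn u) \<bullet> al B u)"
      by (simp only: gram_trace_def scaleR_add_right sum.distrib)
    finally show ?thesis using lap[of X] codazzi_cmc[OF H u, of X] by simp
  qed
  define x where "x = cross3 (curv (cross3 (al ?e1 u) (al ?e2 u))) (nn u)"
  have sk: "cross3 (curv (cross3 (al ?e2 u) (al ?e1 u))) (nn u) = - x"
    unfolding x_def by (rule vec3_eqI) (simp_all add: cross_components curv_def vector_3 algebra_simps)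
  have c0: "curv 0 = 0" by (rule vec3_eqI) (simp_all add: curv_def vector_3)
  define g11 g12 g22 where "g11 = al ?e1 u \<bullet> al ?e1 u" and "g12 = al ?e1 u \<bullet> al ?e2 u" and "g22 = al ?e2 u \<bullet> al ?e2 u"
  have d: "g11 * g22 - g12 * g12 \<noteq> 0" using det_gM_pos[OF u] by (simp add: det_gM_def g11_def g12_def g22_def)
  \<comment> \<open>In the trace the index \<open>A\<close> equal to \<open>X\<close> contributes
    nothing, and the other one contributes \<open>x\<close> or \<open>- x\<close>. This leaves two
    linear equations whose determinant is the Gram determinant.\<close>
  have "g22 * (x \<bullet> al ?e1 u) - g12 * (x \<bullet> al ?e2 u) = 0" "g11 * (x \<bullet> al ?e2 u) - g12 * (x \<bullet> al ?e1 u) = 0"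
    using 2[of ?e2] 2[of ?e1] det_gM_pos[OF u]
    by (simp_all add: trM_eq[OF u, of "\<lambda>A B. cross3 (curv (cross3 (al A u) (al _ u))) (nn u) \<bullet> al B u"] c0 sk flip: x_def g11_def g12_def g22_def)
  then have "(g11 * g22 - g12 * g12) * (x \<bullet> al ?e1 u) = 0" "(g11 * g22 - g12 * g12) * (x \<bullet> al ?e2 u) = 0"
    by algebra+
  then have "x \<bullet> al ?e1 u = 0" "x \<bullet> al ?e2 u = 0" using d by simp_all
  then have "x \<bullet> al X u = 0" for X by (simp add: al_expand[OF u, of X] inner_add_right)
  moreover have "x \<bullet> nn u = 0" by (simp add: x_def dot_cross_self)
  ultimately show ?thesis using tangent_eq_0[OF u] by (simp add: x_def)
qed

end

section \<open>The tension field of the Gauss map\<close>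

context surface
begin

lemma range_dF: "u \<in> S \<Longrightarrow> range (dirderiv F u) = {X. coframe (F u) X \<bullet> nn u = 0}"
proof -
  assume u: "u \<in> S"
  have "X \<in> range (dirderiv F u)" if "coframe (F u) X \<bullet> nn u = 0" for X
  proof -
    have "coframe (F u) X \<in> range (\<lambda>X. al X u)"
      using that by (simp add: range_al[OF u] inner_commute)
    then show ?thesis by (auto simp: al_def coframe_inject)
  qed
  then show ?thesis using al_nn[OF u] by (auto simp: al_def)
qed

lemma gauss_map_domain: "u \<in> S \<Longrightarrow> gauss_map F u \<in> gr_chart_domain E k \<longleftrightarrow> nn u $ k \<noteq> 0"
proof -
  assume u: "u \<in> S"
  note lin = linear_dirderiv[OF differentiable_F[OF u]]
  have "subspace (range (dirderiv F u))"
    using linear_subspace_image[OF lin, of UNIV] by simp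
  moreover have "dim (range (dirderiv F u)) = 2"
    using dim_image_eq[OF lin, of UNIV] immersion[OF u] by (simp add: inj_on_subset)
  moreover have "E k (F u) \<notin> range (dirderiv F u) \<longleftrightarrow> nn u $ k \<noteq> 0"
    by (simp add: range_dF[OF u] inner_index[of _ _ k])
  ultimately show ?thesis by (simp add: gauss_map_def gr_chart_domain_def gr_bundle_def)
qed

definition wk :: "3 \<Rightarrow> real^2 \<Rightarrow> real^2" where
  "wk k u = vector [- (nn u $ (k+1) / nn u $ k), - (nn u $ (k+2) / nn u $ k)]"

lemma nu_wk: "nn u $ k \<noteq> 0 \<Longrightarrow> nu k (wk k u) = (1 / nn u $ k) *\<^sub>R nn u"
  by (intro vec_index_eqI[of _ k]) (simp_all add: wk_def vector_2)

lemma gr_chart_gauss_map: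
  assumes u: "u \<in> S" and k: "nn u $ k \<noteq> 0"
  shows "gr_chart E k (gauss_map F u) = (F u, wk k u)"
proof -
  have "(THE w. gr_plane E k (F u, w) = range (dirderiv F u)) = wk k u"
  proof (rule the_equality)
    show *: "gr_plane E k (F u, wk k u) = range (dirderiv F u)"
      using k by (simp add: gr_plane_eq range_dF[OF u] nu_wk)
    fix w assume w: "gr_plane E k (F u, w) = range (dirderiv F u)"
    have "w $ i = wk k u $ i" for i
    proof -
      have "lift (F u) (gbas k w i) \<in> gr_plane E k (F u, w)"
        by (simp add: gr_plane_eq gbas_nu)
      then have "lift (F u) (gbas k w i) \<in> gr_plane E k (F u, wk k u)"
        by (simp only: w *)
      then have "gbas k w i \<bullet> nu k (wk k u) = 0"
        by (simp add: gr_plane_eq)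
      then show ?thesis
        using exhaust_2[of i] by (auto simp: inner_index[of _ _ k])
    qed
    then show "w = wk k u" by (simp add: vec_eq_iff)
  qed
  then show ?thesis by (simp add: gr_chart_def gauss_map_def)
qed

text \<open>The cross product is orthogonal to the surface, and its squared length is the Gram
  determinant.\<close>

lemma cross_al:
  assumes u: "u \<in> S"
  obtains c where "c \<noteq> 0" "cross3 (al (axis 1 1) u) (al (axis 2 1) u) = c *\<^sub>R nn u"
proof -
  define x where "x = cross3 (al (axis 1 1) u) (al (axis 2 1) u)"
  define c where "c = x \<bullet> nn u"
  have "x \<bullet> al X u = 0" for X
    by (simp add: x_def al_expand[OF u, of X] inner_add_right dot_cross_self)
  then have "x - c *\<^sub>R nn u = 0"
    using al_nn[OF u] nn_unit[OF u]
    by (intro tangent_eq_0[OF u]) (simp_all add: c_def inner_diff_left inner_diff_right inner_commute)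
  then have x: "x = c *\<^sub>R nn u" by simp
  have "x \<bullet> x = det_gM u"
    by (simp add: x_def dot_cross det_gM_def inner_commute)
  then have "c \<noteq> 0" using det_gM_pos[OF u] x by auto
  then show ?thesis using x that by (simp add: x_def)
qed

text \<open>The components of curv(n) x n are the products of two components of n times differences
  of eigenvalues, which are nonzero since 0 < m < s. The normal is therefore plus or minus a single
  frame vector.\<close>

lemma ricci_eigenvector:
  assumes u: "u \<in> S" and 0: "cross3 (curv (cross3 (al (axis 1 1) u) (al (axis 2 1) u))) (nn u) = 0"
  shows "nn u $ 1 * nn u $ 2 = 0" "nn u $ 1 * nn u $ 3 = 0" "nn u $ 2 * nn u $ 3 = 0"
proof -
  obtain c where c: "c \<noteq> 0" "cross3 (al (axis 1 1) u) (al (axis 2 1) u) = c *\<^sub>R nn u"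
    using cross_al[OF u] .
  let ?y = "cross3 (curv (c *\<^sub>R nn u)) (nn u)"
  have y: "?y $ 3 = c * (2 * m * (m - s)) * (nn u $ 1 * nn u $ 2)"
    "?y $ 2 = c * (4 * m * s) * (nn u $ 1 * nn u $ 3)" "?y $ 1 = - (c * (2 * m * (m + s)) * (nn u $ 2 * nn u $ 3))"
    by (simp_all add: cross_components curv_def vector_3 power2_eq_square algebra_simps)
  have nz: "m \<noteq> 0" "s \<noteq> 0" "m - s \<noteq> 0" "m + s \<noteq> 0"
    using m_pos m_less_s by auto
  have "?y = 0" using 0 c by simp
  then have "?y $ i = 0" for i by simp
  from this[of 3] this[of 2] this[of 1]
  show "nn u $ 1 * nn u $ 2 = 0" "nn u $ 1 * nn u $ 3 = 0" "nn u $ 2 * nn u $ 3 = 0"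
    unfolding y using c nz by auto
qed

end

text \<open>Graph coordinates determine a unit normal whose \<open>k\<close>-th component is
  positive, while the normal of the surface may have either sign. On the open set \<open>Sk\<close>,
  where \<sigma> is the sign of that component, the two differ by the constant factor
  \<sigma>.\<close>

locale surface_chart = surface +
  fixes \<kappa> \<sigma> :: real and k :: 3
  assumes \<kappa>: "\<kappa> > 0" and \<sigma>: "\<sigma> = 1 \<or> \<sigma> = - 1"
begin

definition Sk :: "(real^2) set" where "Sk = {u \<in> S. \<sigma> * nn u $ k > 0}"

definition \<psi> :: "real^2 \<Rightarrow> (real^3) \<times> (real^2)" where "\<psi> = gr_chart E k \<circ> gauss_map F"

abbreviation G :: "((real^3) \<times> (real^2)) metric_field" where "G \<equiv> gr_metric g \<kappa> E k"

lemma open_Sk: "open Sk"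
proof -
  have "continuous_on S (\<lambda>u. \<sigma> * nn u $ k)"
    using smooth_on_continuous[OF smooth_nn] by (intro continuous_intros)
  from continuous_open_preimage[OF this open_S, of "{0<..}"]
  show ?thesis by (simp add: Sk_def vimage_def Int_def)
qed

lemma Sk_D: "u \<in> Sk \<Longrightarrow> u \<in> S" "u \<in> Sk \<Longrightarrow> nn u $ k \<noteq> 0"
  by (auto simp: Sk_def)

lemma Sk_subset: "Sk \<subseteq> S" by (auto simp: Sk_def)

lemma \<psi>_eq: "u \<in> Sk \<Longrightarrow> \<psi> u = (F u, wk k u)"
  by (simp add: \<psi>_def gr_chart_gauss_map Sk_D)

lemma smooth_\<psi>: "smooth_on Sk \<psi>"
proof (rule smooth_on_cong[OF open_Sk])
  have sm: "smooth_on Sk (\<lambda>u. nn u $ i)" for i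
    by (rule smooth_on_nth[OF open_Sk smooth_on_subset[OF smooth_nn Sk_subset]])
  have "smooth_on Sk (\<lambda>u. - (nn u $ j / nn u $ k))" for j
    by (intro smooth_on_uminus smooth_on_divide open_Sk sm Sk_D)
  then have "smooth_on Sk (\<lambda>u. if i = 1 then - (nn u $ (k+1) / nn u $ k) else - (nn u $ (k+2) / nn u $ k))" for i :: 2
    by (cases "i = 1") simp_all
  then have "smooth_on Sk (\<lambda>u. (\<chi> i. if i = 1 then - (nn u $ (k+1) / nn u $ k) else - (nn u $ (k+2) / nn u $ k)) :: real^2)"
    by (rule smooth_on_vec_lambda[OF open_Sk,
        of "\<lambda>i u. if i = 1 then - (nn u $ (k+1) / nn u $ k) else - (nn u $ (k+2) / nn u $ k)"])
  moreover have "wk k u = (\<chi> i. if i = 1 then - (nn u $ (k+1) / nn u $ k) else - (nn u $ (k+2) / nn u $ k))" for u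
    by (simp add: wk_def vec_eq_iff forall_2 vector_2)
  ultimately show "smooth_on Sk (\<lambda>u. (F u, wk k u))"
    by (intro smooth_on_Pair open_Sk smooth_on_subset[OF smooth_F Sk_subset]) simp
qed (simp add: \<psi>_eq)

lemma unu_\<psi>: "u \<in> Sk \<Longrightarrow> unu k (snd (\<psi> u)) = \<sigma> *\<^sub>R nn u"
proof -
  assume u: "u \<in> Sk"
  have "norm (nn u) = 1" using nn_unit[OF Sk_D(1)[OF u]] by (simp add: norm_eq_sqrt_inner)
  then have "unu k (snd (\<psi> u)) = (\<bar>nn u $ k\<bar> / nn u $ k) *\<^sub>R nn u"
    using Sk_D[OF u] by (simp add: \<psi>_eq[OF u] unu_def rad_def nu_wk)
  also have "\<bar>nn u $ k\<bar> / nn u $ k = \<sigma>"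
    using u \<sigma> by (auto simp: Sk_def abs_if field_simps split: if_splits)
  finally show ?thesis .
qed

lemma fst_d\<psi>: "u \<in> Sk \<Longrightarrow> fst (dirderiv \<psi> u X) = dirderiv F u X"
proof -
  assume u: "u \<in> Sk"
  have "dirderiv (\<lambda>v. fst (\<psi> v)) u X = fst (dirderiv \<psi> u X)"
    by (rule dirderiv_linear_compose[OF linear_fst smooth_on_differentiable[OF smooth_\<psi> u]])
  moreover have "dirderiv (\<lambda>v. fst (\<psi> v)) u X = dirderiv F u X"
    by (rule dirderiv_cong_open[OF open_Sk u, THEN fun_cong]) (simp add: \<psi>_eq)
  ultimately show ?thesis by simp
qed

lemma al_d\<psi>: "u \<in> Sk \<Longrightarrow> coframe (fst (\<psi> u)) (fst (dirderiv \<psi> u X)) = al X u"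
  by (simp add: fst_d\<psi> \<psi>_eq al_def)

text \<open>The vertical part of the differential of the Gauss map is, up to sign, the covariant
  derivative of the normal: \<open>vert\<close> is the covariant derivative of \<open>unu\<close>,
  which equals \<sigma> times \<open>nn\<close> along \<psi>.\<close>

lemma vert_d\<psi>: "u \<in> Sk \<Longrightarrow> vert k (\<psi> u) (dirderiv \<psi> u X) = \<sigma> *\<^sub>R cov X nn u"
proof -
  assume u: "u \<in> Sk"
  note d = smooth_on_differentiable[OF smooth_\<psi> u]
  have "((\<lambda>v. unu k (snd (\<psi> v))) has_derivative (\<lambda>X. dunu k (snd (\<psi> u)) (snd (dirderiv \<psi> u X)))) (at u)"
    by (rule has_derivative_compose[OF has_derivative_snd[OF has_derivative_dirderiv[OF d]] has_derivative_unu])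
  then have "dunu k (snd (\<psi> u)) (snd (dirderiv \<psi> u X)) = dirderiv (\<lambda>v. unu k (snd (\<psi> v))) u X"
    by (simp add: dirderiv_eq)
  also have "\<dots> = dirderiv (\<lambda>v. \<sigma> *\<^sub>R nn v) u X"
    by (rule dirderiv_cong_open[OF open_Sk u, THEN fun_cong]) (rule unu_\<psi>)
  also have "\<dots> = \<sigma> *\<^sub>R dirderiv nn u X"
    by (rule dirderiv_linear_compose[OF linear_scaleR differentiable_nn[OF Sk_D(1)[OF u]]])
  finally show ?thesis
    by (simp add: vert_def cov_def al_d\<psi>[OF u] unu_\<psi>[OF u] cross_mult_right scaleR_add_right)
qed

lemma linear_dvert: "linear (dvert k P \<zeta>)"
  unfolding dvert_def d2unu_def
  by (rule linearI) (simp_all add: linear_add[OF linear_lnu] linear_scale[OF linear_lnu] coframe_linear_simps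
      conn_linear_simps cross_add_left cross_mult_left bilinear_radd[OF bilinear_twist] bilinear_rmul[OF bilinear_twist]
      inner_add_right algebra_simps)

text \<open>The derivative of \<open>vert\<close> is known for a fixed vector argument; linearity
  and a basis expansion of \<xi> allow the argument to vary.\<close>

lemma dirderiv_vert:
  fixes P \<xi> :: "real^2 \<Rightarrow> (real^3) \<times> (real^2)"
  assumes P: "P differentiable (at u)" and \<xi>: "\<xi> differentiable (at u)"
  shows "dirderiv (\<lambda>v. vert k (P v) (\<xi> v)) u X = dvert k (P u) (dirderiv P u X) (\<xi> u) + vert k (P u) (dirderiv \<xi> u X)"
proof -
  have ex: "L x = (\<Sum>b\<in>Basis. (x \<bullet> b) *\<^sub>R L b)" if "linear L" for L :: "(real^3) \<times> (real^2) \<Rightarrow> real^3" and x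
    by (subst euclidean_representation[of x, symmetric]) (simp only: linear_sum[OF that] linear_scale[OF that])
  have "((\<lambda>v. \<Sum>b\<in>Basis. (\<xi> v \<bullet> b) *\<^sub>R vert k (P v) b) has_derivative
      (\<lambda>X. \<Sum>b\<in>Basis. (\<xi> u \<bullet> b) *\<^sub>R dvert k (P u) (dirderiv P u X) b + (dirderiv \<xi> u X \<bullet> b) *\<^sub>R vert k (P u) b)) (at u)"
    by (intro has_derivative_sum has_derivative_scaleR has_derivative_inner_left
        has_derivative_compose[OF has_derivative_dirderiv[OF P] has_derivative_vert] has_derivative_dirderiv[OF \<xi>])
  note d = dirderiv_eq[OF this]
  have "(\<lambda>v. vert k (P v) (\<xi> v)) = (\<lambda>v. \<Sum>b\<in>Basis. (\<xi> v \<bullet> b) *\<^sub>R vert k (P v) b)"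
    by (intro ext ex linear_vert)
  then have "dirderiv (\<lambda>v. vert k (P v) (\<xi> v)) u X =
      (\<Sum>b\<in>Basis. (\<xi> u \<bullet> b) *\<^sub>R dvert k (P u) (dirderiv P u X) b + (dirderiv \<xi> u X \<bullet> b) *\<^sub>R vert k (P u) b)"
    by (simp only: d)
  also have "\<dots> = dvert k (P u) (dirderiv P u X) (\<xi> u) + vert k (P u) (dirderiv \<xi> u X)"
    unfolding sum.distrib by (simp only: ex[OF linear_vert, symmetric] ex[OF linear_dvert, symmetric])
  finally show ?thesis .
qed

lemma bilinear_G: "bilinear (G P)"
  using pos_inner_gr_metric[OF \<kappa>] by (simp add: pos_inner_def)

lemma gauss_tension_pairing:
  "G (\<psi> u) (gauss_tension g \<kappa> E k F u) W = trM u (\<lambda>X Y. G (\<psi> u) (cov_hessian gM G \<psi> u X Y) W)"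
  unfolding gauss_tension_def tension_def \<psi>_def[symmetric]
  using bilinear_G[of "\<psi> u"] unfolding bilinear_def by (intro gram_trace_linear[where L="\<lambda>x. G (\<psi> u) x W"]) blast

text \<open>Pairing with a constant vector turns the Christoffel symbols of the bundle metric into Koszul
  terms, so they need not be computed.\<close>

lemma hessian_pairing:
  "G (\<psi> u) (cov_hessian gM G \<psi> u X Y) W = G (\<psi> u) (dirderiv (\<lambda>v. dirderiv \<psi> v Y) u X) W
    + (dirderiv (\<lambda>Q. G Q (dirderiv \<psi> u Y) W) (\<psi> u) (dirderiv \<psi> u X)
      + dirderiv (\<lambda>Q. G Q (dirderiv \<psi> u X) W) (\<psi> u) (dirderiv \<psi> u Y)
      - dirderiv (\<lambda>Q. G Q (dirderiv \<psi> u X) (dirderiv \<psi> u Y)) (\<psi> u) W) / 2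
    - G (\<psi> u) (dirderiv \<psi> u (christoffel gM u X Y)) W"
  using koszul_gr_metric[OF \<kappa>, of k "\<psi> u" "dirderiv \<psi> u X" "dirderiv \<psi> u Y" W]
  by (simp add: cov_hessian_def bilinear_ladd[OF bilinear_G] bilinear_lsub[OF bilinear_G])

text \<open>Against a vertical vector the horizontal part of the bundle metric contributes nothing.
  The \<open>d2unu\<close> terms cancel by symmetry, and the cross products that remain complete
  ordinary derivatives to \<open>cov\<close>. Both orders of differentiation occur because the
  Koszul terms are symmetric in \<open>X\<close> and \<open>Y\<close>.\<close>

lemma vertical_hessian_pairing:
  assumes u: "u \<in> Sk"
  shows "G (\<psi> u) (cov_hessian gM G \<psi> u X Y) (0, \<eta>) = \<kappa> * \<sigma> *
    (((cov X (cov Y nn) u + cov Y (cov X nn) u) /\<^sub>R 2 - cov (christoffel gM u X Y) nn u) \<bullet> dunu k (snd (\<psi> u)) \<eta>)"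
proof -
  let ?w = "snd (\<psi> u)" and ?z = "dunu k (snd (\<psi> u)) \<eta>" and ?d = "dirderiv \<psi> u"
  note S = Sk_D(1)[OF u] and d\<psi> = smooth_on_differentiable[OF smooth_\<psi> u]
    and d2\<psi> = smooth_on_differentiable[OF smooth_on_dirderiv[OF smooth_\<psi>] u]
  have c0: "conn 0 = 0" "twist 0 a = 0" "twist a 0 = 0" for a
    using linear_0[OF linear_conn] bilinear_lzero[OF bilinear_twist] bilinear_rzero[OF bilinear_twist] by auto
  have vW: "vert k (\<psi> u) (0, \<eta>) = ?z"
    by (simp add: vert_def coframe_linear_simps c0)
  have dW: "dvert k (\<psi> u) (?d X) (0, \<eta>) = d2unu k ?w (snd (?d X)) \<eta>" for X
    by (simp add: dvert_def coframe_linear_simps c0)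
  have Wd: "dvert k (\<psi> u) (0, \<eta>) (?d X) = d2unu k ?w (snd (?d X)) \<eta> + cross3 (conn (al X u)) ?z" for X
    by (simp add: dvert_def coframe_linear_simps c0 al_d\<psi>[OF u] d2unu_commute[of k ?w \<eta>])
  have "dirderiv (\<lambda>v. vert k (\<psi> v) (dirderiv \<psi> v Y)) u X = dirderiv (\<lambda>v. \<sigma> *\<^sub>R cov Y nn v) u X" for X Y
    by (rule dirderiv_cong_open[OF open_Sk u, THEN fun_cong]) (rule vert_d\<psi>)
  \<comment> \<open>Differentiating \<open>vert_d\<psi>\<close> trades this derivative of
    \<open>vert\<close> for the normal; the second derivative of \<psi> it introduces cancels the
    leading term of \<open>hessian_pairing\<close>.\<close>
  then have dd: "dvert k (\<psi> u) (?d X) (?d Y) = \<sigma> *\<^sub>R dirderiv (cov Y nn) u X - vert k (\<psi> u) (dirderiv (\<lambda>v. dirderiv \<psi> v Y) u X)" for X Y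
    by (simp add: dirderiv_vert[OF d\<psi> d2\<psi>] dirderiv_linear_compose[OF linear_scaleR smooth_on_differentiable[OF smooth_cov[OF smooth_nn] S]]
        algebra_simps)
  have cc: "cov X (cov Y nn) u = dirderiv (cov Y nn) u X + cross3 (conn (al X u)) (cov Y nn u)" for X Y
    by (simp add: cov_def[of X "cov Y nn"])
  have swap: "?z \<bullet> cross3 c v = - (v \<bullet> cross3 c ?z)" for c v
    using cross3_inner_swap[of c v ?z] by (simp add: inner_commute)
  show ?thesis
    unfolding hessian_pairing unfolding dirderiv_gr_metric
    unfolding dW Wd dd vert_d\<psi>[OF u] gr_metric_eq vW cc dirderiv_commute[OF open_Sk u smooth_\<psi>, of Y X]
    by (simp add: coframe_linear_simps c0 inner_add_left inner_add_right inner_diff_left inner_diff_right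
        cross3_inner_swap inner_commute field_simps, simp add: swap)
qed

text \<open>Each tangent direction \<open>al X u\<close> is, up to the factor \<open>rad\<close>,
  the derivative of \<open>unu\<close> in some fibre direction, so pairing with that direction reads
  off the corresponding component of the rough Laplacian.\<close>

lemma laplacian_of_vertically_harmonic:
  assumes u: "u \<in> Sk"
    and vh: "vertical_component G fst (gr_chart E k (gauss_map F u)) (gauss_tension g \<kappa> E k F u) = 0"
  shows "trM u (\<lambda>A B. cov A (cov B nn) u \<bullet> al X u - cov X nn u \<bullet> cov A (al B) u) = 0"
proof -
  note S = Sk_D(1)[OF u]
  have "al X u \<bullet> nu k (snd (\<psi> u)) = 0"
    using al_nn[OF S] Sk_D[OF u] by (simp add: \<psi>_eq[OF u] nu_wk)
  then obtain \<eta> where \<eta>: "dunu k (snd (\<psi> u)) \<eta> = rad k (snd (\<psi> u)) *\<^sub>R al X u"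
    by (rule dunu_surj)
  let ?r = "\<kappa> * \<sigma> * rad k (snd (\<psi> u))"
  have "G (\<psi> u) (gauss_tension g \<kappa> E k F u) (0, \<eta>) = 0"
    using vh vertical_component_eq_0_iff[of G "\<psi> u", OF pos_inner_gr_metric[OF \<kappa>]] by (simp add: \<psi>_def)
  then have 0: "trM u (\<lambda>A B. G (\<psi> u) (cov_hessian gM G \<psi> u A B) (0, \<eta>)) = 0"
    by (simp only: gauss_tension_pairing)
  obtain Z where Z: "cov X nn u = al Z u" using cov_nn_expand[OF S] .
  have "cov (christoffel gM u A B) nn u \<bullet> al X u = cov X nn u \<bullet> cov A (al B) u" for A B
    unfolding shape_sym[OF S, of _ X] Z using al_christoffel[OF S, of A B Z] by (simp add: inner_commute)
  then have h: "G (\<psi> u) (cov_hessian gM G \<psi> u A B) (0, \<eta>) = ?r *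
      ((cov A (cov B nn) u \<bullet> al X u + cov B (cov A nn) u \<bullet> al X u) / 2 - cov X nn u \<bullet> cov A (al B) u)" for A B
    unfolding vertical_hessian_pairing[OF u] \<eta>
    by (simp add: inner_diff_left inner_add_left algebra_simps)
  \<comment> \<open>The Gram matrix is symmetric, so the average over both orders has the same trace
    as either order.\<close>
  have "trM u (\<lambda>A B. G (\<psi> u) (cov_hessian gM G \<psi> u A B) (0, \<eta>)) =
      ?r * trM u (\<lambda>A B. cov A (cov B nn) u \<bullet> al X u - cov X nn u \<bullet> cov A (al B) u)"
    unfolding h
      trM_eq[OF S, of "\<lambda>A B. ?r * ((cov A (cov B nn) u \<bullet> al X u + cov B (cov A nn) u \<bullet> al X u) / 2 - cov X nn u \<bullet> cov A (al B) u)"]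
      trM_eq[OF S, of "\<lambda>A B. cov A (cov B nn) u \<bullet> al X u - cov X nn u \<bullet> cov A (al B) u"]
    using det_gM_pos[OF S] by (simp add: field_simps)
  then show ?thesis
    using 0 \<kappa> \<sigma> rad_pos[of k "snd (\<psi> u)"] by auto
qed

end

section \<open>Horizontal planes\<close>

context surface
begin

lemma open_nn_nonzero: "open {u \<in> S. nn u $ i \<noteq> 0}"
proof -
  have "continuous_on S (\<lambda>u. nn u $ i)"
    using smooth_on_continuous[OF smooth_nn] by (intro continuous_intros)
  from continuous_open_preimage[OF this open_S, of "- {0}"]
  show ?thesis by (simp add: vimage_def Int_def open_delete Compl_eq_Diff_UNIV)
qed

lemma smooth_al_nth_zero:
  assumes "open U" "u \<in> U" "U \<subseteq> S" "\<And>v. v \<in> U \<Longrightarrow> al Y v $ i = 0"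
  shows "dirderiv (al Y) u X $ i = 0"
proof -
  have "u \<in> S" using assms by auto
  have "dirderiv (al Y) u X $ i = dirderiv (\<lambda>v. al Y v $ i) u X"
    by (rule dirderiv_linear_compose[OF linear_vec_nth differentiable_al[OF \<open>u \<in> S\<close>], symmetric])
  also have "\<dots> = dirderiv (\<lambda>v. 0) u X"
    by (rule dirderiv_cong_open[OF assms(1,2), THEN fun_cong]) (rule assms(4))
  finally show ?thesis by simp
qed

text \<open>A surface tangent to the planes orthogonal to \<open>E\<^sub>1\<close> or \<open>E\<^sub>3\<close> cannot exist, because
  these distributions are not integrable.\<close>

lemma normal_not_axis:
  assumes u: "u \<in> S" and prods: "\<And>v. v \<in> S \<Longrightarrow> nn v $ 1 * nn v $ 2 = 0"
    "\<And>v. v \<in> S \<Longrightarrow> nn v $ 1 * nn v $ 3 = 0" "\<And>v. v \<in> S \<Longrightarrow> nn v $ 2 * nn v $ 3 = 0"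
    and i: "i = 1 \<or> i = 3"
  shows "nn u $ i = 0"
proof (rule ccontr)
  assume ni: "nn u $ i \<noteq> 0"
  let ?U = "{v \<in> S. nn v $ i \<noteq> 0}"
  \<comment> \<open>Where the \<open>i\<close>-th component of the normal is nonzero the products
    force the other two to vanish, so the surface is orthogonal to the \<open>i\<close>-th frame
    vector on an open set.\<close>
  have z: "al Y v $ i = 0" if "v \<in> ?U" for Y v
  proof -
    have v: "v \<in> S" "nn v $ i \<noteq> 0" using that by auto
    then show ?thesis
      using al_nn[OF v(1), of Y] prods[OF v(1)] i by (auto simp: inner_3)
  qed
  have d: "dirderiv (al Y) u X $ i = 0" for X Y
    by (rule smooth_al_nth_zero[OF open_nn_nonzero[of i]]) (use u ni z in auto)
  let ?a = "al (axis 1 1) u" and ?b = "al (axis 2 1) u"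
  obtain c where c: "c \<noteq> 0" "cross3 ?a ?b = c *\<^sub>R nn u" using cross_al[OF u] .
  \<comment> \<open>Torsion-freeness in component \<open>i\<close>, with no derivative terms left.
    The difference of the sides is a structure constant, \<open>s - m\<close> or
    \<open>s + m\<close>, times a nonzero multiple of \<open>nn u $ i\<close>.\<close>
  have "cross3 (conn ?a) ?b $ i = cross3 (conn ?b) ?a $ i"
    using arg_cong[OF cov_al_commute[OF u, of "axis 1 1" "axis 2 1"], of "\<lambda>x. x $ i"] by (simp add: cov_def d)
  then have "(s - m) * cross3 ?a ?b $ i = 0 \<or> (s + m) * cross3 ?a ?b $ i = 0"
    using i by (elim disjE) (simp_all add: cross_components conn_nth algebra_simps)
  then show False using c ni m_pos m_less_s by auto
qed

text \<open>The frame vectors E1 and E3 form an orthonormal basis of the tangent plane, in which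
  this bilinear form has zero diagonal.\<close>

lemma trM_off_diagonal:
  assumes u: "u \<in> S" and p: "\<And>X. al X u $ 2 = 0"
  shows "trM u (\<lambda>X Y. c * (al X u $ 1 * al Y u $ 3 + al X u $ 3 * al Y u $ 1)) = 0"
  unfolding trM_eq[OF u, of "\<lambda>X Y. c * (al X u $ 1 * al Y u $ 3 + al X u $ 3 * al Y u $ 1)"] inner_3 p
  by (simp add: algebra_simps)

end

locale plane_surface = surface +
  assumes nn_plane: "\<And>u. u \<in> S \<Longrightarrow> nn u $ 1 = 0" "\<And>u. u \<in> S \<Longrightarrow> nn u $ 3 = 0"
begin

lemma nn_2: "u \<in> S \<Longrightarrow> nn u $ 2 = 1 \<or> nn u $ 2 = - 1"
  using nn_unit[of u] nn_plane[of u] by (simp add: inner_3 square_eq_1_iff)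

lemma al_2: "u \<in> S \<Longrightarrow> al X u $ 2 = 0"
  using al_nn[of u X] nn_plane[of u] nn_2[of u] by (auto simp: inner_3)

lemma dF_3: "u \<in> S \<Longrightarrow> dirderiv F u X $ 3 = 0"
  using al_2[of u X] by (simp add: al_def coframe_nth)

lemma dal_2: "u \<in> S \<Longrightarrow> dirderiv (al Y) u X $ 2 = 0"
  by (rule smooth_al_nth_zero[OF open_S _ subset_refl al_2])

text \<open>The second fundamental form is purely off-diagonal in E1 and E3 with entries plus or
  minus \<open>m\<close>, so it is traceless but not zero.\<close>

lemma minimal_plane:
  assumes u: "u \<in> S"
  shows "mean_curvature g F n u = 0"
proof -
  have "cov X nn u \<bullet> al Y u = (m * nn u $ 2) * (al X u $ 1 * al Y u $ 3 + al X u $ 3 * al Y u $ 1)" for X Y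
    unfolding cov_nn_al[OF u]
    by (simp add: inner_3 nn_plane[OF u] cov_def dal_2[OF u] cross_components conn_nth algebra_simps)
  then show ?thesis
    using trM_off_diagonal[OF u al_2[OF u], of "m * nn u $ 2"] by (simp add: mean_curvature_eq[OF u])
qed

end

text \<open>Bundle chart 2 consists of graphs over the plane of E3 and E1, so the Gauss map of a
  horizontal surface has fibre coordinate constantly 0.\<close>

locale plane_chart = surface_chart _ _ _ _ _ _ _ 2 + plane_surface
begin

lemma \<psi>_plane: "u \<in> Sk \<Longrightarrow> \<psi> u = (F u, 0)"
  using nn_plane[OF Sk_D(1)] by (simp add: \<psi>_eq wk_def vec_eq_iff forall_2 vector_2 numeral_mod_3)

lemma d\<psi>_plane: "u \<in> Sk \<Longrightarrow> dirderiv \<psi> u X = (dirderiv F u X, 0)"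
proof -
  assume u: "u \<in> Sk"
  have "dirderiv (\<lambda>v. snd (\<psi> v)) u X = snd (dirderiv \<psi> u X)"
    by (rule dirderiv_linear_compose[OF linear_snd smooth_on_differentiable[OF smooth_\<psi> u]])
  moreover have "dirderiv (\<lambda>v. snd (\<psi> v)) u X = dirderiv (\<lambda>v. 0) u X"
    by (rule dirderiv_cong_open[OF open_Sk u, THEN fun_cong]) (simp add: \<psi>_plane)
  ultimately show ?thesis using fst_d\<psi>[OF u] by (simp add: prod_eq_iff)
qed

text \<open>On z = const the ambient metric has constant coefficients. Formally,
  \<open>twist\<close> vanishes there and the cross product term is normal, so the coordinate
  Hessian of \<open>F\<close> is tangential and equals the induced Christoffel term.\<close>

lemma flat_plane:
  assumes u: "u \<in> Sk"
  shows "dirderiv (\<lambda>v. dirderiv F v Y) u X = dirderiv F u (christoffel gM u X Y)"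
proof -
  note S = Sk_D(1)[OF u]
  let ?R = "dirderiv (\<lambda>v. dirderiv F v Y) u X - dirderiv F u (christoffel gM u X Y)"
  have tw: "twist (al X u) (al Y u) = 0"
    by (rule vec3_eqI) (simp_all add: twist_nth al_2[OF S])
  have R: "coframe (F u) ?R = dirderiv (al Y) u X - al (christoffel gM u X Y) u"
    using coframe_hessian_F[OF S, of Y X]
    by (simp add: coframe_linear_simps coframe_christoffel tw cov_def flip: al_def)
  have "coframe (F u) ?R = 0"
  proof (rule tangent_eq_0[OF S])
    fix W
    have "cross3 (conn (al X u)) (al Y u) \<bullet> al W u = 0"
      by (simp add: inner_3 cross_components conn_nth al_2[OF S])
    then show "coframe (F u) ?R \<bullet> al W u = 0"
      using al_christoffel[OF S, of X Y W] by (simp add: R inner_diff_left inner_add_left cov_def)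
    show "coframe (F u) ?R \<bullet> nn u = 0"
      using al_nn[OF S] by (simp add: R inner_diff_left inner_3 nn_plane[OF S] dal_2[OF S] al_2[OF S])
  qed
  then show ?thesis using coframe_eq_0 by fastforce
qed

text \<open>The pairing runs over all vectors \<open>W\<close>, since the horizontal part of the
  tension must vanish too. Flatness cancels the second derivatives (\<open>k1\<close>), the metric
  does not change along the plane (\<open>k2\<close>), and the last Koszul term (\<open>k3\<close>)
  is traceless.\<close>

lemma harmonic_plane:
  assumes u: "u \<in> Sk"
  shows "gauss_tension g \<kappa> E 2 F u = 0"
proof -
  note S = Sk_D(1)[OF u]
  let ?d = "dirderiv \<psi> u" and ?P = "\<psi> u"
  have c0: "conn 0 = 0" "twist 0 a = 0" "twist a 0 = 0" "cross3 a 0 = 0" for a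
    using linear_0[OF linear_conn] bilinear_lzero[OF bilinear_twist] bilinear_rzero[OF bilinear_twist] by auto
  have un: "unu 2 (snd ?P) $ 1 = 0" "unu 2 (snd ?P) $ 3 = 0" "unu 2 (snd ?P) $ 2 = 1"
  proof -
    have "\<sigma> * nn u $ 2 = 1" using u \<sigma> nn_2[OF S] by (auto simp: Sk_def)
    then show "unu 2 (snd ?P) $ 1 = 0" "unu 2 (snd ?P) $ 3 = 0" "unu 2 (snd ?P) $ 2 = 1"
      by (simp_all add: unu_\<psi>[OF u] nn_plane[OF S])
  qed
  have du: "dunu 2 (snd ?P) \<eta> $ 2 = 0" for \<eta>
    using unu_dunu[of 2 "snd ?P" \<eta>] by (simp add: inner_3 un)
  have lz: "lnu 2 0 = 0" "dunu 2 w 0 = 0" for w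
    using linear_0[OF linear_lnu] linear_0[OF linear_dunu] by auto
  have tw: "twist (al X u) b = 0" for X b
    by (rule vec3_eqI) (simp_all add: twist_nth al_2[OF S])
  have d2: "d2unu 2 w 0 \<xi> = 0" "d2unu 2 w \<xi> 0 = 0" for w \<xi>
    by (simp_all add: d2unu_def lz)
  have dv: "dvert 2 ?P (?d X) \<xi> = 0" for X \<xi>
    by (simp add: dvert_def al_d\<psi>[OF u]) (simp add: d\<psi>_plane[OF u] d2 lz tw c0)
  have k1: "G ?P (dirderiv (\<lambda>v. dirderiv \<psi> v Y) u X) W = G ?P (?d (christoffel gM u X Y)) W" for X Y W
  proof -
    have "dirderiv (\<lambda>v. dirderiv \<psi> v Y) u X = dirderiv (\<lambda>v. (dirderiv F v Y, 0)) u X"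
      by (rule dirderiv_cong_open[OF open_Sk u, THEN fun_cong]) (rule d\<psi>_plane)
    also have "\<dots> = (dirderiv (\<lambda>v. dirderiv F v Y) u X, 0)"
      by (rule dirderiv_linear_compose[where L="\<lambda>x. (x, 0)"])
        (auto intro!: linearI smooth_on_differentiable[OF smooth_on_dirderiv[OF smooth_F] S])
    finally show ?thesis by (simp add: flat_plane[OF u] d\<psi>_plane[OF u])
  qed
  have k2: "dirderiv (\<lambda>Q. G Q (?d Y) W) ?P (?d X) = 0" for X Y W
    by (simp add: dirderiv_gr_metric dv al_d\<psi>[OF u] tw)
  \<comment> \<open>Only the component of \<open>W\<close> that changes z matters. It changes the
    metric by an off-diagonal form in E1 and E3; the factor \<open>1 + \<kappa> * m\<^sup>2\<close>
    collects the horizontal and the vertical contribution.\<close>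
  have k3: "dirderiv (\<lambda>Q. G Q (?d X) (?d Y)) ?P W =
      (coframe (fst ?P) (fst W) $ 2 * (l1\<^sup>2 - l2\<^sup>2) * (1 + \<kappa> * m\<^sup>2)) * (al X u $ 1 * al Y u $ 3 + al X u $ 3 * al Y u $ 1)" for X Y W
  proof -
    let ?\<beta> = "coframe (fst ?P) (fst W) $ 2"
    have v: "vert 2 ?P (?d X) $ 1 = m * al X u $ 3" "vert 2 ?P (?d X) $ 2 = 0" "vert 2 ?P (?d X) $ 3 = m * al X u $ 1" for X
      unfolding vert_def al_d\<psi>[OF u] by (simp_all add: d\<psi>_plane[OF u] lz cross_components un conn_nth)
    have w: "dvert 2 ?P W (?d X) $ 1 = m * l1\<^sup>2 * ?\<beta> * al X u $ 1" "dvert 2 ?P W (?d X) $ 3 = - (m * l2\<^sup>2 * ?\<beta> * al X u $ 3)" for X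
      unfolding dvert_def al_d\<psi>[OF u]
      by (simp_all add: d\<psi>_plane[OF u] d2 cross_components un conn_nth twist_nth al_2[OF S] du)
    show ?thesis
      unfolding dirderiv_gr_metric al_d\<psi>[OF u]
      by (simp add: inner_3 twist_nth al_2[OF S] v w power2_eq_square algebra_simps)
  qed
  have "G ?P (gauss_tension g \<kappa> E 2 F u) W = G ?P 0 W" for W
  proof -
    let ?c = "- (coframe (fst ?P) (fst W) $ 2 * (l1\<^sup>2 - l2\<^sup>2) * (1 + \<kappa> * m\<^sup>2) / 2)"
    have h: "G ?P (cov_hessian gM G \<psi> u X Y) W = ?c * (al X u $ 1 * al Y u $ 3 + al X u $ 3 * al Y u $ 1)" for X Y
      unfolding hessian_pairing k1 k2 k3 by (simp add: field_simps)
    show ?thesis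
      unfolding gauss_tension_pairing h trM_off_diagonal[OF S al_2[OF S], of ?c]
      by (simp add: bilinear_lzero[OF bilinear_G])
  qed
  then show ?thesis by (rule pos_inner_eq[OF pos_inner_gr_metric[OF \<kappa>]])
qed

end

context surface
begin

lemma plane_harmonic:
  assumes pl: "\<And>u. u \<in> S \<Longrightarrow> nn u $ 1 = 0" "\<And>u. u \<in> S \<Longrightarrow> nn u $ 3 = 0"
    and "\<kappa> > 0" and u: "u \<in> S" and dom: "gauss_map F u \<in> gr_chart_domain E k"
  shows "gauss_tension g \<kappa> E k F u = 0"
proof -
  interpret pl: plane_surface by unfold_locales (use pl in auto)
  have "nn u $ k \<noteq> 0" using dom gauss_map_domain[OF u] by simp
  then have k: "k = 2" using exhaust_3[of k] pl u by auto
  interpret pc: plane_chart l1 l2 S F n \<kappa> "nn u $ 2"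
    by unfold_locales (use assms pl.nn_2[OF u] in auto)
  have "u \<in> pc.Sk"
    using u pl.nn_2[OF u] by (auto simp: pc.Sk_def)
  then show ?thesis unfolding k by (rule pc.harmonic_plane)
qed

lemma normal_of_vertically_harmonic:
  assumes "\<kappa> > 0" and H: "\<And>u. u \<in> S \<Longrightarrow> mean_curvature g F n u = H"
    and vh: "\<And>u k. u \<in> S \<Longrightarrow> gauss_map F u \<in> gr_chart_domain E k \<Longrightarrow>
      vertical_component (gr_metric g \<kappa> E k) fst (gr_chart E k (gauss_map F u)) (gauss_tension g \<kappa> E k F u) = 0"
    and u: "u \<in> S" and i: "i = 1 \<or> i = 3"
  shows "nn u $ i = 0"
proof (rule normal_not_axis[OF u _ _ _ i])
  fix v assume v: "v \<in> S"
  have "nn v \<noteq> 0" using nn_unit[OF v] by auto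
  then obtain k where k: "nn v $ k \<noteq> 0" by (auto simp: vec_eq_iff)
  interpret sc: surface_chart l1 l2 S F n \<kappa> "sgn (nn v $ k)" k
    by unfold_locales (use assms(1) k in \<open>auto simp: sgn_if\<close>)
  have "v \<in> sc.Sk" using v k unfolding sc.Sk_def by (auto simp: sgn_if)
  from sc.laplacian_of_vertically_harmonic[OF this vh[OF v]] k
  have "cross3 (curv (cross3 (al (axis 1 1) v) (al (axis 2 1) v))) (nn v) = 0"
    by (intro ricci_of_laplacian[OF H v]) (simp_all add: gauss_map_domain[OF v])
  from ricci_eigenvector[OF v this]
  show "nn v $ 1 * nn v $ 2 = 0" "nn v $ 1 * nn v $ 3 = 0" "nn v $ 2 * nn v $ 3 = 0" by auto
qed

end

section \<open>Charts adapted to a horizontal plane\<close>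

text \<open>Bootstrapping: the derivative of \<open>h\<close> is the inverse of that of
  \<open>G\<close>, evaluated at \<open>h\<close>. If \<open>h\<close> is C^j, so is its derivative,
  and \<open>h\<close> is C^(j+1).\<close>

lemma smooth_inverse_2:
  fixes G h :: "real^2 \<Rightarrow> real^2"
  assumes U: "open U" and V: "open V" and G: "smooth_on U G" and hom: "homeomorphism U V G h"
    and h: "\<And>y. y \<in> V \<Longrightarrow> h differentiable (at y)"
    and inj: "\<And>x. x \<in> U \<Longrightarrow> inj (dirderiv G x)"
  shows "smooth_on V h"
proof -
  have hV: "h y \<in> U" "G (h y) = y" if "y \<in> V" for y
    using that hom by (auto simp: homeomorphism_def)
  define a b c d where "a x = dirderiv G x (axis 1 1) $ 1" and "b x = dirderiv G x (axis 2 1) $ 1"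
    and "c x = dirderiv G x (axis 1 1) $ 2" and "d x = dirderiv G x (axis 2 1) $ 2" for x
  \<comment> \<open>Cramer's rule for the inverse of the derivative of \<open>G\<close>.\<close>
  define K where "K X x = (1 / (a x * d x - b x * c x)) *\<^sub>R
      ((d x * X$1 - b x * X$2) *\<^sub>R axis 1 1 + (a x * X$2 - c x * X$1) *\<^sub>R axis 2 1 :: real^2)" for X :: "real^2" and x
  have sm: "smooth_on U a" "smooth_on U b" "smooth_on U c" "smooth_on U d"
    unfolding a_def[abs_def] b_def[abs_def] c_def[abs_def] d_def[abs_def]
    by (intro smooth_on_nth[OF U] smooth_on_dirderiv G)+
  have ex: "dirderiv G x X = (X$1 * a x + X$2 * b x) *\<^sub>R axis 1 1 + (X$1 * c x + X$2 * d x) *\<^sub>R axis 2 1" if "x \<in> U" for x X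
  proof -
    note lin = linear_dirderiv[OF smooth_on_differentiable[OF G that]]
    have "X = X$1 *\<^sub>R axis 1 1 + X$2 *\<^sub>R axis 2 1"
      by (simp add: vec_eq_iff forall_2 axis_def)
    then have "dirderiv G x X = X$1 *\<^sub>R dirderiv G x (axis 1 1) + X$2 *\<^sub>R dirderiv G x (axis 2 1)"
      by (metis linear_add[OF lin] linear_scale[OF lin])
    then show ?thesis by (simp add: vec_eq_iff forall_2 axis_def a_def b_def c_def d_def)
  qed
  have det: "a x * d x - b x * c x \<noteq> 0" if x: "x \<in> U" for x
  proof
    assume 0: "a x * d x - b x * c x = 0"
    note lin = linear_dirderiv[OF smooth_on_differentiable[OF G x]]
    have k: "X = 0" if "dirderiv G x X = 0" for X
      using that linear_injective_0[OF lin] inj[OF x] by blast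
    \<comment> \<open>If the determinant vanished, the columns of the adjugate matrix would lie in
      the kernel; injectivity then makes all entries zero.\<close>
    have "dirderiv G x (vector [d x, - c x]) = 0" "dirderiv G x (vector [- b x, a x]) = 0"
      using 0 by (simp_all add: ex[OF x] vector_2 vec_eq_iff forall_2 axis_def algebra_simps)
    then have "vector [d x, - c x] = (0::real^2)" "vector [- b x, a x] = (0::real^2)"
      using k by blast+
    then have "d x = 0" "c x = 0" "b x = 0" "a x = 0"
      by (simp_all add: vec_eq_iff forall_2 vector_2)
    then have "dirderiv G x (axis 1 1) = 0" by (simp add: ex[OF x])
    then show False using k[of "axis 1 1"] by (simp add: axis_eq_0_iff)
  qed
  have K: "smooth_on U (K X)" for X
    unfolding K_def[abs_def]
    by (intro smooth_on_scaleR smooth_on_add smooth_on_diff smooth_on_mult smooth_on_divide smooth_on_const U sm det)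
  have dh: "dirderiv h y X = K X (h y)" if y: "y \<in> V" for y X
  proof -
    let ?Z = "dirderiv h y X"
    have "dirderiv (\<lambda>y. G (h y)) y X = dirderiv (\<lambda>y. y) y X"
      by (rule dirderiv_cong_open[OF V y, THEN fun_cong]) (rule hV)
    then have "dirderiv G (h y) ?Z = X"
      using dirderiv_chain[OF h[OF y] smooth_on_differentiable[OF G hV(1)[OF y]]]
      by (simp add: dirderiv_def)
    then have e: "X = (?Z$1 * a (h y) + ?Z$2 * b (h y)) *\<^sub>R axis 1 1 + (?Z$1 * c (h y) + ?Z$2 * d (h y)) *\<^sub>R axis 2 1"
      using ex[OF hV(1)[OF y], of ?Z] by simp
    have X: "X$1 = ?Z$1 * a (h y) + ?Z$2 * b (h y)" "X$2 = ?Z$1 * c (h y) + ?Z$2 * d (h y)"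
      using arg_cong[OF e, of "\<lambda>v. v $ 1"] arg_cong[OF e, of "\<lambda>v. v $ 2"] by (simp_all add: axis_def)
    have "(1 / (a (h y) * d (h y) - b (h y) * c (h y))) * (d (h y) * X$1 - b (h y) * X$2) = ?Z$1"
      "(1 / (a (h y) * d (h y) - b (h y) * c (h y))) * (a (h y) * X$2 - c (h y) * X$1) = ?Z$2"
      unfolding X using det[OF hV(1)[OF y]] by (simp_all add: field_simps)
    then show ?thesis by (simp add: K_def vec_eq_iff forall_2 axis_def)
  qed
  have "Ck_on j V h" for j
  proof (induction j)
    case 0
    then show ?case using hom by (simp add: homeomorphism_def)
  next
    case (Suc j)
    have "Ck_on j V (\<lambda>y. K X (h y))" for X
      by (rule Ck_on_compose[OF V U]) (use hV(1) K Suc in \<open>auto simp: smooth_on_def\<close>)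
    then have "Ck_on j V (\<lambda>y. dirderiv h y X)" for X
      by (rule Ck_on_cong[OF V, rotated]) (simp add: dh)
    then show ?case using h by simp
  qed
  then show ?thesis by (simp add: smooth_on_def)
qed

lemma smooth_inverse_function_2:
  fixes G :: "real^2 \<Rightarrow> real^2"
  assumes U: "open U" and G: "smooth_on U G" and x0: "x0 \<in> U" and inj: "inj (dirderiv G x0)"
  obtains U' V h where "open U'" "U' \<subseteq> U" "x0 \<in> U'" "open V" "homeomorphism U' V G h" "smooth_on V h"
proof -
  have bl: "bounded_linear (dirderiv G x)" if "x \<in> U" for x
    using linear_dirderiv[OF smooth_on_differentiable[OF G that]] by (simp add: linear_conv_bounded_linear)
  define f' where "f' x = Blinfun (dirderiv G x)" for x
  have f': "blinfun_apply (f' x) = dirderiv G x" if "x \<in> U" for x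
    using bounded_linear_Blinfun_apply[OF bl[OF that]] by (simp add: f'_def)
  have der: "(G has_derivative blinfun_apply (f' x)) (at x)" if "x \<in> U" for x
    using has_derivative_dirderiv[OF smooth_on_differentiable[OF G that]] by (simp add: f' that)
  have cont: "continuous_on U f'"
  proof (rule continuous_on_blinfun_componentwise)
    fix i :: "real^2"
    have "continuous_on U (\<lambda>x. dirderiv G x i)"
      by (rule smooth_on_continuous[OF smooth_on_dirderiv[OF G]])
    then show "continuous_on U (\<lambda>x. blinfun_apply (f' x) i)"
      using f' by (simp cong: continuous_on_cong)
  qed
  obtain k where k: "linear k" "k \<circ> dirderiv G x0 = id"
    using linear_injective_left_inverse[OF linear_dirderiv[OF smooth_on_differentiable[OF G x0]] inj] by blast
  have "Blinfun k o\<^sub>L f' x0 = id_blinfun"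
    using k by (intro blinfun_eqI)
      (simp add: f'[OF x0] bounded_linear_Blinfun_apply linear_conv_bounded_linear fun_eq_iff)
  from inverse_function_theorem[OF U der cont x0 this]
  obtain U' V h h' where *: "open U'" "U' \<subseteq> U" "x0 \<in> U'" "open V" "homeomorphism U' V G h"
    "\<And>y. y \<in> V \<Longrightarrow> (h has_derivative (h' y)) (at y)"
    "\<And>y. y \<in> V \<Longrightarrow> bij (blinfun_apply (f' (h y)))"
    by metis
  have "smooth_on V h"
  proof (rule smooth_inverse_2[OF *(1,4) smooth_on_subset[OF G *(2)] *(5)])
    show "h differentiable (at y)" if "y \<in> V" for y
      using *(6)[OF that] by (auto simp: differentiable_def)
    show "inj (dirderiv G x)" if "x \<in> U'" for x
    proof -
      have "G x \<in> V" "h (G x) = x" using that *(5) by (auto simp: homeomorphism_def)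
      then have "bij (blinfun_apply (f' x))" using *(7) by metis
      then show ?thesis using that *(2) f' by (auto simp: bij_def)
    qed
  qed
  then show ?thesis using that * by blast
qed

section \<open>Charts, reparametrization and left translations\<close>

lemma is_chart_D:
  assumes "is_chart M (D, \<phi>)"
  shows "openin M D" "open (\<phi> ` D)" "homeomorphic_map (subtopology M D) (top_of_set (\<phi> ` D)) \<phi>" "inj_on \<phi> D"
proof -
  show *: "openin M D" "open (\<phi> ` D)" "homeomorphic_map (subtopology M D) (top_of_set (\<phi> ` D)) \<phi>"
    using assms by (auto simp: is_chart_def)
  have "topspace (subtopology M D) = D"
    using openin_subset[OF *(1)] by auto
  then show "inj_on \<phi> D"
    using homeomorphic_imp_injective_map[OF *(3)] by simp
qed

lemma chart_image_open:
  assumes c: "is_chart M (D, \<phi>)" and W: "openin M W"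
  shows "open (\<phi> ` (D \<inter> W))"
proof -
  note c = is_chart_D[OF c]
  have "openin (subtopology M D) (D \<inter> W)"
    using W c(1) by (simp add: openin_open_subtopology openin_Int)
  then have "openin (top_of_set (\<phi> ` D)) (\<phi> ` (D \<inter> W))"
    using homeomorphic_map_openness_eq[OF c(3)] by blast
  then show ?thesis using c(2) openin_open_eq by blast
qed

lemma chart_preimage_open:
  assumes c: "is_chart M (D, \<phi>)" and U: "open U"
  shows "openin M {q \<in> D. \<phi> q \<in> U}"
proof -
  note c = is_chart_D[OF c]
  have t: "topspace (subtopology M D) = D" using openin_subset[OF c(1)] by auto
  have "continuous_map (subtopology M D) (top_of_set (\<phi> ` D)) \<phi>"
    by (rule homeomorphic_imp_continuous_map[OF c(3)])
  from openin_continuous_map_preimage[OF this openin_open_Int[OF U]]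
  have "openin (subtopology M D) {q \<in> D. \<phi> q \<in> \<phi> ` D \<inter> U}" by (simp only: t)
  then have "openin M {q \<in> D. \<phi> q \<in> \<phi> ` D \<inter> U}"
    using c(1) openin_trans_full by blast
  also have "{q \<in> D. \<phi> q \<in> \<phi> ` D \<inter> U} = {q \<in> D. \<phi> q \<in> U}" by auto
  finally show ?thesis .
qed

text \<open>Transition maps of the new chart factor through the old ones, with \<open>h\<close> in
  front in one direction and \<open>G\<close> behind in the other.\<close>

lemma smooth_chart_reparametrize:
  fixes \<phi> :: "'m \<Rightarrow> real^2"
  assumes M: "smooth_2manifold M A" and c: "(D, \<phi>) \<in> A"
    and U: "open U" "U \<subseteq> \<phi> ` D" and V: "open V" and G: "smooth_on U G" and hom: "homeomorphism U V G h"
    and h: "smooth_on V h"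
  shows "smooth_chart M A ({q \<in> D. \<phi> q \<in> U}, G \<circ> \<phi>)"
proof -
  define W where "W = {q \<in> D. \<phi> q \<in> U}"
  have chart: "is_chart M c'" and compat: "compatible (D, \<phi>) c'" if "c' \<in> A" for c'
    using M c that unfolding smooth_2manifold_def by blast+
  note cD = is_chart_D[OF chart[OF c]]
  have W: "openin M W" unfolding W_def by (rule chart_preimage_open[OF chart[OF c] U(1)])
  have \<phi>W: "\<phi> ` W = U" using U(2) by (auto simp: W_def)
  have WD: "W \<subseteq> D" "W \<subseteq> topspace M" using openin_subset[OF W] by (auto simp: W_def)
  have GU: "G ` U = V" "h ` V = U" "\<And>x. x \<in> U \<Longrightarrow> h (G x) = x" "\<And>y. y \<in> V \<Longrightarrow> G (h y) = y"
    using hom by (auto simp: homeomorphism_def)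
  have img: "(G \<circ> \<phi>) ` W = V" unfolding image_comp[symmetric] \<phi>W by (rule GU(1))
  have "homeomorphic_map (subtopology (subtopology M D) W) (subtopology (top_of_set (\<phi> ` D)) U) \<phi>"
    using WD U(2) \<phi>W openin_subset[OF cD(1)]
    by (intro homeomorphic_map_subtopologies[OF cD(3)]) (auto simp: Int_absorb1 Int_absorb2)
  then have 1: "homeomorphic_map (subtopology M W) (top_of_set U) \<phi>"
    using WD U(2) by (simp add: subtopology_subtopology Int_absorb1)
  have 2: "homeomorphic_map (top_of_set U) (top_of_set V) G"
    by (rule homeomorphic_maps_imp_map[of _ _ _ h])
      (use hom in \<open>auto simp: homeomorphic_maps_def homeomorphism_def\<close>)
  have is_chart: "is_chart M (W, G \<circ> \<phi>)"
    unfolding is_chart_def prod.case img using W V homeomorphic_map_compose[OF 1 2] by blast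
  note inj = is_chart_D(4)[OF is_chart]
  have "compatible (W, G \<circ> \<phi>) (D', \<phi>')" if c': "(D', \<phi>') \<in> A" for D' \<phi>'
  proof -
    note c'D = is_chart_D[OF chart[OF c']]
    have s1: "smooth_on (\<phi> ` (D \<inter> D')) (\<phi>' \<circ> inv_into D \<phi>)" and s2: "smooth_on (\<phi>' ` (D \<inter> D')) (\<phi> \<circ> inv_into D' \<phi>')"
      using compat[OF c'] by (auto simp: compatible_def)
    have o1: "open ((G \<circ> \<phi>) ` (W \<inter> D'))" by (rule chart_image_open[OF is_chart c'D(1)])
    have o2: "open (\<phi>' ` (W \<inter> D'))" using chart_image_open[OF chart[OF c'] W] by (simp add: Int_commute)
    have o3: "open (\<phi> ` (D \<inter> D'))" by (rule chart_image_open[OF chart[OF c] c'D(1)])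
    have sub: "(G \<circ> \<phi>) ` (W \<inter> D') \<subseteq> V" using img by auto
    have hG: "h ((G \<circ> \<phi>) q) = \<phi> q" if "q \<in> W" for q using that GU(3) by (auto simp: W_def)
    have "smooth_on ((G \<circ> \<phi>) ` (W \<inter> D')) (\<lambda>y. (\<phi>' \<circ> inv_into D \<phi>) (h y))"
      by (rule smooth_on_compose[OF o1 o3 s1 smooth_on_subset[OF h sub]]) (use WD hG in auto)
    then have "smooth_on ((G \<circ> \<phi>) ` (W \<inter> D')) (\<phi>' \<circ> inv_into W (G \<circ> \<phi>))"
    proof (rule smooth_on_cong[OF o1, rotated])
      fix y assume "y \<in> (G \<circ> \<phi>) ` (W \<inter> D')"
      then obtain q where q: "q \<in> W" "y = (G \<circ> \<phi>) q" by auto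
      then have "inv_into W (G \<circ> \<phi>) y = q" "inv_into D \<phi> (h y) = q"
        using inj cD(4) WD hG by (auto simp: inv_into_f_f simp del: o_apply)
      then show "(\<phi>' \<circ> inv_into D \<phi>) (h y) = (\<phi>' \<circ> inv_into W (G \<circ> \<phi>)) y" by simp
    qed
    moreover have "smooth_on (\<phi>' ` (W \<inter> D')) (\<lambda>y. G ((\<phi> \<circ> inv_into D' \<phi>') y))"
    proof (rule smooth_on_compose[OF o2 U(1) G])
      show "smooth_on (\<phi>' ` (W \<inter> D')) (\<phi> \<circ> inv_into D' \<phi>')"
        by (rule smooth_on_subset[OF s2]) (use WD in auto)
      show "(\<phi> \<circ> inv_into D' \<phi>') ` \<phi>' ` (W \<inter> D') \<subseteq> U"
        using c'D(4) by (auto simp: inv_into_f_f W_def)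
    qed
    ultimately show ?thesis by (simp add: compatible_def o_def)
  qed
  then show ?thesis
    unfolding smooth_chart_def W_def[symmetric] using is_chart by auto
qed

lemma locally_constant_on_connected:
  assumes C: "connectedin M C" and loc: "\<And>p. p \<in> topspace M \<Longrightarrow> \<exists>W. openin M W \<and> p \<in> W \<and> (\<forall>q\<in>W. f q = f p)"
    and p: "p \<in> C" and q: "q \<in> C"
  shows "f p = f q"
proof (rule ccontr)
  assume ne: "f p \<noteq> f q"
  have op: "openin M {x \<in> topspace M. P (f x)}" for P
  proof (subst openin_subopen, intro ballI)
    fix x assume "x \<in> {x \<in> topspace M. P (f x)}"
    then obtain W where W: "openin M W" "x \<in> W" "\<forall>q\<in>W. f q = f x" and "P (f x)" using loc by blast
    have "q \<in> topspace M \<and> P (f q)" if "q \<in> W" for q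
      using W(3)[rule_format, OF that] \<open>P (f x)\<close> openin_subset[OF W(1)] that by auto
    then show "\<exists>T. openin M T \<and> x \<in> T \<and> T \<subseteq> {x \<in> topspace M. P (f x)}"
      using W(1,2) by (intro exI[of _ W]) auto
  qed
  have CM: "C \<subseteq> topspace M" using C by (rule connectedin_subset_topspace)
  have "C \<subseteq> {x \<in> topspace M. f x = f p} \<union> {x \<in> topspace M. f x \<noteq> f p}"
    "{x \<in> topspace M. f x = f p} \<inter> {x \<in> topspace M. f x \<noteq> f p} \<inter> C = {}"
    "{x \<in> topspace M. f x = f p} \<inter> C \<noteq> {}" "{x \<in> topspace M. f x \<noteq> f p} \<inter> C \<noteq> {}"
    using CM p q ne by auto
  then show False
    using C op[of "\<lambda>y. y = f p"] op[of "\<lambda>y. y \<noteq> f p"] unfolding connectedin by blast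
qed

text \<open>Left translation by \<open>(0, 0, z)\<close>.\<close>

definition E2_screw :: "real \<Rightarrow> real^3 \<Rightarrow> real^3" where
  "E2_screw z p = vector [cos z * p$1 - sin z * p$2, sin z * p$1 + cos z * p$2, p$3 + z]"

definition rot3 :: "real \<Rightarrow> real^3 \<Rightarrow> real^3" where
  "rot3 z X = vector [cos z * X$1 - sin z * X$2, sin z * X$1 + cos z * X$2, X$3]"

lemma linear_rot3: "linear (rot3 z)"
  by (intro linearI vec3_eqI) (simp_all add: rot3_def vector_3 algebra_simps)

lemma E2_screw_eq: "E2_screw z p = rot3 z p + z *\<^sub>R axis 3 1"
  by (rule vec3_eqI) (simp_all add: E2_screw_def rot3_def vector_3)

lemma smooth_E2_screw: "smooth_on UNIV (E2_screw z)"
  unfolding E2_screw_eq[abs_def]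
  by (intro smooth_on_add smooth_on_linear[OF _ linear_rot3] smooth_on_id smooth_on_const open_UNIV)

lemma dirderiv_E2_screw: "dirderiv (E2_screw z) p X = rot3 z X"
proof -
  have "(E2_screw z has_derivative rot3 z) (at p)"
    unfolding E2_screw_eq[abs_def]
    by (rule has_derivative_eq_rhs[OF has_derivative_add[OF bounded_linear_imp_has_derivative has_derivative_const]])
      (use linear_rot3 in \<open>simp_all add: linear_conv_bounded_linear\<close>)
  then show ?thesis by (simp add: dirderiv_eq)
qed

lemma E2_screw_add: "E2_screw a (E2_screw b p) = E2_screw (a + b) p"
  by (rule vec3_eqI) (simp_all add: E2_screw_def vector_3 cos_add sin_add algebra_simps)

lemma E2_screw_0: "E2_screw 0 p = p"
  by (rule vec3_eqI) (simp_all add: E2_screw_def vector_3)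

context e2
begin

text \<open>Left-invariance of the frame: the translation turns the first two coordinates by
  \<open>z\<close> and advances the frame angle by the same amount.\<close>

lemma coframe_E2_screw: "coframe (E2_screw z p) (rot3 z X) = coframe p X"
proof -
  have "cos z * cos z + sin z * sin z = 1"
    using sin_cos_squared_add2[of z] by (simp add: power2_eq_square)
  then have sc: "x * (cos z * cos z) + x * (sin z * sin z) = x" for x
    by (metis distrib_left mult.right_neutral)
  have 1: "- sin (p$3 + z) * (cos z * X$1 - sin z * X$2) + cos (p$3 + z) * (sin z * X$1 + cos z * X$2)
      = - sin (p$3) * X$1 + cos (p$3) * X$2"
    using sc[of "sin (p$3) * X$1"] sc[of "cos (p$3) * X$2"] by (simp add: cos_add sin_add algebra_simps)
  have 2: "cos (p$3 + z) * (cos z * X$1 - sin z * X$2) + sin (p$3 + z) * (sin z * X$1 + cos z * X$2)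
      = cos (p$3) * X$1 + sin (p$3) * X$2"
    using sc[of "cos (p$3) * X$1"] sc[of "sin (p$3) * X$2"] by (simp add: cos_add sin_add algebra_simps)
  have "E2_screw z p $ 3 = p$3 + z" "rot3 z X $ 1 = cos z * X$1 - sin z * X$2"
    "rot3 z X $ 2 = sin z * X$1 + cos z * X$2" "rot3 z X $ 3 = X$3"
    by (simp_all add: E2_screw_def rot3_def vector_3)
  then show ?thesis
    by (intro vec3_eqI) (simp_all only: coframe_nth 1 2)
qed

lemma isometry_E2_screw: "riemannian_isometry g (E2_screw z)"
proof -
  have l: "E2_screw (- z) (E2_screw z p) = p" and r: "E2_screw z (E2_screw (- z) p) = p" for p
    by (simp_all add: E2_screw_add E2_screw_0)
  have "bij (E2_screw z)" by (rule bij_betw_byWitness[of _ "E2_screw (- z)"]) (auto simp: l r)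
  moreover have "inv (E2_screw z) = E2_screw (- z)"
    by (rule inv_unique_comp) (auto simp: fun_eq_iff l r)
  ultimately show ?thesis
    by (simp add: riemannian_isometry_def smooth_E2_screw g_eq dirderiv_E2_screw coframe_E2_screw)
qed

end

context plane_surface
begin

lemma height_locally_constant:
  assumes u: "u \<in> S"
  obtains B where "open B" "u \<in> B" "B \<subseteq> S" "\<And>v. v \<in> B \<Longrightarrow> F v $ 3 = F u $ 3"
proof -
  obtain r where r: "r > 0" "ball u r \<subseteq> S" using open_S u open_contains_ball by metis
  have const: "F v $ 3 = F u $ 3" if v: "v \<in> ball u r" for v
  proof (rule has_derivative_zero_unique_connected[where f="\<lambda>v. F v $ 3"])
    fix x assume "x \<in> ball u r"
    then have x: "x \<in> S" using r by auto
    have "((\<lambda>v. F v $ 3) has_derivative (\<lambda>X. dirderiv F x X $ 3)) (at x)"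
      by (rule bounded_linear.has_derivative[OF bounded_linear_vec_nth has_derivative_dirderiv[OF differentiable_F[OF x]]])
    then show "((\<lambda>v. F v $ 3) has_derivative (\<lambda>X. 0)) (at x)" by (simp add: dF_3[OF x])
  qed (use v r in auto)
  show ?thesis by (rule that[OF open_ball _ r(2) const]) (use r in simp_all)
qed

text \<open>After translation to height 0 the third coordinate is constant, so the first two already
  form an immersion of the plane, and the inverse function theorem makes them a local chart.\<close>

lemma planar_chart:
  assumes u: "u \<in> S"
  obtains U V G h where "open U" "U \<subseteq> S" "u \<in> U" "open V" "smooth_on U G" "homeomorphism U V G h" "smooth_on V h"
    "\<And>v. v \<in> U \<Longrightarrow> E2_screw (- (F u $ 3)) (F v) = horizontal_plane (G v)"
proof -
  obtain B where B: "open B" "u \<in> B" "B \<subseteq> S" and F3: "\<And>v. v \<in> B \<Longrightarrow> F v $ 3 = F u $ 3"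
    using height_locally_constant[OF u] by metis
  define T where "T v = E2_screw (- (F u $ 3)) (F v)" for v
  define G :: "real^2 \<Rightarrow> real^2" where "G v = T v $ 1 *\<^sub>R axis 1 1 + T v $ 2 *\<^sub>R axis 2 1" for v
  have smT: "smooth_on B T"
    unfolding T_def[abs_def]
    by (rule smooth_on_compose[OF B(1) open_UNIV smooth_E2_screw smooth_on_subset[OF smooth_F B(3)]]) simp
  have smG: "smooth_on B G"
    unfolding G_def[abs_def] by (intro smooth_on_add smooth_on_scaleR smooth_on_nth smT smooth_on_const B(1))
  have dT: "dirderiv T u X = rot3 (- (F u $ 3)) (dirderiv F u X)" for X
    unfolding T_def[abs_def]
    using dirderiv_chain[OF differentiable_F[OF u], of "E2_screw (- (F u $ 3))"]
      smooth_on_differentiable[OF smooth_E2_screw UNIV_I] by (simp add: dirderiv_E2_screw)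
  have "dirderiv G u X $ i = dirderiv T u X $ (if i = 1 then 1 else 2)" for X i
  proof -
    have "dirderiv G u X $ i = dirderiv (\<lambda>v. G v $ i) u X"
      by (rule dirderiv_linear_compose[OF linear_vec_nth smooth_on_differentiable[OF smG B(2)], symmetric])
    also have "(\<lambda>v. G v $ i) = (\<lambda>v. T v $ (if i = 1 then 1 else 2))"
      using exhaust_2[of i] by (auto simp: G_def axis_def)
    also have "dirderiv \<dots> u X = dirderiv T u X $ (if i = 1 then 1 else 2)"
      by (rule dirderiv_linear_compose[OF linear_vec_nth smooth_on_differentiable[OF smT B(2)]])
    finally show ?thesis .
  qed
  note dG = this
  have "X = 0" if "dirderiv G u X = 0" for X
  proof -
    have "dirderiv T u X = 0"
      using dG[of X 1] dG[of X 2] that by (intro vec3_eqI) (simp_all add: dT rot3_def vector_3 dF_3[OF u])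
    then have "coframe (E2_screw (- (F u $ 3)) (F u)) (rot3 (- (F u $ 3)) (dirderiv F u X)) = 0"
      by (simp add: dT coframe_linear_simps)
    then show "X = 0"
      unfolding coframe_E2_screw using al_eq_0[OF u, of X] by (simp add: al_def)
  qed
  then have "inj (dirderiv G u)"
    using linear_injective_0[OF linear_dirderiv[OF smooth_on_differentiable[OF smG B(2)]]] by blast
  then obtain U V h where "open U" "U \<subseteq> B" "u \<in> U" "open V" "homeomorphism U V G h" "smooth_on V h"
    using smooth_inverse_function_2[OF B(1) smG B(2)] by metis
  moreover have "T v = horizontal_plane (G v)" if "v \<in> B" for v
    using F3[OF that] by (intro vec3_eqI) (simp_all add: horizontal_plane_def vector_3 G_def axis_def, simp add: T_def E2_screw_def vector_3)
  ultimately show ?thesis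
    using that[of U V G h] smG smooth_on_subset B(3) unfolding T_def by (metis subset_iff)
qed

end

section \<open>From charts to whole surfaces\<close>

context e2
begin

lemma surface_in_chart:
  assumes f: "immersed_surface g M A f N" and c: "c \<in> A"
  shows "surface l1 l2 (chart_image c) (in_chart c f) (in_chart c N)"
proof unfold_locales
  have "is_chart M c" using f c by (auto simp: immersed_surface_def smooth_2manifold_def)
  then show "open (chart_image c)" by (auto simp: is_chart_def chart_image_def split: prod.splits)
qed (use f c in \<open>auto simp: immersed_surface_def Let_def\<close>)

lemma plane_surface_conclusions:
  assumes pl: "\<And>c. c \<in> A \<Longrightarrow> plane_surface l1 l2 (chart_image c) (in_chart c f) (in_chart c N)" and \<kappa>: "\<kappa> > 0"
  shows "minimal g A f N" "harmonic_gauss_map g \<kappa> E A f"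
proof -
  show "minimal g A f N"
    unfolding minimal_def has_mean_curvature_def using plane_surface.minimal_plane[OF pl] by blast
  have "gauss_tension g \<kappa> E k (in_chart c f) u = 0"
    if "c \<in> A" "u \<in> chart_image c" "gauss_map (in_chart c f) u \<in> gr_chart_domain E k" for c u k
  proof -
    interpret plane_surface l1 l2 "chart_image c" "in_chart c f" "in_chart c N" by (rule pl[OF that(1)])
    show ?thesis using plane_harmonic[OF nn_plane \<kappa> that(2,3)] by blast
  qed
  then show "harmonic_gauss_map g \<kappa> E A f" by (simp add: harmonic_gauss_map_def Let_def)
qed

lemma plane_surface_of_vertically_harmonic:
  assumes f: "immersed_surface g M A f N" and H: "cmc g A f N" and vh: "vertically_harmonic_gauss_map g \<kappa> E A f"
    and \<kappa>: "\<kappa> > 0" and c: "c \<in> A"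
  shows "plane_surface l1 l2 (chart_image c) (in_chart c f) (in_chart c N)"
proof -
  interpret surface l1 l2 "chart_image c" "in_chart c f" "in_chart c N" by (rule surface_in_chart[OF f c])
  obtain h where h: "\<And>u. u \<in> chart_image c \<Longrightarrow> mean_curvature g (in_chart c f) (in_chart c N) u = h"
    using H c unfolding cmc_def has_mean_curvature_def by blast
  have "nn u $ i = 0" if "u \<in> chart_image c" "i = 1 \<or> i = 3" for u i
    by (rule normal_of_vertically_harmonic[OF \<kappa> h _ that])
      (use vh c in \<open>auto simp: vertically_harmonic_gauss_map_def Let_def\<close>)
  then show ?thesis by unfold_locales auto
qed

text \<open>The local parametrizations use the translation by minus the height of their own base
  point. The height is locally constant, hence constant on a component, so one translation serves
  all its points.\<close>

lemma local_planar_parametrization: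
  assumes f: "immersed_surface g M A f N"
    and pl: "\<And>c. c \<in> A \<Longrightarrow> plane_surface l1 l2 (chart_image c) (in_chart c f) (in_chart c N)"
    and C: "C \<in> connected_components_of M"
  shows "\<exists>\<Phi>. riemannian_isometry g \<Phi> \<and> (\<forall>p\<in>C. \<exists>W \<xi>. smooth_chart M A (W, \<xi>) \<and> p \<in> W \<and>
    (\<forall>q\<in>W. \<Phi> (f q) = horizontal_plane (\<xi> q)))"
proof -
  have man: "smooth_2manifold M A" using f by (simp add: immersed_surface_def)
  have chart: "is_chart M c" if "c \<in> A" for c using man that by (simp add: smooth_2manifold_def)
  have cover: "\<exists>D \<phi>. (D, \<phi>) \<in> A \<and> p \<in> D" if "p \<in> topspace M" for p
    using man that unfolding smooth_2manifold_def by fastforce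
  have in_chart: "in_chart (D, \<phi>) f (\<phi> q) = f q" if "(D, \<phi>) \<in> A" "q \<in> D" for D \<phi> q
    using is_chart_D(4)[OF chart[OF that(1)]] that(2) by (simp add: in_chart_def)
  have param: "\<exists>W \<xi>. smooth_chart M A (W, \<xi>) \<and> p \<in> W \<and> (\<forall>q\<in>W. E2_screw (- (f p $ 3)) (f q) = horizontal_plane (\<xi> q))"
    if p: "p \<in> topspace M" for p
  proof -
    obtain D \<phi> where c: "(D, \<phi>) \<in> A" "p \<in> D" using cover[OF p] by blast
    interpret plane_surface l1 l2 "chart_image (D, \<phi>)" "in_chart (D, \<phi>) f" "in_chart (D, \<phi>) N" by (rule pl[OF c(1)])
    have im: "chart_image (D, \<phi>) = \<phi> ` D" by (simp add: chart_image_def)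
    then have "\<phi> p \<in> chart_image (D, \<phi>)" using c by simp
    then obtain U V G h where U: "open U" "U \<subseteq> \<phi> ` D" "\<phi> p \<in> U" and V: "open V" "smooth_on U G" "homeomorphism U V G h" "smooth_on V h"
      and G: "\<And>v. v \<in> U \<Longrightarrow> E2_screw (- (in_chart (D, \<phi>) f (\<phi> p) $ 3)) (in_chart (D, \<phi>) f v) = horizontal_plane (G v)"
      unfolding im by (rule planar_chart[unfolded im]) (rule that)
    have "smooth_chart M A ({q \<in> D. \<phi> q \<in> U}, G \<circ> \<phi>)"
      by (rule smooth_chart_reparametrize[OF man c(1) U(1,2) V(1,2,3,4)])
    moreover have "E2_screw (- (f p $ 3)) (f q) = horizontal_plane ((G \<circ> \<phi>) q)" if "q \<in> {q \<in> D. \<phi> q \<in> U}" for q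
      using G[of "\<phi> q"] that in_chart[OF c(1)] c(2) by simp
    ultimately show ?thesis using c(2) U(3) by blast
  qed
  have CM: "C \<subseteq> topspace M" by (rule connected_components_of_subset[OF C])
  obtain p0 where p0: "p0 \<in> C" using nonempty_connected_components_of[OF C] by auto
  have loc: "\<exists>W. openin M W \<and> p \<in> W \<and> (\<forall>q\<in>W. f q $ 3 = f p $ 3)" if p: "p \<in> topspace M" for p
  proof -
    obtain W \<xi> where W: "smooth_chart M A (W, \<xi>)" "p \<in> W" "\<forall>q\<in>W. E2_screw (- (f p $ 3)) (f q) = horizontal_plane (\<xi> q)"
      using param[OF p] by blast
    have "f q $ 3 = f p $ 3" if "q \<in> W" for q
      using arg_cong[OF W(3)[rule_format, OF that], of "\<lambda>x. x $ 3"] by (simp add: E2_screw_def horizontal_plane_def vector_3)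
    moreover have "openin M W" using W(1) by (simp add: smooth_chart_def is_chart_def)
    ultimately show ?thesis using W(2) by blast
  qed
  have "f p $ 3 = f p0 $ 3" if "p \<in> C" for p
    by (rule locally_constant_on_connected[of M C "\<lambda>p. f p $ 3", OF connectedin_connected_components_of[OF C] loc that p0])
  then show ?thesis
    using param CM isometry_E2_screw by (intro exI[of _ "E2_screw (- (f p0 $ 3))"]) (metis subsetD)
qed

text \<open>The frame vector E2, whose coordinates do not depend on the point.\<close>

definition vertical_normal :: "real^3" where "vertical_normal = vector [0, 0, l1 * l2]"

lemma linear_horizontal_plane: "linear horizontal_plane"
  by (intro linearI vec3_eqI) (simp_all add: horizontal_plane_def vector_3)

lemma horizontal_plane_surface:
  assumes U: "open U"
  shows "immersed_surface g (top_of_set U) {(U, id)} horizontal_plane (\<lambda>_. vertical_normal)"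
    and "plane_surface l1 l2 (chart_image (U, id)) (in_chart (U, id) horizontal_plane) (in_chart (U, id) (\<lambda>_. vertical_normal))"
proof -
  let ?F = "in_chart (U, id) horizontal_plane" and ?n = "in_chart (U, id) (\<lambda>_. vertical_normal)"
  have ci: "chart_image (U, id) = U" by (simp add: chart_image_def)
  \<comment> \<open>\<open>inv_into U id\<close> is the identity only on \<open>U\<close>; hence the
    passage to derivatives goes through congruence on the open set.\<close>
  have F: "?F u = horizontal_plane u" if "u \<in> U" for u
    using that inv_into_f_f[of id U u] by (simp add: in_chart_def)
  have n: "?n = (\<lambda>_. vertical_normal)" by (simp add: in_chart_def fun_eq_iff)
  have sF: "smooth_on U ?F"
    by (rule smooth_on_cong[OF U _ smooth_on_linear[OF U linear_horizontal_plane smooth_on_id]]) (simp add: F)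
  have dF: "dirderiv ?F u X = horizontal_plane X" if "u \<in> U" for u X
  proof -
    have "dirderiv ?F u X = dirderiv horizontal_plane u X"
      by (rule dirderiv_cong_open[OF U that, THEN fun_cong]) (rule F)
    also have "(horizontal_plane has_derivative horizontal_plane) (at u)"
      using linear_horizontal_plane by (simp add: linear_conv_bounded_linear bounded_linear_imp_has_derivative)
    then have "dirderiv horizontal_plane u X = horizontal_plane X" by (simp add: dirderiv_eq)
    finally show ?thesis .
  qed
  then have dF': "dirderiv ?F u = horizontal_plane" if "u \<in> U" for u using that by blast
  have inj: "inj horizontal_plane"
    by (auto intro!: injI simp: horizontal_plane_def vec_eq_iff forall_3 forall_2 vector_3)
  have cn: "coframe p vertical_normal = axis 2 1" for p
    by (rule vec3_eqI) (simp_all add: coframe_nth vertical_normal_def vector_3)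
  have cF: "coframe p (horizontal_plane X) $ 2 = 0" for p X
    by (simp add: coframe_nth horizontal_plane_def vector_3)
  interpret surface l1 l2 U ?F ?n
    by unfold_locales (auto simp: U sF n smooth_on_const dF' inj g_eq cn cF inner_3)
  show "plane_surface l1 l2 (chart_image (U, id)) ?F ?n"
  proof -
    have "nn u = axis 2 1" for u unfolding nn_def by (simp add: n cn)
    then show ?thesis unfolding ci by unfold_locales simp_all
  qed
  have sc: "second_countable (top_of_set U)"
  proof (rule second_countable_subtopology)
    obtain B :: "(real^2) set set" where "countable B" "\<And>C. C \<in> B \<Longrightarrow> open C" "\<And>S. open S \<Longrightarrow> \<exists>U. U \<subseteq> B \<and> S = \<Union>U"
      using univ_second_countable by blast
    then show "second_countable (euclidean :: (real^2) topology)"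
      unfolding second_countable_def by (intro exI[of _ B]) (fastforce simp flip: open_openin)
  qed
  have id: "smooth_on U (id \<circ> inv_into U id)"
    by (rule smooth_on_cong[OF U _ smooth_on_id]) (metis comp_apply f_inv_into_f id_apply image_id)
  have "smooth_2manifold (top_of_set U) {(U, id)}"
    using U sc id by (simp add: smooth_2manifold_def is_chart_def compatible_def Hausdorff_space_subtopology subtopology_subtopology)
  then show "immersed_surface g (top_of_set U) {(U, id)} horizontal_plane (\<lambda>_. vertical_normal)"
    using smooth_F smooth_n immersion unit_normal orth_normal by (simp add: immersed_surface_def ci Let_def)
qed

lemma vertically_harmonic_of_harmonic:
  assumes "\<kappa> > 0" "harmonic_gauss_map g \<kappa> E A f"
  shows "vertically_harmonic_gauss_map g \<kappa> E A f"
proof -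
  have "vertical_component (gr_metric g \<kappa> E k) fst P 0 = 0" for k P
    using pos_inner_gr_metric[OF assms(1), of k P] vertical_component_eq_0_iff[of "gr_metric g \<kappa> E k" P 0]
      bilinear_lzero by (auto simp: pos_inner_def)
  then show ?thesis
    using assms(2) by (simp add: vertically_harmonic_gauss_map_def harmonic_gauss_map_def Let_def)
qed

end

text \<open>The isometry depends on the connected component because components may lie at different
  heights. The second half shows that the classification is attained on every open parameter
  domain.\<close>

theorem theorem5:
  fixes l1 l2 \<kappa> :: real
  assumes "l1 > l2" and "l2 > 0" and "\<kappa> > 0"
  defines "g \<equiv> E2_metric l1 l2" and "E \<equiv> E2_frame l1 l2 (1 / (l1 * l2))"
  shows
    "(\<forall>(M :: 'm topology) A f N.
        immersed_surface g M A f N \<and> cmc g A f N \<and> vertically_harmonic_gauss_map g \<kappa> E A f \<longrightarrow>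
          (\<forall>C \<in> connected_components_of M. \<exists>\<Phi>. riemannian_isometry g \<Phi> \<and>
             (\<forall>p\<in>C. \<exists>W \<xi>. smooth_chart M A (W, \<xi>) \<and> p \<in> W \<and>
                (\<forall>q\<in>W. \<Phi> (f q) = horizontal_plane (\<xi> q)))) \<and>
          minimal g A f N \<and> harmonic_gauss_map g \<kappa> E A f)
     \<and>
     (\<forall>U :: (real^2) set. open U \<longrightarrow>
        (\<exists>N. immersed_surface g (top_of_set U) {(U, id)} horizontal_plane N \<and>
             cmc g {(U, id)} horizontal_plane N \<and>
             vertically_harmonic_gauss_map g \<kappa> E {(U, id)} horizontal_plane \<and>
             minimal g {(U, id)} horizontal_plane N \<and>
             harmonic_gauss_map g \<kappa> E {(U, id)} horizontal_plane))"
proof (intro conjI allI impI)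
  interpret e2 l1 l2 by unfold_locales (use assms in auto)
  {
    fix M :: "'m topology" and A f N
    assume *: "immersed_surface g M A f N \<and> cmc g A f N \<and> vertically_harmonic_gauss_map g \<kappa> E A f"
    have pl: "plane_surface l1 l2 (chart_image c) (in_chart c f) (in_chart c N)" if "c \<in> A" for c
      using plane_surface_of_vertically_harmonic[of M A f N \<kappa>, OF _ _ _ assms(3) that] * unfolding g_def E_def by blast
    show "\<forall>C \<in> connected_components_of M. \<exists>\<Phi>. riemannian_isometry g \<Phi> \<and>
             (\<forall>p\<in>C. \<exists>W \<xi>. smooth_chart M A (W, \<xi>) \<and> p \<in> W \<and>
                (\<forall>q\<in>W. \<Phi> (f q) = horizontal_plane (\<xi> q)))"
      using local_planar_parametrization[of M A f N, OF _ pl] * unfolding g_def by blast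
    show "minimal g A f N" "harmonic_gauss_map g \<kappa> E A f"
      using plane_surface_conclusions[of A f N \<kappa>, OF pl assms(3)] unfolding g_def E_def by blast+
  }
  fix U :: "(real^2) set" assume U: "open U"
  note hp = horizontal_plane_surface[OF U]
  have "plane_surface l1 l2 (chart_image c) (in_chart c horizontal_plane) (in_chart c (\<lambda>_. vertical_normal))"
    if "c \<in> {(U, id)}" for c using hp(2) that by simp
  note con = plane_surface_conclusions[of "{(U, id)}", OF this assms(3)]
  show "\<exists>N. immersed_surface g (top_of_set U) {(U, id)} horizontal_plane N \<and>
             cmc g {(U, id)} horizontal_plane N \<and>
             vertically_harmonic_gauss_map g \<kappa> E {(U, id)} horizontal_plane \<and>
             minimal g {(U, id)} horizontal_plane N \<and>
             harmonic_gauss_map g \<kappa> E {(U, id)} horizontal_plane"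
    unfolding g_def E_def
    using hp(1) con vertically_harmonic_of_harmonic[OF assms(3) con(2)]
    by (intro exI[of _ "\<lambda>_. vertical_normal"]) (auto simp: cmc_def minimal_def)
qed

end
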